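(* Let $d > 3$ be an integer and let $\psi = (\psi_i)_{1 \le i \le d}$ be a $d$-dimensional permanental vector with kernel $G = (G(i,j))_{1 \le i,j \le d}$ and some index $\beta > 0$. Assume that there exists at most one subset $I \subset \{1, \dots, d\}$ of three indexes such that the principal submatrix $G_{I \times I} = (G(i,j))_{(i,j) \in I \times I}$ is symmetrizable. Then $\psi$ is infinitely divisible.
   Context: A real-valued, nonnegative random vector $\psi = (\psi_i)_{1 \le i \le n}$ is a permanental vector with kernel $G = (G(i,j))_{1 \le i,j \le n}$ (a real $n\times n$ matrix) and index $\beta > 0$ if for every $(\alpha_1, \dots, \alpha_n) \in \mathbb{R}_+^n$, $$\mathbb{E}\Big[\exp\Big\{-\tfrac12 \sum_{i=1}^n \alpha_i \psi_i\Big\}\Big] = |I + \alpha G|^{-\beta},$$ where $I$ is the $n\times n$ identity matrix, $\alpha = \mathrm{Diag}((\alpha_i)_{1\le i\le n})$, and $|\cdot|$ denotes the determinant. Two $m\times m$ real matrices $A$ and $B$ are effectively equivalent if $|I + xA| = |I + xB|$ for every diagonal matrix $x = \mathrm{Diag}(x_1,\dots,x_m)$ with $(x_1,\dots,x_m) \in \mathbb{R}^m$. A square matrix is symmetrizable if it is effectively equivalent to a symmetric matrix. A random vector $\psi$ is infinitely divisible if for every integer $k \ge 1$ there exist i.i.d. random vectors $\psi^{(1)}, \dots, \psi^{(k)}$ with $\psi^{(1)} + \dots + \psi^{(k)}$ equal in law to $\psi$. *)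

theory Defs
  imports "HOL-Probability.Probability"
begin

definition permanental_vector ::
  "'a measure \<Rightarrow> ('a \<Rightarrow> real^'n::finite) \<Rightarrow> real^'n^'n \<Rightarrow> real \<Rightarrow> bool" where
  "permanental_vector M psi G beta \<longleftrightarrow>
     prob_space M \<and> psi \<in> borel_measurable M \<and>
     (\<forall>\<omega>\<in>space M. \<forall>i. psi \<omega> $ i \<ge> 0) \<and>
     (\<forall>\<alpha>::real^'n. (\<forall>i. \<alpha> $ i \<ge> 0) \<longrightarrow>
        (\<integral>\<omega>. exp (- (1/2) * (\<Sum>i\<in>UNIV. \<alpha> $ i * psi \<omega> $ i)) \<partial>M)
          = det (mat 1 + (\<chi> i j. if i = j then \<alpha> $ i else 0) ** G) powr (- beta))"

definition det_on :: "'n set \<Rightarrow> ('n \<Rightarrow> 'n \<Rightarrow> real) \<Rightarrow> real" where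
  "det_on I A = (\<Sum>p\<in>{p. p permutes I}. of_int (sign p) * (\<Prod>i\<in>I. A i (p i)))"

definition eff_equiv_on :: "'n set \<Rightarrow> ('n \<Rightarrow> 'n \<Rightarrow> real) \<Rightarrow> ('n \<Rightarrow> 'n \<Rightarrow> real) \<Rightarrow> bool" where
  "eff_equiv_on I A B \<longleftrightarrow>
     (\<forall>x::'n \<Rightarrow> real.
        det_on I (\<lambda>i j. (if i = j then 1 else 0) + x i * A i j)
      = det_on I (\<lambda>i j. (if i = j then 1 else 0) + x i * B i j))"

definition symmetrizable_on :: "'n set \<Rightarrow> ('n \<Rightarrow> 'n \<Rightarrow> real) \<Rightarrow> bool" where
  "symmetrizable_on I A \<longleftrightarrow>
     (\<exists>B. (\<forall>i\<in>I. \<forall>j\<in>I. B i j = B j i) \<and> eff_equiv_on I A B)"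

text \<open>Infinite divisibility: for every k \<ge> 1 there are i.i.d. random vectors
  X 0, ..., X (k-1) (on some probability space, realized on the sample space type
  nat \<Rightarrow> real^'n) whose sum has the law of psi.\<close>
definition infinitely_divisible :: "'a measure \<Rightarrow> ('a \<Rightarrow> real^'n::finite) \<Rightarrow> bool" where
  "infinitely_divisible M psi \<longleftrightarrow>
     (\<forall>k::nat. k \<ge> 1 \<longrightarrow>
       (\<exists>(N :: (nat \<Rightarrow> real^'n) measure) (X :: nat \<Rightarrow> (nat \<Rightarrow> real^'n) \<Rightarrow> real^'n).
          prob_space N \<and>
          (\<forall>j<k. X j \<in> borel_measurable N) \<and>
          prob_space.indep_vars N (\<lambda>_. borel) X {..<k} \<and>
          (\<forall>j<k. distr N borel (X j) = distr N borel (X 0)) \<and>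
          distr N borel (\<lambda>\<omega>. \<Sum>j<k. X j \<omega>) = distr M borel psi))"

end

theory Submission
  imports Defs "HOL-Complex_Analysis.Complex_Analysis"
begin

no_notation fps_nth (infixl "$" 75)

text \<open>
  Let \<open>A = (I + r G)\<^sup>-\<^sup>1\<close>. Mixing Poisson variables over \<open>psi\<close> shows that powers \<open>det (A\<^sub>I + \<delta>) powr (- beta)\<close>, for a diagonal matrix
  \<open>\<delta>\<close>, have nonnegative Taylor coefficients along suitable lines. By a Pringsheim argument the root of smallest
  modulus of the determinant is then real. For pairs this gives \<open>A i j * A j i \<ge> 0\<close>; for triples whose two cyclic
  products differ, a cubic with a dominating pair of complex roots is excluded only if the cyclic products are
  nonpositive. For large \<open>r\<close> every nonsymmetrizable triple of \<open>G\<close> has different cyclic products in \<open>A\<close>, so, with at most one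
  exception and at least four indices, a parity argument makes all off-diagonal entries of \<open>A\<close> nonpositive
  after conjugation with a diagonal sign matrix. Letting \<open>r \<rightarrow> \<infinity>\<close>, \<open>G\<close> is the inverse of an M-matrix (singularity would make two rows proportional and
  hence two triples symmetrizable). Gaussian elimination then expands
  \<open>det (I + \<alpha> G) powr (- b)\<close>, for every \<open>b > 0\<close>, into a positive combination of Laplace transforms of products of gamma laws, and
  \<open>b = beta / k\<close> gives the \<open>k\<close>-th convolution roots.
\<close>

section \<open>Power series with nonnegative coefficients\<close>

text \<open>Everything drawn from \<open>psi\<close> is sign information about \<open>A\<close>, and
  signs do not involve the exponent. This is why one known power \<open>- beta\<close> yields every
  power \<open>- b\<close>. Asymmetry matters because of an identity. Let x, y be the cyclic
  products of a triple and a, b, c its pair products. Then x y = a b c, so (x + y)^2 - 4 a b c = (x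
  - y)^2. If x = y, AM-GM keeps all roots of the cubic real for every choice of diagonal weights,
  and nothing follows about the sign of x. If x and y differ, suitable weights produce a non-real
  pair. Two further obstacles shape the end. The signature could vary with \<open>r\<close>; it is
  fixed at one \<open>r\<close> and moved into the kernel, whose nonnegative entries then force
  trivial signs for all large \<open>r\<close>. And \<open>G\<close> is not known to be invertible,
  so its inverse is built row by row as a limit of normalised resolvent rows.\<close>

text \<open>
  A form of Pringsheim's theorem. On the largest zero-free disc around \<open>0\<close> the series is a holomorphic branch
  of \<open>Q powr (- beta)\<close>; nonnegativity of its coefficients gives \<open>norm (Q z) \<ge> Q (norm z)\<close> there, and letting \<open>z\<close>
  tend to a zero of smallest modulus produces a zero on the positive axis.
\<close>

lemma nonneg_power_series_smallest_root:
  fixes Q :: "complex \<Rightarrow> complex" and q :: "real \<Rightarrow> real" and a :: "nat \<Rightarrow> real"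
  assumes holo: "Q holomorphic_on UNIV" and Qq: "\<And>x. Q (of_real x) = of_real (q x)"
    and a: "\<And>n. a n \<ge> 0" and R: "R > 0"
    and sums: "\<And>h. 0 \<le> h \<Longrightarrow> h < R \<Longrightarrow> (\<lambda>n. a n * h ^ n) sums (q h powr - beta)"
    and beta: "beta > 0"
    and root: "Q z0 = 0"
    and pos: "\<And>x. 0 \<le> x \<Longrightarrow> x \<le> norm z0 \<Longrightarrow> q x > 0"
  shows False
proof -
  have contQ: "continuous_on A Q" for A
    using holomorphic_on_imp_continuous_on[OF holo] continuous_on_subset by blast
  define K where "K = {z. Q z = 0} \<inter> cball 0 (norm z0)"
  have "closed {z. Q z = 0}"
    using continuous_closed_vimage[of "{0}" Q] contQ[of UNIV]
    by (auto simp: vimage_def continuous_on_eq_continuous_at)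
  then have "compact K" unfolding K_def by (intro closed_Int_compact) auto
  moreover have "z0 \<in> K" using root by (simp add: K_def)
  ultimately obtain z1 where z1: "z1 \<in> K" and z1min: "\<And>z. z \<in> K \<Longrightarrow> norm z1 \<le> norm z"
    using continuous_attains_inf[of K norm] by (auto intro: continuous_on_norm_id)
  define r where "r = norm z1"
  have r_le: "r \<le> norm z0" and Qz1: "Q z1 = 0" using z1 by (auto simp: K_def r_def)
  have "Q 0 \<noteq> 0" using Qq[of 0] pos[of 0] by auto
  then have r: "r > 0" using Qz1 by (auto simp: r_def)
  have Qnz: "Q z \<noteq> 0" if "z \<in> ball 0 r" for z
    using z1min[of z] that r_le by (force simp: K_def r_def)
  have Q0: "Q 0 = of_real (q 0)" and q0: "q 0 > 0" using Qq[of 0] pos[of 0] by auto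
  have "Q holomorphic_on ball 0 r" using holo holomorphic_on_subset by blast
  from holomorphic_logarithm_exists[OF convex_ball open_ball this Qnz, of 0] r
  obtain g' where g': "g' holomorphic_on ball 0 r"
    and g'exp: "\<And>x. x \<in> ball 0 r \<Longrightarrow> exp (g' x) = Q x"
    by (metis centre_in_ball)
  \<comment> \<open>The constant makes \<open>g 0\<close> the real logarithm of \<open>Q 0\<close>,
    so that \<open>F\<close> below is the branch agreeing with \<open>q powr - beta\<close> on the
    real axis near \<open>0\<close>.\<close>
  define g where "g z = g' z - g' 0 + Ln (Q 0)" for z
  have g: "g holomorphic_on ball 0 r" unfolding g_def by (intro holomorphic_intros g')
  have g0: "g 0 = Ln (Q 0)" by (simp add: g_def)
  have gexp: "exp (g x) = Q x" if "x \<in> ball 0 r" for x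
    using g'exp[OF that] g'exp[of 0] r \<open>Q 0 \<noteq> 0\<close> by (simp add: g_def exp_add exp_diff)
  define F where "F z = exp (- of_real beta * g z)" for z
  have holF: "F holomorphic_on ball 0 r"
    unfolding F_def by (intro holomorphic_intros g)
  have "Im (g 0) = 0" unfolding g0 Q0 using q0 by simp
  moreover have "isCont g 0"
    using holomorphic_on_imp_continuous_on[OF g] r
    by (simp add: continuous_on_eq_continuous_at)
  ultimately obtain d where d: "d > 0" "\<And>z. norm z < d \<Longrightarrow> \<bar>Im (g z)\<bar> < 1"
  proof -
    assume 1: "Im (g 0) = 0" and 2: "isCont g 0"
      and 3: "\<And>d. 0 < d \<Longrightarrow> (\<And>z. cmod z < d \<Longrightarrow> \<bar>Im (g z)\<bar> < 1) \<Longrightarrow> thesis"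
    from 2 obtain d where "d > 0" "\<And>z. dist z 0 < d \<Longrightarrow> dist (g z) (g 0) < 1"
      unfolding continuous_at_eps_delta by (metis zero_less_one)
    moreover have "\<bar>Im (g z)\<bar> \<le> dist (g z) (g 0)" for z
      using abs_Im_le_cmod[of "g z - g 0"] 1 by (simp add: dist_norm)
    ultimately show thesis using 3[of d] by (metis dist_0_norm dist_commute le_less_trans)
  qed
  define S where "S z = (\<Sum>n. of_real (a n) * z ^ n)" for z :: complex
  have Ssum: "(\<lambda>n. of_real (a n) * z ^ n) sums S z" if "norm z < R" for z
  proof -
    have "summable (\<lambda>n. norm (of_real (a n) * z ^ n :: complex))"
      using sums_summable[OF sums[of "norm z"]] that a by (simp add: norm_mult norm_power)
    then show ?thesis unfolding S_def by (simp add: summable_norm_cancel summable_sums)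
  qed
  have holS: "S holomorphic_on ball 0 R"
    by (rule power_series_holomorphic[where a="\<lambda>n. of_real (a n)"]) (use Ssum in \<open>auto\<close>)
  define m where "m = min d (min r R)"
  have m: "m > 0" "m \<le> d" "m \<le> r" "m \<le> R" using d r R by (auto simp: m_def)
  have FS_real: "F (of_real h) = S (of_real h)" if h: "0 \<le> h" "h < m" for h
  proof -
    have hr: "of_real h \<in> ball (0::complex) r" using h m by auto
    have e: "exp (g (of_real h)) = of_real (q h)" using gexp[OF hr] Qq by simp
    have im: "\<bar>Im (g (of_real h))\<bar> < 1" using d(2)[of "of_real h"] h m by simp
    have qh: "q h > 0" using pos[of h] h m r_le by auto
    \<comment> \<open>Both sides are logarithms of \<open>q h\<close>; their imaginary parts differ
      by less than 2 pi, hence they coincide.\<close>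
    have "g (of_real h) = of_real (ln (q h))"
    proof (rule exp_complex_eqI)
      show "\<bar>Im (g (of_real h)) - Im (of_real (ln (q h)))\<bar> < 2 * pi"
        using im pi_gt3 by simp
      show "exp (g (of_real h)) = exp (of_real (ln (q h)))"
        using qh by (simp only: e exp_of_real exp_ln)
    qed
    then have "F (of_real h) = of_real (q h powr - beta)"
      using qh by (simp add: F_def powr_def flip: exp_of_real)
    moreover have "S (of_real h) = of_real (q h powr - beta)"
    proof (rule sums_unique2)
      show "(\<lambda>n. of_real (a n) * of_real h ^ n :: complex) sums S (of_real h)"
        using Ssum[of "of_real h"] h m by simp
      show "(\<lambda>n. of_real (a n) * of_real h ^ n :: complex) sums of_real (q h powr - beta)"
        using sums_of_real[OF sums[of h], where 'a=complex] h m by simp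
    qed
    ultimately show ?thesis by simp
  qed
  have FS: "F z = S z" if "z \<in> ball 0 m" for z
  proof -
    have lim: "(0::complex) islimpt of_real ` {0..<m}"
      unfolding islimpt_approachable
    proof (intro allI impI)
      fix e :: real assume "e > 0"
      then show "\<exists>x'\<in>complex_of_real ` {0..<m}. x' \<noteq> 0 \<and> dist x' 0 < e"
        using m by (intro bexI[of _ "of_real (min e m / 2)"] imageI) (auto simp: norm_divide simp del: of_real_divide)
    qed
    have "(\<lambda>z. F z - S z) holomorphic_on ball 0 m"
      using holF holS m by (intro holomorphic_intros) (auto elim!: holomorphic_on_subset)
    moreover have "F z - S z = 0" if "z \<in> complex_of_real ` {0..<m}" for z
      using that FS_real by auto
    moreover have "complex_of_real ` {0..<m} \<subseteq> ball 0 m" "0 \<in> ball (0::complex) m"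
      using m by auto
    ultimately have "F z - S z = 0"
      using analytic_continuation[of "\<lambda>z. F z - S z", OF _ open_ball connected_ball _ _ lim _ that] by metis
    then show ?thesis by simp
  qed
  have Fsum0: "(\<lambda>n. (deriv ^^ n) F 0 / fact n * z ^ n) sums F z" if "norm z < r" for z
    using holomorphic_power_series[OF holF, of z] that by simp
  have coef: "(deriv ^^ n) F 0 / fact n = of_real (a n)" for n
  proof -
    have "F has_fps_expansion Abs_fps (\<lambda>n. of_real (a n))"
    proof (rule has_fps_expansionI)
      have "eventually (\<lambda>u. u \<in> ball 0 m) (nhds (0::complex))"
        using m by (intro eventually_nhds_in_open) auto
      then show "eventually (\<lambda>u. (\<lambda>n. fps_nth (Abs_fps (\<lambda>n. of_real (a n))) n * u ^ n) sums F u) (nhds 0)"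
        by (rule eventually_mono) (use FS Ssum m in auto)
    qed
    moreover have "F has_fps_expansion Abs_fps (\<lambda>n. (deriv ^^ n) F 0 / fact n)"
    proof (rule has_fps_expansionI)
      have "eventually (\<lambda>u. u \<in> ball 0 m) (nhds (0::complex))"
        using m by (intro eventually_nhds_in_open) auto
      then show "eventually (\<lambda>u. (\<lambda>n. fps_nth (Abs_fps (\<lambda>n. (deriv ^^ n) F 0 / fact n)) n * u ^ n) sums F u) (nhds 0)"
        by (rule eventually_mono) (use Fsum0 m in auto)
    qed
    ultimately have "Abs_fps (\<lambda>n. of_real (a n)) = Abs_fps (\<lambda>n. (deriv ^^ n) F 0 / fact n)"
      by (rule fps_expansion_unique_complex)
    then show ?thesis by (metis fps_nth_Abs_fps)
  qed
  \<comment> \<open>The \<open>a n\<close> are the Taylor coefficients of the holomorphic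
    \<open>F\<close>, so their series represents \<open>F\<close> on the whole zero-free disc, even
    if \<open>R < r\<close>.\<close>
  have Fsums: "(\<lambda>n. of_real (a n) * z ^ n) sums F z" if "norm z < r" for z
    using holomorphic_power_series[OF holF, of z] that coef by simp
  have F_le: "norm (F z) \<le> norm (F (of_real (norm z)))" if "norm z < r" for z
  proof -
    have 1: "(\<lambda>n. of_real (a n * norm z ^ n)) sums F (of_real (norm z))"
      using Fsums[of "of_real (norm z)"] that by simp
    then have 2: "(\<lambda>n. a n * norm z ^ n) sums Re (F (of_real (norm z)))"
      using sums_Re[OF 1] by simp
    have "norm (F z) \<le> Re (F (of_real (norm z)))"
      using norm_suminf_le[of "\<lambda>n. of_real (a n) * z ^ n" "\<lambda>n. a n * norm z ^ n"] 2 Fsums[OF that] a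
      by (auto simp: norm_mult norm_power sums_iff)
    then show ?thesis using complex_Re_le_cmod order_trans by blast
  qed
  have Q_ge: "norm (Q z) \<ge> q (norm z)" if "norm z < r" for z
  proof -
    have b: "z \<in> ball 0 r" "of_real (norm z) \<in> ball (0::complex) r" using that by auto
    have "Re (g (of_real (norm z))) \<le> Re (g z)"
      using F_le[OF that] beta by (simp add: F_def)
    then have "norm (exp (g (of_real (norm z)))) \<le> norm (exp (g z))" by simp
    then have "norm (Q (of_real (norm z))) \<le> norm (Q z)"
      using gexp[OF b(1)] gexp[OF b(2)] by simp
    then show ?thesis unfolding Qq by simp
  qed
  have contq: "continuous_on UNIV q"
  proof -
    have "continuous_on UNIV (\<lambda>x. Re (Q (of_real x)))"
      by (intro continuous_intros continuous_on_compose2[OF contQ[of UNIV]]) auto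
    then show ?thesis by (simp add: Qq)
  qed
  have "q r \<le> norm (Q z1)"
  proof (rule tendsto_le)
    show "((\<lambda>t. norm (Q (of_real t * z1))) \<longlongrightarrow> norm (Q z1)) (at_left 1)"
      using contQ[of UNIV]
      by (intro tendsto_norm isCont_tendsto_compose[of z1 Q] tendsto_eq_intros)
         (auto simp: continuous_on_eq_continuous_at)
    show "((\<lambda>t. q (t * r)) \<longlongrightarrow> q r) (at_left 1)"
      using contq
      by (intro isCont_tendsto_compose[of r q] tendsto_eq_intros)
         (auto simp: continuous_on_eq_continuous_at)
    show "\<forall>\<^sub>F t in at_left 1. q (t * r) \<le> norm (Q (of_real t * z1))"
    proof (rule eventually_at_leftI[of 0])
      fix t :: real assume "t \<in> {0<..<1}"
      then show "q (t * r) \<le> norm (Q (of_real t * z1))"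
        using Q_ge[of "of_real t * z1"] r by (simp add: norm_mult r_def)
    qed simp
  qed simp
  then show False using Qz1 pos[of r] r r_le by simp
qed

text \<open>
  The same monomial may occur for several indices \<open>j\<close>, so products are closed under the definition without
  collecting coefficients.
\<close>

definition nonneg_series ::
  "('x \<Rightarrow> real) set \<Rightarrow> 'x set \<Rightarrow> 'a measure \<Rightarrow> ('a \<Rightarrow> 'x \<Rightarrow> ennreal) \<Rightarrow> bool" where
  "nonneg_series mon D M f \<longleftrightarrow>
     (\<exists>c m. (\<forall>j::nat. c j \<in> borel_measurable M \<and> m j \<in> mon) \<and>
       (\<forall>\<omega>\<in>space M. \<forall>x\<in>D. f \<omega> x = (\<Sum>j. c j \<omega> * ennreal (m j x))))"

text \<open>Two instances are used: powers of one variable on \<open>{0..<R}\<close> and power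
  products on the unit cube. The sample point \<open>\<omega>\<close> stays a parameter so that
  coefficients may be random until \<open>series_integral\<close> averages them.\<close>

locale monomials =
  fixes mon :: "('x \<Rightarrow> real) set" and D :: "'x set"
  assumes one: "(\<lambda>_. 1) \<in> mon"
    and mult: "m \<in> mon \<Longrightarrow> m' \<in> mon \<Longrightarrow> (\<lambda>x. m x * m' x) \<in> mon"
    and nonneg: "m \<in> mon \<Longrightarrow> x \<in> D \<Longrightarrow> 0 \<le> m x"
begin

abbreviation "series \<equiv> nonneg_series mon D"

lemma series_cong:
  assumes "series M f" "\<And>\<omega> x. \<omega> \<in> space M \<Longrightarrow> x \<in> D \<Longrightarrow> f \<omega> x = g \<omega> x"
  shows "series M g"
  using assms unfolding nonneg_series_def by metis

lemma series_monomial: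
  assumes "g \<in> borel_measurable M" "m \<in> mon"
  shows "series M (\<lambda>\<omega> x. g \<omega> * ennreal (m x))"
  unfolding nonneg_series_def
proof (intro exI[of _ "\<lambda>j \<omega>. if j = 0 then g \<omega> else 0"] exI[of _ "\<lambda>_. m"] conjI allI ballI)
  fix j :: nat
  show "(\<lambda>\<omega>. if j = 0 then g \<omega> else 0) \<in> borel_measurable M" using assms by (cases "j = 0") auto
  fix \<omega> x
  have "(\<Sum>j. (if j = 0 then g \<omega> else 0) * ennreal (m x)) = (\<Sum>j\<in>{0::nat}. (if j = 0 then g \<omega> else 0) * ennreal (m x))"
    by (intro suminf_finite) auto
  then show "g \<omega> * ennreal (m x) = (\<Sum>j::nat. (if j = 0 then g \<omega> else 0) * ennreal (m x))" by simp
qed (use assms in auto)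

lemma series_const: "g \<in> borel_measurable M \<Longrightarrow> series M (\<lambda>\<omega> x. g \<omega>)"
  using series_monomial[OF _ one, of g M] by simp

lemma series_suminf:
  assumes "\<And>k::nat. series M (f k)"
  shows "series M (\<lambda>\<omega> x. \<Sum>k. f k \<omega> x)"
proof -
  from assms obtain c m where cm: "\<And>k j. c k j \<in> borel_measurable M" "\<And>k j. m k j \<in> mon"
     "\<And>k \<omega> x. \<omega> \<in> space M \<Longrightarrow> x \<in> D \<Longrightarrow> f k \<omega> x = (\<Sum>j. c k j \<omega> * ennreal (m k j x))"
    unfolding nonneg_series_def by metis
  show ?thesis
    unfolding nonneg_series_def
  proof (intro exI[of _ "\<lambda>i. case_prod c (prod_decode i)"] exI[of _ "\<lambda>i. case_prod m (prod_decode i)"]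
         conjI allI ballI)
    fix i
    show "case_prod c (prod_decode i) \<in> borel_measurable M" "case_prod m (prod_decode i) \<in> mon"
      using cm(1,2) by (cases "prod_decode i"; simp)+
  next
    fix \<omega> x assume "\<omega> \<in> space M" "x \<in> D"
    then show "(\<Sum>k. f k \<omega> x) =
       (\<Sum>i. (case prod_decode i of (k, j) \<Rightarrow> c k j) \<omega> * ennreal ((case prod_decode i of (k, j) \<Rightarrow> m k j) x))"
      by (subst suminf_ennreal_2dimen[symmetric,
            where f="\<lambda>p. case_prod c p \<omega> * ennreal (case_prod m p x)"]) (auto simp: cm)
  qed
qed

lemma series_add:
  assumes "series M f" "series M g"
  shows "series M (\<lambda>\<omega> x. f \<omega> x + g \<omega> x)"
proof -
  define h where "h k = (if k = 0 then f else if k = 1 then g else (\<lambda>_ _. 0))" for k :: nat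
  have "series M (h k)" for k
    using assms series_const[of "\<lambda>_. 0" M] unfolding h_def by (cases "k = 0"; cases "k = 1"; simp)
  then have "series M (\<lambda>\<omega> x. \<Sum>k. h k \<omega> x)" by (rule series_suminf)
  then show ?thesis
  proof (rule series_cong)
    fix \<omega> x
    have "(\<Sum>k. h k \<omega> x) = (\<Sum>k\<in>{0,1}. h k \<omega> x)"
      by (intro suminf_finite) (auto simp: h_def)
    then show "(\<Sum>k. h k \<omega> x) = f \<omega> x + g \<omega> x" by (simp add: h_def)
  qed
qed

lemma series_monomial_mult:
  assumes "g \<in> borel_measurable M" "m \<in> mon" "series M f"
  shows "series M (\<lambda>\<omega> x. g \<omega> * ennreal (m x) * f \<omega> x)"
proof -
  from assms(3) obtain c n where cm: "\<And>j. c j \<in> borel_measurable M" "\<And>j. n j \<in> mon"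
     "\<And>\<omega> x. \<omega> \<in> space M \<Longrightarrow> x \<in> D \<Longrightarrow> f \<omega> x = (\<Sum>j. c j \<omega> * ennreal (n j x))"
    unfolding nonneg_series_def by metis
  show ?thesis
    unfolding nonneg_series_def
  proof (intro exI[of _ "\<lambda>j \<omega>. g \<omega> * c j \<omega>"] exI[of _ "\<lambda>j x. m x * n j x"] conjI allI ballI)
    fix \<omega> x assume "\<omega> \<in> space M" "x \<in> D"
    then have "g \<omega> * ennreal (m x) * f \<omega> x = (\<Sum>j. g \<omega> * ennreal (m x) * (c j \<omega> * ennreal (n j x)))"
      by (subst cm(3)) (simp_all only: ennreal_suminf_cmult)
    also have "\<dots> = (\<Sum>j. g \<omega> * c j \<omega> * ennreal (m x * n j x))"
      using nonneg[OF assms(2) \<open>x \<in> D\<close>] nonneg[OF cm(2) \<open>x \<in> D\<close>]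
      by (intro suminf_cong) (simp add: ennreal_mult mult_ac)
    finally show "g \<omega> * ennreal (m x) * f \<omega> x = (\<Sum>j. g \<omega> * c j \<omega> * ennreal (m x * n j x))" .
  qed (use assms cm mult in auto)
qed

lemma series_mult:
  assumes "series M f" "series M g"
  shows "series M (\<lambda>\<omega> x. f \<omega> x * g \<omega> x)"
proof -
  from assms(1) obtain c m where cm: "\<And>j. c j \<in> borel_measurable M" "\<And>j. m j \<in> mon"
     "\<And>\<omega> x. \<omega> \<in> space M \<Longrightarrow> x \<in> D \<Longrightarrow> f \<omega> x = (\<Sum>j. c j \<omega> * ennreal (m j x))"
    unfolding nonneg_series_def by metis
  have "series M (\<lambda>\<omega> x. \<Sum>j. c j \<omega> * ennreal (m j x) * g \<omega> x)"
    by (intro series_suminf series_monomial_mult cm assms)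
  then show ?thesis
    by (rule series_cong) (simp add: cm(3))
qed

lemma series_power:
  assumes "series M f"
  shows "series M (\<lambda>\<omega> x. f \<omega> x ^ k)"
proof (induction k)
  case 0
  show ?case using series_const[of "\<lambda>_. 1" M] by simp
next
  case (Suc k)
  show ?case using series_mult[OF assms Suc] by simp
qed

lemma series_prod:
  assumes "finite I" "\<And>i. i \<in> I \<Longrightarrow> series M (f i)"
  shows "series M (\<lambda>\<omega> x. \<Prod>i\<in>I. f i \<omega> x)"
  using assms
proof (induction I rule: finite_induct)
  case empty
  show ?case using series_const[of "\<lambda>_. 1" M] by simp
next
  case (insert i I)
  then show ?case using series_mult[of M "f i" "\<lambda>\<omega> x. \<Prod>i\<in>I. f i \<omega> x"] by simp
qed

text \<open>By Tonelli the expectation is taken coefficient by coefficient. The result does not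
  depend on a sample point, so the space \<open>N\<close> is arbitrary.\<close>

lemma series_integral:
  assumes "series M f"
  shows "series N (\<lambda>_ x. \<integral>\<^sup>+\<omega>. f \<omega> x \<partial>M)"
proof -
  from assms obtain c m where cm: "\<And>j. c j \<in> borel_measurable M" "\<And>j. m j \<in> mon"
     "\<And>\<omega> x. \<omega> \<in> space M \<Longrightarrow> x \<in> D \<Longrightarrow> f \<omega> x = (\<Sum>j. c j \<omega> * ennreal (m j x))"
    unfolding nonneg_series_def by metis
  have "(\<integral>\<^sup>+\<omega>. f \<omega> x \<partial>M) = (\<Sum>j. (\<integral>\<^sup>+\<omega>. c j \<omega> \<partial>M) * ennreal (m j x))" if "x \<in> D" for x
  proof -
    have "(\<integral>\<^sup>+\<omega>. f \<omega> x \<partial>M) = (\<integral>\<^sup>+\<omega>. (\<Sum>j. c j \<omega> * ennreal (m j x)) \<partial>M)"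
      by (intro nn_integral_cong) (simp add: cm that)
    also have "\<dots> = (\<Sum>j. \<integral>\<^sup>+\<omega>. c j \<omega> * ennreal (m j x) \<partial>M)"
      by (intro nn_integral_suminf) (use cm in auto)
    also have "\<dots> = (\<Sum>j. (\<integral>\<^sup>+\<omega>. c j \<omega> \<partial>M) * ennreal (m j x))"
      by (simp add: nn_integral_multc cm)
    finally show ?thesis .
  qed
  then show ?thesis
    unfolding nonneg_series_def
    by (intro exI[of _ "\<lambda>j _. \<integral>\<^sup>+\<omega>. c j \<omega> \<partial>M"] exI[of _ m]) (use cm in auto)
qed

text \<open>The coefficients \<open>pochhammer b k / fact k\<close> of the negative binomial series
  are positive for every \<open>b > 0\<close>; this is where positivity for arbitrary exponents
  comes from.\<close>

lemma series_binomial: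
  fixes f :: "'a \<Rightarrow> 'x \<Rightarrow> real"
  assumes "series M (\<lambda>\<omega> x. ennreal (f \<omega> x))" and b: "b > 0"
    and f: "\<And>\<omega> x. \<omega> \<in> space M \<Longrightarrow> x \<in> D \<Longrightarrow> 0 \<le> f \<omega> x \<and> f \<omega> x < 1"
  shows "series M (\<lambda>\<omega> x. ennreal ((1 - f \<omega> x) powr - b))"
proof -
  have "series M (\<lambda>\<omega> x. \<Sum>k. ennreal (pochhammer b k / fact k) * ennreal (f \<omega> x) ^ k)"
    by (intro series_suminf series_mult series_const series_power assms) auto
  then show ?thesis
  proof (rule series_cong)
    fix \<omega> x assume "\<omega> \<in> space M" "x \<in> D"
    then have fx: "0 \<le> f \<omega> x" "f \<omega> x < 1" using f by auto
    then have "(\<lambda>n. (- b gchoose n) * (- f \<omega> x) ^ n) sums (1 + - f \<omega> x) powr - b"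
      by (intro gen_binomial_real) auto
    also have "(\<lambda>n. (- b gchoose n) * (- f \<omega> x) ^ n) = (\<lambda>n. pochhammer b n / fact n * f \<omega> x ^ n)"
    proof
      fix n
      have "(- f \<omega> x) ^ n = (- 1) ^ n * f \<omega> x ^ n" by (rule power_minus)
      moreover have "(- 1 :: real) ^ n * (- 1) ^ n = 1" by (simp flip: power_add)
      ultimately show "(- b gchoose n) * (- f \<omega> x) ^ n = pochhammer b n / fact n * f \<omega> x ^ n"
        by (simp add: gbinomial_pochhammer)
    qed
    finally have s: "(\<lambda>n. pochhammer b n / fact n * f \<omega> x ^ n) sums (1 - f \<omega> x) powr - b" by simp
    have "(\<Sum>k. ennreal (pochhammer b k / fact k) * ennreal (f \<omega> x) ^ k)
       = (\<Sum>k. ennreal (pochhammer b k / fact k * f \<omega> x ^ k))"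
      using fx b by (intro suminf_cong) (simp add: ennreal_power pochhammer_nonneg flip: ennreal_mult)
    also have "\<dots> = ennreal ((1 - f \<omega> x) powr - b)"
      using s fx b by (intro suminf_ennreal_eq) (auto intro!: divide_nonneg_nonneg mult_nonneg_nonneg pochhammer_nonneg)
    finally show "(\<Sum>k. ennreal (pochhammer b k / fact k) * ennreal (f \<omega> x) ^ k) = ennreal ((1 - f \<omega> x) powr - b)" .
  qed
qed

lemma series_exp:
  fixes f :: "'a \<Rightarrow> 'x \<Rightarrow> real"
  assumes "series M (\<lambda>\<omega> x. ennreal (f \<omega> x))"
    and f: "\<And>\<omega> x. \<omega> \<in> space M \<Longrightarrow> x \<in> D \<Longrightarrow> 0 \<le> f \<omega> x"
  shows "series M (\<lambda>\<omega> x. ennreal (exp (f \<omega> x)))"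
proof -
  have "series M (\<lambda>\<omega> x. \<Sum>k. ennreal (1 / fact k) * ennreal (f \<omega> x) ^ k)"
    by (intro series_suminf series_mult series_const series_power assms) auto
  then show ?thesis
  proof (rule series_cong)
    fix \<omega> x assume "\<omega> \<in> space M" "x \<in> D"
    then have fx: "0 \<le> f \<omega> x" using f by auto
    have "(\<Sum>k. ennreal (1 / fact k) * ennreal (f \<omega> x) ^ k) = (\<Sum>k. ennreal (1 / fact k * f \<omega> x ^ k))"
      using fx by (intro suminf_cong) (simp add: ennreal_power flip: ennreal_mult)
    also have "\<dots> = ennreal (exp (f \<omega> x))"
      using fx exp_converges[of "f \<omega> x"]
      by (intro suminf_ennreal_eq) (auto simp: divide_inverse)
    finally show "(\<Sum>k. ennreal (1 / fact k) * ennreal (f \<omega> x) ^ k) = ennreal (exp (f \<omega> x))" .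
  qed
qed

end

section \<open>Determinants of M-matrices\<close>

lemma det_replace_column:
  fixes a :: "'n::finite \<Rightarrow> real"
  shows "det (\<chi> i j. if j = k then a i else if i = j then 1 else 0) = a k"
proof -
  have "(\<chi> i j. if j = k then a i else if i = j then 1 else 0) =
     (\<chi> i j. if j = k then (mat 1 *v (\<chi> i. a i)) $ i else (mat 1 :: real^'n^'n) $ i $ j)"
    unfolding matrix_vector_mul_lid by (simp add: vec_eq_iff mat_def)
  then show ?thesis using cramer_lemma[of k "mat 1" "\<chi> i. a i"] by simp
qed

lemma det_replace_row:
  fixes a :: "'n::finite \<Rightarrow> real"
  shows "det (\<chi> i j. if i = k then a j else if i = j then 1 else 0) = a k"
proof -
  have "(\<chi> i j. if i = k then a j else if i = j then 1 else 0) =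
      transpose (\<chi> i j. if j = k then a i else if i = j then 1 else (0::real))"
    by (auto simp: transpose_def vec_eq_iff)
  then show ?thesis by (simp only: det_transpose det_replace_column)
qed

text \<open>
  \<open>pad K A\<close> represents the principal submatrix of \<open>A\<close> on \<open>K\<close> inside the full matrix type, so that Gaussian
  elimination can be an induction on \<open>K\<close>.
\<close>

definition pad :: "'n set \<Rightarrow> ('n \<Rightarrow> 'n \<Rightarrow> real) \<Rightarrow> real^'n^'n" where
  "pad K A = (\<chi> i j. if i \<in> K \<and> j \<in> K then A i j else if i = j then 1 else 0)"

text \<open>Schur complement: the padded matrix factors as \<open>L ** A' ** R\<close>, where
  \<open>L\<close> carries the pivot column, \<open>R\<close> the pivot row divided by the pivot,
  and \<open>A'\<close> the complement. Then \<open>det L\<close> is the pivot and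
  \<open>det R = 1\<close>.\<close>

lemma det_pad_insert:
  fixes A :: "'n::finite \<Rightarrow> 'n \<Rightarrow> real"
  assumes k: "k \<notin> K" and akk: "A k k \<noteq> 0"
  shows "det (pad (insert k K) A) = A k k * det (pad K (\<lambda>i j. A i j - A i k * A k j / A k k))"
proof -
  define a where "a i = (if i \<in> insert k K then A i k else 0)" for i
  define b where "b j = (if j \<in> insert k K then A k j / A k k else 0)" for j
  define L where "L = (\<chi> i j. if j = k then a i else if i = j then 1 else (0::real))"
  define R where "R = (\<chi> i j. if i = k then b j else if i = j then 1 else (0::real))"
  define A' where "A' = pad K (\<lambda>i j. A i j - A i k * A k j / A k k)"
  have A'k: "A' $ k $ j = (if k = j then 1 else 0)" "A' $ j $ k = (if k = j then 1 else 0)" for j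
    using k by (auto simp: A'_def pad_def)
  have LA: "(L ** A') $ i $ j = a i * A' $ k $ j + (if i = k then 0 else A' $ i $ j)" for i j
  proof -
    have "(L ** A') $ i $ j = (\<Sum>l\<in>UNIV. (if l = k then a i * A' $ k $ j else 0) +
           (if l = i then (if i = k then 0 else A' $ i $ j) else 0))"
      unfolding matrix_matrix_mult_def L_def vec_lambda_beta by (rule sum.cong) auto
    then show ?thesis by (simp add: sum.distrib)
  qed
  have XR: "(X ** R) $ i $ j = X $ i $ k * b j + (if j = k then 0 else X $ i $ j)" for X i j
  proof -
    have "(X ** R) $ i $ j = (\<Sum>l\<in>UNIV. (if l = k then X $ i $ k * b j else 0) +
           (if l = j then (if j = k then 0 else X $ i $ j) else 0))"
      unfolding matrix_matrix_mult_def R_def vec_lambda_beta by (rule sum.cong) auto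
    then show ?thesis by (simp add: sum.distrib)
  qed
  have "pad (insert k K) A = L ** A' ** R"
    using k akk
    by (auto simp: vec_eq_iff XR LA A'k a_def b_def) (auto simp: A'_def pad_def)
  then show ?thesis
    using det_replace_column[of k a] det_replace_row[of k b] akk
    by (simp add: det_mul L_def[symmetric] R_def[symmetric] A'_def[symmetric]) (simp add: a_def b_def)
qed

context monomials
begin

text \<open>A one-point space replaces the sample space, so the coefficients are constants.\<close>

definition rseries :: "('x \<Rightarrow> real) \<Rightarrow> bool" where
  "rseries f \<longleftrightarrow> (\<forall>x\<in>D. 0 \<le> f x) \<and> series (count_space (UNIV::unit set)) (\<lambda>_ x. ennreal (f x))"

lemma rseries_nonneg: "rseries f \<Longrightarrow> x \<in> D \<Longrightarrow> 0 \<le> f x"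
  by (simp add: rseries_def)

lemma rseries_cong:
  assumes "rseries f" "\<And>x. x \<in> D \<Longrightarrow> f x = g x"
  shows "rseries g"
proof -
  have "series (count_space (UNIV::unit set)) (\<lambda>_ x. ennreal (g x))"
    by (rule series_cong[of _ "\<lambda>_ x. ennreal (f x)"]) (use assms in \<open>auto simp: rseries_def\<close>)
  moreover have "\<forall>x\<in>D. 0 \<le> g x" using assms by (metis rseries_nonneg)
  ultimately show ?thesis by (simp add: rseries_def)
qed

lemma rseries_const: "0 \<le> c \<Longrightarrow> rseries (\<lambda>_. c)"
  unfolding rseries_def by (auto intro: series_const)

lemma rseries_monomial:
  assumes "m \<in> mon"
  shows "rseries m"
proof -
  have "series (count_space (UNIV::unit set)) (\<lambda>_ x. 1 * ennreal (m x))"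
    by (rule series_monomial) (use assms in auto)
  then show ?thesis using nonneg[OF assms] by (simp add: rseries_def)
qed

lemma rseries_add:
  assumes "rseries f" "rseries g"
  shows "rseries (\<lambda>x. f x + g x)"
proof -
  have "series (count_space (UNIV::unit set)) (\<lambda>_ x. ennreal (f x) + ennreal (g x))"
    using assms by (intro series_add) (auto simp: rseries_def)
  then have "series (count_space (UNIV::unit set)) (\<lambda>_ x. ennreal (f x + g x))"
    by (rule series_cong) (use assms in \<open>auto simp: rseries_def\<close>)
  then show ?thesis using assms by (auto simp: rseries_def)
qed

lemma rseries_mult:
  assumes "rseries f" "rseries g"
  shows "rseries (\<lambda>x. f x * g x)"
proof -
  have "series (count_space (UNIV::unit set)) (\<lambda>_ x. ennreal (f x) * ennreal (g x))"
    using assms by (intro series_mult) (auto simp: rseries_def)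
  then have "series (count_space (UNIV::unit set)) (\<lambda>_ x. ennreal (f x * g x))"
    by (rule series_cong) (use assms in \<open>auto simp: rseries_def ennreal_mult\<close>)
  then show ?thesis using assms by (auto simp: rseries_def)
qed

lemma rseries_binomial:
  assumes "rseries f" "\<And>x. x \<in> D \<Longrightarrow> f x < 1" "b > 0"
  shows "rseries (\<lambda>x. (1 - f x) powr - b)"
proof -
  have "series (count_space (UNIV::unit set)) (\<lambda>_ x. ennreal ((1 - f x) powr - b))"
    by (rule series_binomial) (use assms in \<open>auto simp: rseries_def\<close>)
  then show ?thesis by (simp add: rseries_def)
qed

text \<open>Eliminating \<open>k\<close> from I - F leaves I - F' with F' again a matrix of
  nonnegative series, and the weight vector \<open>v\<close> still satisfies F' v < v. So each pivot
  has the form 1 - f with f < 1, and its power \<open>- b\<close> is a binomial series.\<close>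

lemma rseries_det_powr:
  fixes F :: "'n::finite \<Rightarrow> 'n \<Rightarrow> 'x \<Rightarrow> real"
  assumes "\<And>i j. rseries (F i j)" "b > 0" "\<And>i. v i > 0"
    "\<And>x i. x \<in> D \<Longrightarrow> i \<in> K \<Longrightarrow> (\<Sum>j\<in>K. F i j x * v j) < v i"
  shows "rseries (\<lambda>x. det (pad K (\<lambda>i j. (if i = j then 1 else 0) - F i j x)) powr - b) \<and>
    (\<forall>x\<in>D. det (pad K (\<lambda>i j. (if i = j then 1 else 0) - F i j x)) > 0)"
proof -
  have "finite K" by simp
  then show ?thesis using assms(1,4)
  proof (induction K arbitrary: F rule: finite_induct)
    case empty
    have "pad {} A = mat 1" for A :: "'n \<Rightarrow> 'n \<Rightarrow> real" by (auto simp: pad_def mat_def vec_eq_iff)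
    then show ?case using rseries_const[of 1] by simp
  next
    case (insert k K)
    let ?A = "\<lambda>x i j. (if i = j then 1 else 0) - F i j x"
    \<comment> \<open>The geometric series of the pivot is written with \<open>powr - 1\<close> so
      that \<open>rseries_binomial\<close> covers it.\<close>
    define F' where "F' i j x = F i j x + F i k x * F k j x * (1 - F k k x) powr - 1" for i j x
    note ser = insert.prems(1)
    have F0: "0 \<le> F i j x" if "x \<in> D" for i j x using rseries_nonneg[OF ser that] .
    have row: "F i k x * v k + (\<Sum>j\<in>K. F i j x * v j) < v i" if "x \<in> D" "i \<in> insert k K" for x i
      using insert.prems(2)[OF that] insert.hyps by simp
    have Kpos: "0 \<le> (\<Sum>j\<in>K. F i j x * v j)" if "x \<in> D" for i x
      using F0[OF that] assms(3) by (intro sum_nonneg mult_nonneg_nonneg) (auto intro: less_imp_le)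
    have kk: "F k k x < 1" if "x \<in> D" for x
      proof -
      have "F k k x * v k < 1 * v k" using row[OF that, of k] Kpos[OF that, of k] by simp
      then show ?thesis using assms(3)[of k] by (simp only: mult_less_cancel_right_pos)
    qed
    have ser': "rseries (F' i j)" for i j
      unfolding F'_def using kk by (intro rseries_add rseries_mult rseries_binomial ser) auto
    have row': "(\<Sum>j\<in>K. F' i j x * v j) < v i" if x: "x \<in> D" and i: "i \<in> K" for x i
    proof -
      have p: "(1 - F k k x) powr - 1 = 1 / (1 - F k k x)"
        using kk[OF x] by (simp add: powr_minus_divide)
      have "(\<Sum>j\<in>K. F' i j x * v j) = (\<Sum>j\<in>K. F i j x * v j) + F i k x * ((\<Sum>j\<in>K. F k j x * v j) / (1 - F k k x))"
        unfolding F'_def p sum_divide_distrib sum_distrib_left sum.distrib[symmetric]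
        by (rule sum.cong) (simp_all add: distrib_right)
      also have "(\<Sum>j\<in>K. F k j x * v j) / (1 - F k k x) \<le> v k"
        using row[OF x, of k] kk[OF x] by (simp add: field_simps)
      finally show ?thesis using row[OF x, of i] i F0[OF x, of i k] by (simp add: mult_left_mono)
    qed
    note IH = insert.IH[OF ser' row']
    have det: "det (pad (insert k K) (?A x)) =
        (1 - F k k x) * det (pad K (\<lambda>i j. (if i = j then 1 else 0) - F' i j x))" if x: "x \<in> D" for x
    proof -
      have "pad K (\<lambda>i j. ?A x i j - ?A x i k * ?A x k j / ?A x k k) =
         pad K (\<lambda>i j. (if i = j then 1 else 0) - F' i j x)"
      proof -
        have "?A x i j - ?A x i k * ?A x k j / ?A x k k = (if i = j then 1 else 0) - F' i j x"
          if "i \<in> K" "j \<in> K" for i j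
        proof -
          have ne: "i \<noteq> k" "k \<noteq> j" using that insert.hyps(2) by auto
          show ?thesis using kk[OF x] ne(1) ne(2) by (simp add: F'_def powr_minus_divide)
        qed
        then show ?thesis unfolding pad_def vec_eq_iff vec_lambda_beta by presburger
      qed
      then show ?thesis using det_pad_insert[OF insert.hyps(2), of "?A x"] kk[OF x] by simp
    qed
    have pos: "\<forall>x\<in>D. det (pad (insert k K) (?A x)) > 0"
      using IH kk by (simp add: det)
    moreover have "rseries (\<lambda>x. (1 - F k k x) powr - b * det (pad K (\<lambda>i j. (if i = j then 1 else 0) - F' i j x)) powr - b)"
      using IH kk assms(2) ser by (intro rseries_mult rseries_binomial) auto
    then have "rseries (\<lambda>x. det (pad (insert k K) (?A x)) powr - b)"
    proof (rule rseries_cong)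
      fix x assume x: "x \<in> D"
      then show "(1 - F k k x) powr - b * det (pad K (\<lambda>i j. (if i = j then 1 else 0) - F' i j x)) powr - b
          = det (pad (insert k K) (?A x)) powr - b"
        using IH kk[OF x] by (simp add: det powr_mult less_imp_le)
    qed
    ultimately show ?case by blast
  qed
qed

end

section \<open>Z-matrices: minimum principle and positive vectors\<close>

lemma finite_arg_min:
  fixes f :: "'n::finite \<Rightarrow> real"
  shows "\<exists>i. \<forall>j. f i \<le> f j"
proof -
  have "Min (range f) \<in> range f" by (intro Min_in) auto
  then obtain i where "f i = Min (range f)" by (metis imageE)
  then show ?thesis by (intro exI[of _ i]) simp
qed

text \<open>Minimum principle: subtract from \<open>u\<close> the multiple of \<open>v\<close> given
  by the least ratio \<open>u $ i / v $ i\<close>. The result is nonnegative and vanishes at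
  \<open>i\<close>, so its image under \<open>Z\<close> is nonpositive there; a negative ratio would
  make it positive. The sign of \<open>Z *v u\<close> is demanded only where \<open>u\<close> is
  negative, which allows later use with a vector vanishing exactly where the sign is bad.\<close>

lemma Z_matrix_monotone:
  fixes Z :: "real^'n::finite^'n"
  assumes off: "\<And>i j. i \<noteq> j \<Longrightarrow> Z $ i $ j \<le> 0" and v: "\<And>i. v $ i > 0"
    and Zv: "\<And>i. (Z *v v) $ i > 0" and u: "\<And>i. u $ i < 0 \<Longrightarrow> (Z *v u) $ i \<ge> 0"
  shows "u $ k \<ge> 0"
proof (rule ccontr)
  assume k: "\<not> u $ k \<ge> 0"
  obtain i where i: "\<And>j. u $ i / v $ i \<le> u $ j / v $ j"
    using finite_arg_min[of "\<lambda>j. u $ j / v $ j"] by blast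
  define t where "t = u $ i / v $ i"
  have "t \<le> u $ k / v $ k" using i by (simp add: t_def)
  also have "\<dots> < 0" using k v[of k] by (simp add: divide_neg_pos)
  finally have t: "t < 0" .
  then have "u $ i < 0" using v[of i] by (simp add: t_def divide_less_0_iff)
  define w where "w = u - t *\<^sub>R v"
  have w: "w $ j \<ge> 0" for j
    using i[of j] v[of j] by (simp add: w_def t_def[symmetric] pos_le_divide_eq)
  have wi: "w $ i = 0" using v[of i] by (simp add: w_def t_def)
  have "(Z *v w) $ i = (\<Sum>j\<in>UNIV. Z $ i $ j * w $ j)" by (simp add: matrix_vector_mult_def)
  also have "\<dots> \<le> 0"
    using w wi off by (intro sum_nonpos) (metis mult_nonpos_nonneg mult_zero_right order_refl)
  finally have "(Z *v w) $ i \<le> 0" .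
  moreover have "(Z *v w) $ i = (Z *v u) $ i - t * (Z *v v) $ i"
    by (simp add: w_def matrix_vector_mult_diff_distrib matrix_vector_mult_scaleR)
  moreover have "t * (Z *v v) $ i < 0" using t Zv[of i] by (simp add: mult_neg_pos)
  ultimately show False using u[OF \<open>u $ i < 0\<close>] by simp
qed

lemma real_polynomial_function_det:
  fixes M :: "real \<Rightarrow> real^'n::finite^'n"
  assumes "\<And>i j. real_polynomial_function (\<lambda>t. M t $ i $ j)"
  shows "real_polynomial_function (\<lambda>t. det (M t))"
  unfolding det_def
  by (intro real_polynomial_function_sum real_polynomial_function.intros(4) real_polynomial_function_prod
      real_polynomial_function.intros(2) assms) (auto simp: finite_permutations)

lemma real_polynomial_function_if:
  "(c \<Longrightarrow> real_polynomial_function f) \<Longrightarrow> (\<not> c \<Longrightarrow> real_polynomial_function g) \<Longrightarrow>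
    real_polynomial_function (\<lambda>t. if c then f t else g t)"
  by (cases c) auto

lemma real_polynomial_function_affine:
  "real_polynomial_function (\<lambda>t::real. a + t * b)"
  by (intro real_polynomial_function.intros(3) real_polynomial_function.intros(4)
      real_polynomial_function.intros(2) real_polynomial_function.intros(1) bounded_linear_ident)

lemma continuous_on_real_polynomial_function:
  "real_polynomial_function f \<Longrightarrow> continuous_on S f"
  using continuous_on_polymonial_function by (simp add: real_polynomial_function_eq)

text \<open>
  The solution \<open>V t\<close> of \<open>(Z + t I) V = 1\<close> is nonnegative exactly when it is positive, so the set of such \<open>t\<close> is
  open and closed in \<open>[0, \<infinity>)\<close>; diagonal dominance puts large \<open>t\<close> into it.
\<close>

lemma M_matrix_positive_vector:
  fixes Z :: "real^'n::finite^'n"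
  assumes off: "\<And>i j. i \<noteq> j \<Longrightarrow> Z $ i $ j \<le> 0"
    and det: "\<And>t. t \<ge> 0 \<Longrightarrow> det (Z + t *\<^sub>R mat 1) > 0"
  obtains v where "\<And>i. v $ i > 0" "Z *v v = (\<chi> i. 1)"
proof -
  define V where "V t = (\<chi> k. det (\<chi> i j. if j = k then (\<chi> i. 1) $ i else (Z + t *\<^sub>R mat 1) $ i $ j)
      / det (Z + t *\<^sub>R mat 1))" for t
  have V: "(Z + t *\<^sub>R mat 1) *v V t = (\<chi> i. 1)" if "t \<ge> 0" for t
  proof -
    have "det (Z + t *\<^sub>R mat 1) \<noteq> 0" using det[OF that] by simp
    from cramer[OF this, of "V t" "\<chi> i. 1"] show ?thesis by (simp add: V_def)
  qed
  have Vi: "t * V t $ i + (\<Sum>j\<in>UNIV. Z $ i $ j * V t $ j) = 1" if "t \<ge> 0" for t i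
  proof -
    have "((Z + t *\<^sub>R mat 1) *v V t) $ i = (Z *v V t) $ i + t * V t $ i"
      by (simp add: matrix_vector_mult_add_rdistrib flip: scaleR_matrix_vector_assoc)
    moreover have "(Z *v V t) $ i = (\<Sum>j\<in>UNIV. Z $ i $ j * V t $ j)"
      by (simp add: matrix_vector_mult_def)
    moreover have "((Z + t *\<^sub>R mat 1) *v V t) $ i = 1" unfolding V[OF that] by simp
    ultimately show ?thesis by simp
  qed
  have entry: "real_polynomial_function (\<lambda>t. (Z + t *\<^sub>R mat 1) $ i $ j)" for i j
    using real_polynomial_function_affine[of "Z $ i $ j" "mat 1 $ i $ j"] by simp
  have cont: "continuous_on {0..} V"
    unfolding V_def
  proof (intro continuous_on_vec_lambda continuous_on_divide continuous_on_real_polynomial_function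
      real_polynomial_function_det entry)
    fix k i j
    show "real_polynomial_function (\<lambda>t. (\<chi> i j. if j = k then (\<chi> i. 1) $ i else (Z + t *\<^sub>R mat 1) $ i $ j) $ i $ j)"
      using entry[of i j] by (simp add: real_polynomial_function_if real_polynomial_function.intros(2))
  qed (use det in fastforce)
  define T where "T = {0..} \<inter> V -` {x. \<forall>i. 0 < x $ i}"
  \<comment> \<open>At a zero coordinate \<open>i\<close> of a nonnegative \<open>V t\<close>, the
    left side of row \<open>i\<close> of the equation is nonpositive although it equals
    \<open>1\<close>.\<close>
  have T': "T = {0..} \<inter> V -` {x. \<forall>i. 0 \<le> x $ i}"
  proof -
    have "0 < V t $ i" if t: "t \<ge> 0" and nn: "\<forall>i. 0 \<le> V t $ i" for t i
    proof (rule ccontr)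
      assume "\<not> 0 < V t $ i"
      then have z: "V t $ i = 0" using nn by (simp add: order_antisym)
      have "(\<Sum>j\<in>UNIV. Z $ i $ j * V t $ j) \<le> 0"
        using nn z off by (intro sum_nonpos) (metis mult_nonpos_nonneg mult_zero_right order_refl)
      then show False using Vi[OF t, of i] z by simp
    qed
    then show ?thesis unfolding T_def by (auto intro: less_imp_le)
  qed
  have "open {x::real^'n. \<forall>i. 0 < x $ i}"
  proof -
    have "{x::real^'n. \<forall>i. 0 < x $ i} = (\<Inter>i. {x. 0 < x $ i})" by auto
    then show ?thesis
      by (auto intro!: open_INT open_Collect_less continuous_intros)
  qed
  then have op: "openin (top_of_set {0..}) T"
    unfolding T_def using cont by (intro continuous_openin_preimage_gen)
  have "closed {x::real^'n. \<forall>i. 0 \<le> x $ i}"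
    by (intro closed_Collect_all closed_Collect_le continuous_intros)
  then have cl: "closedin (top_of_set {0..}) T"
    unfolding T' using cont by (intro continuous_closedin_preimage)
  \<comment> \<open>With this \<open>t0\<close> all row sums of \<open>Z + t0 I\<close> are
    nonnegative; comparing row \<open>i\<close> with its row sum at the smallest coordinate
    \<open>V t0 $ i\<close> shows that this coordinate is positive.\<close>
  define t0 where "t0 = 1 + (\<Sum>i\<in>UNIV. \<Sum>j\<in>UNIV. \<bar>Z $ i $ j\<bar>)"
  have t0: "t0 \<ge> 0" unfolding t0_def by (intro add_nonneg_nonneg sum_nonneg) auto
  have "t0 \<in> T"
  proof -
    obtain i where i: "\<And>j. V t0 $ i \<le> V t0 $ j"
      using finite_arg_min[of "\<lambda>j. V t0 $ j"] by blast
    have "V t0 $ i > 0"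
    proof (rule ccontr)
      assume n: "\<not> V t0 $ i > 0"
      have "(\<Sum>j\<in>UNIV. Z $ i $ j * V t0 $ j) \<le> (\<Sum>j\<in>UNIV. Z $ i $ j * V t0 $ i)"
        using i off by (intro sum_mono) (metis mult_left_mono_neg order_refl)
      then have "1 \<le> V t0 $ i * (t0 + (\<Sum>j\<in>UNIV. Z $ i $ j))"
        using Vi[OF t0, of i] unfolding sum_distrib_right[symmetric] by (simp add: distrib_left mult.commute)
      moreover have "t0 + (\<Sum>j\<in>UNIV. Z $ i $ j) \<ge> 0"
      proof -
        have "- (\<Sum>j\<in>UNIV. Z $ i $ j) \<le> (\<Sum>j\<in>UNIV. \<bar>Z $ i $ j\<bar>)"
          unfolding sum_negf[symmetric] by (intro sum_mono) auto
        also have "\<dots> \<le> (\<Sum>i\<in>UNIV. \<Sum>j\<in>UNIV. \<bar>Z $ i $ j\<bar>)"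
          by (intro member_le_sum sum_nonneg) auto
        finally show ?thesis by (simp add: t0_def)
      qed
      ultimately show False using n by (smt (verit) mult_nonneg_nonneg mult_nonpos_nonneg)
    qed
    then have "\<forall>j. 0 < V t0 $ j" using i by (meson less_le_trans)
    then show ?thesis using t0 by (auto simp: T_def)
  qed
  then have "T = {0..}"
    using op cl connected_clopen[of "{0::real..}"] by (metis connected_Ici empty_iff)
  then have "0 \<in> T" by simp
  then have "\<And>i. V 0 $ i > 0" by (simp add: T_def)
  moreover have "Z *v V 0 = (\<chi> i. 1)" using V[of 0] by simp
  ultimately show ?thesis using that by blast
qed

section \<open>Balanced sign patterns\<close>

lemma other_index:
  fixes i j k :: "'n::finite"
  assumes "CARD('n) > 3"
  obtains l where "l \<noteq> i" "l \<noteq> j" "l \<noteq> k"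
proof -
  have "card {i, j, k} \<le> 3" by (simp add: card_insert_if)
  then have "{i, j, k} \<noteq> UNIV" using assms by (metis not_less)
  then show ?thesis using that by blast
qed

text \<open>
  Call a triangle good if the product of its three edge signs is \<open>1\<close>. Each edge of a tetrahedron lies on two of its
  faces, so the number of bad faces is even; hence one exceptional triangle cannot be bad.
\<close>

lemma signature_exists:
  fixes q :: "'n::finite \<Rightarrow> 'n \<Rightarrow> real"
  assumes card: "CARD('n) > 3"
    and pair: "\<And>i j. i \<noteq> j \<Longrightarrow> q i j * q j i \<ge> 0"
    and good: "\<And>i j k. i \<noteq> j \<Longrightarrow> j \<noteq> k \<Longrightarrow> i \<noteq> k \<Longrightarrow> \<not> S {i, j, k} \<Longrightarrow>
      q i j * q j k * q k i > 0 \<or> q i k * q k j * q j i > 0"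
    and one: "\<And>I J. S I \<Longrightarrow> S J \<Longrightarrow> I = J"
  obtains \<sigma> :: "'n \<Rightarrow> real" where "\<And>i. \<sigma> i = 1 \<or> \<sigma> i = -1"
    "\<And>i j. i \<noteq> j \<Longrightarrow> \<sigma> i * \<sigma> j * q i j \<ge> 0"
proof -
  \<comment> \<open>One of \<open>q i j\<close>, \<open>q j i\<close> may vanish, so the edge takes
    the sign of whichever is nonzero; if both vanish, \<open>-1\<close> is an arbitrary
    choice.\<close>
  define e :: "'n \<Rightarrow> 'n \<Rightarrow> real" where "e i j = (if q i j > 0 \<or> q j i > 0 then 1 else -1)" for i j
  have sym: "e i j = e j i" for i j by (auto simp: e_def)
  have e1: "e i j = 1 \<or> e i j = -1" for i j by (auto simp: e_def)
  have esq: "e i j * e i j = 1" for i j by (auto simp: e_def)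
  have eq: "e i j * q i j \<ge> 0" if "i \<noteq> j" for i j
    using pair[OF that] by (auto simp: e_def zero_le_mult_iff)
  have esgn: "e i j = sgn (q i j)" if "i \<noteq> j" "q i j \<noteq> 0" for i j
    using eq[OF that(1)] that(2) e1[of i j] by (auto simp: sgn_if)
  have g: "e i j * e j k * e k i = 1"
    if d: "i \<noteq> j" "j \<noteq> k" "i \<noteq> k" and ns: "\<not> S {i, j, k}" for i j k
  proof -
    have *: "e a b * e b c * e c a = 1" if x: "q a b * q b c * q c a > 0" and "a \<noteq> b" "b \<noteq> c" "c \<noteq> a" for a b c
    proof -
      have "q a b \<noteq> 0" "q b c \<noteq> 0" "q c a \<noteq> 0" using x by auto
      then have "e a b * e b c * e c a = sgn (q a b * q b c * q c a)"
        using that esgn by (simp add: sgn_mult)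
      then show ?thesis using x by simp
    qed
    from good[OF d ns] show ?thesis
    proof
      assume "q i j * q j k * q k i > 0"
      then show ?thesis using *[of i j k] d by simp
    next
      assume "q i k * q k j * q j i > 0"
      then show ?thesis using *[of i k j] d sym by (simp add: mult_ac)
    qed
  qed
  have t: "e i j * e j k * e k i = 1" if d: "i \<noteq> j" "j \<noteq> k" "i \<noteq> k" for i j k
  proof (cases "S {i, j, k}")
    case True
    obtain l where l: "l \<noteq> i" "l \<noteq> j" "l \<noteq> k" using other_index[OF card] by blast
    have "\<not> S {i, j, l}" "\<not> S {j, k, l}" "\<not> S {k, i, l}"
      using one[OF True, of "{i,j,l}"] one[OF True, of "{j,k,l}"] one[OF True, of "{k,i,l}"] l d by auto
    then have "e i j * e j l * e l i = 1" "e j k * e k l * e l j = 1" "e k i * e i l * e l k = 1"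
      using g[of i j l] g[of j k l] g[of k i l] l d by auto
    then have "(e i j * e j l * e l i) * (e j k * e k l * e l j) * (e k i * e i l * e l k) = 1" by simp
    then have "(e i j * e j k * e k i) * (e j l * e j l) * (e k l * e k l) * (e i l * e i l) = 1"
      using sym[of l i] sym[of l j] sym[of l k] by (simp add: mult_ac)
    then show ?thesis by (simp add: esq)
  next
    case False
    then show ?thesis using g d by blast
  qed
  obtain o' :: 'n where True by blast
  \<comment> \<open>Since every triangle is balanced, the edge signs are products of vertex signs,
    and these can be read off from the edges at a base point \<open>o'\<close>.\<close>
  define s where "s i = (if i = o' then 1 else e o' i)" for i
  show ?thesis
  proof
    show "s i = 1 \<or> s i = -1" for i using e1 by (auto simp: s_def)
    fix i j :: 'n assume ij: "i \<noteq> j"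
    have "s i * s j = e i j"
    proof -
      consider "i = o'" | "j = o'" | "i \<noteq> o'" "j \<noteq> o'" by blast
      then show ?thesis
      proof cases
        case 1 then show ?thesis using ij by (simp add: s_def)
      next
        case 2 then show ?thesis using ij sym by (simp add: s_def)
      next
        case 3
        have "e o' i * e i j * e j o' * e i j = e i j" using t[of o' i j] 3 ij by simp
        then have "e o' i * e o' j * (e i j * e i j) = e i j" using sym[of j o'] by (simp add: mult_ac)
        then show ?thesis using 3 by (simp add: s_def esq)
      qed
    qed
    then show "s i * s j * q i j \<ge> 0" using eq[OF ij] by simp
  qed
qed

section \<open>Laplace transforms on the orthant\<close>

text \<open>Under the substitution y_i = exp(- x_i / 2) monomials become Laplace kernels. Lists
  allow repeated exponents, so sums and products need no collecting of terms.\<close>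

lemma exp_polynomial_sum:
  fixes p :: "real^'n::finite \<Rightarrow> real"
  assumes "real_polynomial_function p"
  shows "\<exists>xs :: (real \<times> (real^'n)) list. (\<forall>(c, a)\<in>set xs. \<forall>i. a $ i \<ge> 0) \<and>
    (\<forall>x. p (\<chi> i. exp (- (x $ i) / 2)) = (\<Sum>(c, a)\<leftarrow>xs. c * exp (- (1/2) * (\<Sum>i\<in>UNIV. a $ i * x $ i))))"
  using assms
proof (induction p)
  case (linear f)
  then interpret bounded_linear f .
  obtain l :: "'n list" where l: "set l = UNIV" "distinct l" using finite_distinct_list[of "UNIV :: 'n set"] by auto
  have "f y = (\<Sum>i\<in>UNIV. y $ i * f (axis i 1))" for y
  proof -
    have "y = (\<Sum>i\<in>UNIV. y $ i *\<^sub>R axis i 1)"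
      by (simp add: vec_eq_iff axis_def if_distrib cong: if_cong)
    then have "f y = f (\<Sum>i\<in>UNIV. y $ i *\<^sub>R axis i 1)" by simp
    then show ?thesis by (simp add: sum scaleR)
  qed
  note f_eq = this
  have "f (\<chi> i. exp (- (x $ i) / 2)) =
      (\<Sum>(c, a)\<leftarrow>map (\<lambda>j. (f (axis j 1), axis j 1)) l. c * exp (- (1/2) * (\<Sum>i\<in>UNIV. a $ i * x $ i)))" for x
  proof -
    have ax: "(\<Sum>i\<in>UNIV. axis j 1 $ i * x $ i) = x $ j" for j
    proof -
      have "(\<Sum>i\<in>UNIV. axis j 1 $ i * x $ i) = (\<Sum>i\<in>UNIV. if i = j then x $ i else 0)"
        by (rule sum.cong) (auto simp: axis_def)
      then show ?thesis by simp
    qed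
    have "(\<Sum>(c, a)\<leftarrow>map (\<lambda>j. (f (axis j 1), axis j 1)) l. c * exp (- (1/2) * (\<Sum>i\<in>UNIV. a $ i * x $ i)))
       = (\<Sum>j\<leftarrow>l. f (axis j 1) * exp (- (1/2) * x $ j))"
      by (induction l) (auto simp: ax)
    also have "\<dots> = (\<Sum>j\<in>UNIV. f (axis j 1) * exp (- (1/2) * x $ j))"
      using sum_list_distinct_conv_sum_set[OF l(2)] l(1) by simp
    finally show ?thesis by (subst f_eq) (simp add: mult.commute)
  qed
  then show ?case
    by (intro exI[of _ "map (\<lambda>j. (f (axis j 1), axis j 1)) l"]) (auto simp: axis_def)
next
  case (const c)
  show ?case by (intro exI[of _ "[(c, 0)]"]) auto
next
  case (add f g)
  then obtain xs ys where xs: "\<forall>(c, a)\<in>set xs. \<forall>i. a $ i \<ge> 0"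
     "\<And>x. f (\<chi> i. exp (- (x $ i) / 2)) = (\<Sum>(c, a)\<leftarrow>xs. c * exp (- (1/2) * (\<Sum>i\<in>UNIV. a $ i * x $ i)))"
   and ys: "\<forall>(c, a)\<in>set ys. \<forall>i. a $ i \<ge> 0"
     "\<And>x. g (\<chi> i. exp (- (x $ i) / 2)) = (\<Sum>(c, a)\<leftarrow>ys. c * exp (- (1/2) * (\<Sum>i\<in>UNIV. a $ i * x $ i)))"
    by blast
  show ?case using xs ys by (intro exI[of _ "xs @ ys"]) auto
next
  case (mult f g)
  then obtain xs ys where xs: "\<forall>(c, a)\<in>set xs. \<forall>i. a $ i \<ge> 0"
     "\<And>x. f (\<chi> i. exp (- (x $ i) / 2)) = (\<Sum>(c, a)\<leftarrow>xs. c * exp (- (1/2) * (\<Sum>i\<in>UNIV. a $ i * x $ i)))"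
   and ys: "\<forall>(c, a)\<in>set ys. \<forall>i. a $ i \<ge> 0"
     "\<And>x. g (\<chi> i. exp (- (x $ i) / 2)) = (\<Sum>(c, a)\<leftarrow>ys. c * exp (- (1/2) * (\<Sum>i\<in>UNIV. a $ i * x $ i)))"
    by blast
  define E where "E a x = exp (- (1/2) * (\<Sum>i\<in>UNIV. a $ i * x $ i))" for a x :: "real^'n"
  have e: "E (a + b) x = E a x * E b x" for a b x
    by (simp add: E_def distrib_right sum.distrib add_divide_distrib flip: exp_add)
  let ?zs = "concat (map (\<lambda>(c, a). map (\<lambda>(d, b). (c * d, a + b)) ys) xs)"
  have inner: "(\<Sum>(c', a')\<leftarrow>map (\<lambda>(d, b). (c * d, a + b)) zs. c' * E a' x) =
     c * E a x * (\<Sum>(d, b)\<leftarrow>zs. d * E b x)" for c a zs x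
    by (induction zs) (auto simp: e algebra_simps)
  have "(\<Sum>(c, a)\<leftarrow>concat (map (\<lambda>(c, a). map (\<lambda>(d, b). (c * d, a + b)) ys) zs). c * E a x) =
     (\<Sum>(c, a)\<leftarrow>zs. c * E a x) * (\<Sum>(d, b)\<leftarrow>ys. d * E b x)" for zs x
    by (induction zs) (auto simp: inner algebra_simps simp del: map_map)
  then have "f (\<chi> i. exp (- (x $ i) / 2)) * g (\<chi> i. exp (- (x $ i) / 2)) = (\<Sum>(c, a)\<leftarrow>?zs. c * E a x)" for x
    unfolding xs(2) ys(2) E_def by simp
  then show ?case using xs(1) ys(1) unfolding E_def
    by (intro exI[of _ ?zs]) fastforce
qed

text \<open>\<open>T\<close> maps the orthant into the compact unit cube, where polynomials are
  dense by Stone-Weierstrass and, by \<open>exp_polynomial_sum\<close>, have known integrals. So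
  bounded continuous functions of \<open>T x\<close> have equal integrals under both measures, and
  indicators of lower boxes are limits of such functions.\<close>

lemma laplace_transform_unique:
  fixes \<mu> \<nu> :: "(real^'n::finite) measure"
  assumes "prob_space \<mu>" "prob_space \<nu>" and sets: "sets \<mu> = sets borel" "sets \<nu> = sets borel"
    and nn: "AE x in \<mu>. \<forall>i. x $ i \<ge> 0" "AE x in \<nu>. \<forall>i. x $ i \<ge> 0"
    and eq: "\<And>a::real^'n. (\<And>i. a $ i \<ge> 0) \<Longrightarrow>
       (\<integral>x. exp (- (1/2) * (\<Sum>i\<in>UNIV. a $ i * x $ i)) \<partial>\<mu>) = (\<integral>x. exp (- (1/2) * (\<Sum>i\<in>UNIV. a $ i * x $ i)) \<partial>\<nu>)"
  shows "\<mu> = \<nu>"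
proof -
  interpret m: prob_space \<mu> by fact
  interpret n: prob_space \<nu> by fact
  define T where "T x = (\<chi> i. exp (- (x $ i) / 2))" for x :: "real^'n"
  define K where "K = {y::real^'n. \<forall>i. 0 \<le> y $ i \<and> y $ i \<le> 1}"
  have K_cbox: "K = cbox 0 (\<chi> i. 1)"
    by (auto simp: K_def mem_box_cart)
  have contT: "continuous_on UNIV T" unfolding T_def by (intro continuous_intros) auto
  have TK: "T x \<in> K" if "\<forall>i. x $ i \<ge> 0" for x using that by (simp add: T_def K_def)
  let ?e = "\<lambda>a x. exp (- (1/2) * (\<Sum>i\<in>UNIV. a $ i * x $ i)) :: real"
  have meas: "\<And>N. sets N = sets borel \<Longrightarrow> h \<in> borel_measurable borel \<Longrightarrow> h \<in> borel_measurable N" for h :: "real^'n \<Rightarrow> real"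
    using measurable_cong_sets by blast
  have int_e: "integrable N (?e a)" if "prob_space N" "sets N = sets borel" "AE x in N. \<forall>i. x $ i \<ge> 0" "\<forall>i. a $ i \<ge> 0" for a and N :: "(real^'n) measure"
  proof -
    interpret prob_space N by fact
    show ?thesis
    proof (rule integrable_const_bound[where B=1])
      show "AE x in N. norm (?e a x) \<le> 1" using that(3)
        by eventually_elim (use that(4) in \<open>auto intro!: sum_nonneg mult_nonneg_nonneg\<close>)
      show "?e a \<in> borel_measurable N"
        by (rule meas[OF that(2)]) measurable
    qed
  qed
  have poly: "(\<integral>x. p (T x) \<partial>\<mu>) = (\<integral>x. p (T x) \<partial>\<nu>)" if p: "real_polynomial_function p" for p
  proof -
    obtain xs where xs: "\<forall>(c, a)\<in>set xs. \<forall>i. a $ i \<ge> 0"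
      "\<And>x. p (T x) = (\<Sum>(c, a)\<leftarrow>xs. c * ?e a x)"
      using exp_polynomial_sum[OF p] unfolding T_def by blast
    have "(\<forall>(c, a)\<in>set zs. \<forall>i. a $ i \<ge> 0) \<Longrightarrow>
      integrable \<mu> (\<lambda>x. \<Sum>(c, a)\<leftarrow>zs. c * ?e a x) \<and> integrable \<nu> (\<lambda>x. \<Sum>(c, a)\<leftarrow>zs. c * ?e a x) \<and>
      (\<integral>x. (\<Sum>(c, a)\<leftarrow>zs. c * ?e a x) \<partial>\<mu>) = (\<integral>x. (\<Sum>(c, a)\<leftarrow>zs. c * ?e a x) \<partial>\<nu>)" for zs
    proof (induction zs)
      case (Cons z zs)
      obtain c a where z: "z = (c, a)" by (cases z)
      have a: "\<forall>i. a $ i \<ge> 0" using Cons.prems z by auto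
      have "integrable \<mu> (?e a)" "integrable \<nu> (?e a)"
        using int_e[OF assms(1) sets(1) nn(1) a] int_e[OF assms(2) sets(2) nn(2) a] by auto
      then show ?case using Cons eq[of a] a z by simp
    qed simp
    then show ?thesis using xs by simp
  qed
  have cont: "(\<integral>x. f (T x) \<partial>\<mu>) = (\<integral>x. f (T x) \<partial>\<nu>)" if f: "continuous_on UNIV f" and fb: "\<And>y. \<bar>f y\<bar> \<le> 1"
    for f :: "real^'n \<Rightarrow> real"
  proof -
    have "\<bar>(\<integral>x. f (T x) \<partial>\<mu>) - (\<integral>x. f (T x) \<partial>\<nu>)\<bar> \<le> 2 * e" if e: "e > 0" for e
    proof -
      obtain p where p: "real_polynomial_function p" "\<And>y. y \<in> K \<Longrightarrow> \<bar>f y - p y\<bar> < e"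
        using Stone_Weierstrass_real_polynomial_function[of K f e] f e
        by (metis K_cbox compact_cbox continuous_on_subset top_greatest)
      have *: "\<bar>(\<integral>x. f (T x) \<partial>N) - (\<integral>x. p (T x) \<partial>N)\<bar> \<le> e"
        if N: "prob_space N" "sets N = sets borel" "AE x in N. \<forall>i. x $ i \<ge> 0" for N :: "(real^'n) measure"
      proof -
        interpret prob_space N by fact
        have mf: "(\<lambda>x. f (T x)) \<in> borel_measurable N"
          by (rule meas[OF N(2)]) (intro borel_measurable_continuous_onI continuous_on_compose2[OF f contT], auto)
        have cp: "continuous_on UNIV p"
          using p(1) continuous_on_polymonial_function by (simp add: real_polynomial_function_eq)
        have mp: "(\<lambda>x. p (T x)) \<in> borel_measurable N"
          by (rule meas[OF N(2)]) (intro borel_measurable_continuous_onI continuous_on_compose2[OF cp contT], auto)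
        have if': "integrable N (\<lambda>x. f (T x))"
          using integrable_const_bound[of "\<lambda>x. f (T x)" 1] fb mf by simp
        have b: "AE x in N. \<bar>f (T x) - p (T x)\<bar> \<le> e"
          using N(3) by eventually_elim (rule less_imp_le[OF p(2)[OF TK]])
        have id: "integrable N (\<lambda>x. f (T x) - p (T x))"
          using integrable_const_bound[of "\<lambda>x. f (T x) - p (T x)" e] b mf mp by simp
        have ip: "integrable N (\<lambda>x. p (T x))"
          using Bochner_Integration.integrable_diff[OF if' id] by simp
        have "\<bar>\<integral>x. f (T x) - p (T x) \<partial>N\<bar> \<le> (\<integral>x. \<bar>f (T x) - p (T x)\<bar> \<partial>N)"
          by (rule integral_abs_bound)
        also have "\<dots> \<le> (\<integral>x. e \<partial>N)"
          using id b by (intro integral_mono_AE) simp_all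
        finally show ?thesis using if' ip by (simp add: prob_space)
      qed
      show ?thesis
        using *[OF assms(1) sets(1) nn(1)] *[OF assms(2) sets(2) nn(2)] poly[OF p(1)] by linarith
    qed
    then have "\<bar>(\<integral>x. f (T x) \<partial>\<mu>) - (\<integral>x. f (T x) \<partial>\<nu>)\<bar> \<le> 0"
      using field_le_epsilon[of "\<bar>(\<integral>x. f (T x) \<partial>\<mu>) - (\<integral>x. f (T x) \<partial>\<nu>)\<bar>" 0]
      by (metis add_0 field_sum_of_halves half_gt_zero mult_2)
    then show ?thesis by simp
  qed
  have box: "measure \<mu> {..c} = measure \<nu> {..c}" for c :: "real^'n"
  proof -
    \<comment> \<open>Each factor is a ramp equal to \<open>1\<close> when the coordinate of
      \<open>y\<close> is at least exp(- c_i / 2), that is when x_i \<le> c_i for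
      \<open>y = T x\<close>, and \<open>0\<close> once it falls short by 1/m.\<close>
    define f where "f m y = (\<Prod>i\<in>UNIV. min 1 (max 0 (1 + real m * (y $ i - exp (- (c $ i) / 2)))))" for m :: nat and y :: "real^'n"
    have f01: "0 \<le> f m y \<and> f m y \<le> 1" for m y
      unfolding f_def by (auto intro!: prod_nonneg prod_le_1)
    have fc: "continuous_on UNIV (f m)" for m unfolding f_def by (intro continuous_intros)
    have lim1: "(\<lambda>m. min 1 (max 0 (1 + real m * d))) \<longlonglongrightarrow> (if d \<ge> 0 then 1 else 0)" for d :: real
    proof (cases "d \<ge> 0")
      case True
      then have "(\<lambda>m. min 1 (max 0 (1 + real m * d))) = (\<lambda>_. 1)" by (auto simp: fun_eq_iff min_def max_def)
      then show ?thesis using True by simp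
    next
      case False
      obtain m0 where m0: "real m0 > - 1 / d" using reals_Archimedean2 by blast
      have "eventually (\<lambda>m. min 1 (max 0 (1 + real m * d)) = 0) sequentially"
      proof (rule eventually_sequentiallyI[of m0])
        fix m assume "m \<ge> m0"
        then have "real m > - 1 / d" using m0 by linarith
        then have "1 + real m * d < 0" using False by (simp add: field_simps)
        then show "min 1 (max 0 (1 + real m * d)) = 0" by simp
      qed
      then show ?thesis using False by (simp add: tendsto_eventually)
    qed
    have lim: "(\<lambda>m. f m (T x)) \<longlonglongrightarrow> indicator {..c} x" for x
    proof -
      have "(\<lambda>m. f m (T x)) \<longlonglongrightarrow> (\<Prod>i\<in>UNIV. if T x $ i - exp (- (c $ i) / 2) \<ge> 0 then 1 else 0)"
        unfolding f_def by (intro tendsto_prod lim1)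
      also have "(\<Prod>i\<in>UNIV. if T x $ i - exp (- (c $ i) / 2) \<ge> 0 then 1 else 0) = (indicator {..c} x :: real)"
        by (auto simp: T_def less_eq_vec_def indicator_def)
      finally show ?thesis .
    qed
    have conv: "(\<lambda>m. \<integral>x. f m (T x) \<partial>N) \<longlonglongrightarrow> measure N {..c}"
      if N: "prob_space N" "sets N = sets borel" for N :: "(real^'n) measure"
    proof -
      interpret prob_space N by fact
      have "(\<lambda>m. \<integral>x. f m (T x) \<partial>N) \<longlonglongrightarrow> (\<integral>x. indicator {..c} x \<partial>N)"
      proof (rule integral_dominated_convergence[where w="\<lambda>_. 1"])
        show "(\<lambda>x. indicator {..c} x :: real) \<in> borel_measurable N"
          using N(2) by (intro borel_measurable_indicator) auto
        show "(\<lambda>x. f m (T x)) \<in> borel_measurable N" for m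
          by (rule meas[OF N(2)]) (intro borel_measurable_continuous_onI continuous_on_compose2[OF fc contT], auto)
      qed (use lim f01 in \<open>auto simp: abs_le_iff intro: order_trans[of _ 0]\<close>)
      then show ?thesis using N(2) by (simp add: sets_eq_imp_space_eq[OF N(2)])
    qed
    have "(\<lambda>m. \<integral>x. f m (T x) \<partial>\<mu>) = (\<lambda>m. \<integral>x. f m (T x) \<partial>\<nu>)"
      using cont[OF fc] f01 by (auto simp: abs_le_iff fun_eq_iff intro: order_trans[of _ 0])
    then show ?thesis
      using conv[OF assms(1) sets(1)] conv[OF assms(2) sets(2)] LIMSEQ_unique by metis
  qed
  show ?thesis
  proof (rule measure_eqI_generator_eq[where E="range (\<lambda>c::real^'n. {..c})" and \<Omega>=UNIV and A="\<lambda>k. {..(\<chi> i. real k)}"])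
    show "Int_stable (range (\<lambda>c::real^'n. {..c}))"
    proof -
      have "{..a} \<inter> {..b} = {..(\<chi> i. min (a $ i) (b $ i))}" for a b :: "real^'n"
        by (auto simp: less_eq_vec_def)
      then show ?thesis by (auto simp: Int_stable_def)
    qed
    show "emeasure \<mu> X = emeasure \<nu> X" if "X \<in> range (\<lambda>c::real^'n. {..c})" for X
      using that box by (auto simp: m.emeasure_eq_measure n.emeasure_eq_measure)
    show "sets \<mu> = sigma_sets UNIV (range (\<lambda>c::real^'n. {..c}))" "sets \<nu> = sigma_sets UNIV (range (\<lambda>c::real^'n. {..c}))"
      unfolding sets borel_eq_atMost by (auto intro: sets_measure_of)
    show "(\<Union>k. {..(\<chi> i. real k)}) = (UNIV :: (real^'n) set)"
    proof -
      have "\<exists>k. x \<le> (\<chi> i. real k)" for x :: "real^'n"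
      proof -
        obtain k where k: "real k \<ge> Max (range (\<lambda>i. x $ i))" using real_arch_simple by blast
        have "x $ i \<le> Max (range (\<lambda>i. x $ i))" for i by (intro Max_ge) auto
        then show ?thesis using k by (auto simp: less_eq_vec_def intro!: exI[of _ k] intro: order_trans)
      qed
      then show ?thesis by auto
    qed
  qed (auto simp: m.emeasure_eq_measure)
qed

section \<open>Gamma laws and their mixtures\<close>

definition gamma_density :: "real \<Rightarrow> real \<Rightarrow> real" where
  "gamma_density a x = (if x > 0 then x powr (a - 1) * exp (- x) / Gamma a else 0)"

lemma gamma_density_measurable [measurable]: "gamma_density a \<in> borel_measurable borel"
  unfolding gamma_density_def by measurable

lemma gamma_density_nonneg: "a > 0 \<Longrightarrow> gamma_density a x \<ge> 0"
  by (simp add: gamma_density_def Gamma_real_pos less_imp_le)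

text \<open>Substitute (1 + t) x in Euler's integral for \<open>Gamma a\<close>.\<close>

lemma gamma_density_laplace:
  fixes a t :: real
  assumes a: "a > 0" and t: "t \<ge> 0"
  shows "(\<integral>\<^sup>+x. ennreal (gamma_density a x) * ennreal (exp (- t * x)) \<partial>lborel) = ennreal ((1 + t) powr - a)"
proof -
  define f where "f x = indicator {0..} x * (x powr (a - 1) / exp x)" for x :: real
  have fm: "f \<in> borel_measurable borel" unfolding f_def by measurable
  have int: "(\<integral>\<^sup>+x. ennreal (f x) \<partial>lborel) = ennreal (Gamma a)"
  proof -
    have "((\<lambda>x. x powr (a - 1) / exp x) has_integral Gamma a) {0..}"
      by (rule Gamma_integral_real[OF a])
    then have "((\<lambda>x. if x \<in> {0..} then x powr (a - 1) / exp x else 0) has_integral Gamma a) UNIV"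
      by (subst has_integral_restrict_UNIV)
    also have "(\<lambda>x. if x \<in> {0..} then x powr (a - 1) / exp x else 0) = f"
      by (auto simp: f_def fun_eq_iff)
    finally have "(f has_integral Gamma a) UNIV" .
    moreover note fm
    moreover have "0 \<le> f x" for x by (simp add: f_def)
    ultimately show ?thesis using nn_integral_has_integral_lborel by blast
  qed
  have "ennreal (Gamma a) = ennreal (1 + t) * (\<integral>\<^sup>+x. ennreal (f ((1 + t) * x)) \<partial>lborel)"
    using nn_integral_real_affine[of "\<lambda>x. ennreal (f x)" "1 + t" 0] t fm
    by (simp add: int)
  also have "(\<lambda>x. ennreal (f ((1 + t) * x))) =
     (\<lambda>x. ennreal (Gamma a * (1 + t) powr (a - 1)) * (ennreal (gamma_density a x) * ennreal (exp (- t * x))))"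
  proof
    fix x
    have G: "Gamma a > 0" using a by (rule Gamma_real_pos)
    have "f ((1 + t) * x) = Gamma a * (1 + t) powr (a - 1) * (gamma_density a x * exp (- t * x))"
    proof (cases "x > 0")
      case True
      have "((1 + t) * x) powr (a - 1) = (1 + t) powr (a - 1) * x powr (a - 1)"
        using True t by (simp add: powr_mult)
      moreover have "exp ((1 + t) * x) = exp x * exp (t * x)" by (simp add: distrib_right exp_add)
      ultimately show ?thesis using t G True
        by (simp add: f_def gamma_density_def exp_minus divide_inverse)
    next
      case False
      then have "(1 + t) * x \<le> 0" using t by (simp add: mult_nonneg_nonpos)
      then show ?thesis using False t by (auto simp: f_def gamma_density_def indicator_def)
    qed
    then show "ennreal (f ((1 + t) * x)) =
        ennreal (Gamma a * (1 + t) powr (a - 1)) * (ennreal (gamma_density a x) * ennreal (exp (- t * x)))"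
      using G gamma_density_nonneg[OF a, of x] by (simp add: ennreal_mult)
  qed
  also have "(\<integral>\<^sup>+x. ennreal (Gamma a * (1 + t) powr (a - 1)) * (ennreal (gamma_density a x) * ennreal (exp (- t * x))) \<partial>lborel)
    = ennreal (Gamma a * (1 + t) powr (a - 1)) * (\<integral>\<^sup>+x. ennreal (gamma_density a x) * ennreal (exp (- t * x)) \<partial>lborel)"
    by (rule nn_integral_cmult) measurable
  finally have eq: "ennreal (Gamma a) = ennreal (1 + t) * (ennreal (Gamma a * (1 + t) powr (a - 1)) *
     (\<integral>\<^sup>+x. ennreal (gamma_density a x) * ennreal (exp (- t * x)) \<partial>lborel))" (is "_ = _ * (_ * ?J)") .
  have G: "Gamma a > 0" using a by (rule Gamma_real_pos)
  have p: "(1 + t) * (1 + t) powr (a - 1) = (1 + t) powr a"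
    using t powr_add[of "1 + t" 1 "a - 1"] by simp
  have "ennreal (Gamma a) = ennreal (Gamma a * (1 + t) powr a) * ?J"
    unfolding eq p[symmetric] using G t by (simp add: ennreal_mult mult_ac)
  then have "ennreal (inverse (Gamma a * (1 + t) powr a)) * ennreal (Gamma a) =
      ennreal (inverse (Gamma a * (1 + t) powr a)) * ennreal (Gamma a * (1 + t) powr a) * ?J"
    by (simp add: mult.assoc)
  also have "ennreal (inverse (Gamma a * (1 + t) powr a)) * ennreal (Gamma a * (1 + t) powr a) = 1"
  proof -
    have "Gamma a * (1 + t) powr a > 0" using G t by simp
    then have "inverse (Gamma a * (1 + t) powr a) * (Gamma a * (1 + t) powr a) = 1"
      by (intro left_inverse) linarith
    then show ?thesis
      using \<open>Gamma a * (1 + t) powr a > 0\<close> by (subst ennreal_mult[symmetric]) (auto simp del: inverse_mult_distrib)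
  qed
  also have "ennreal (inverse (Gamma a * (1 + t) powr a)) * ennreal (Gamma a) = ennreal ((1 + t) powr - a)"
    using G t by (simp add: powr_minus flip: ennreal_mult)
  finally show ?thesis by simp
qed

text \<open>The factor with exponent \<open>- (b + real (e j i))\<close> is the transform of a gamma
  variable of that shape scaled by \<open>2 / d\<close>; the \<open>2\<close> cancels the 1/2 in the
  transform. Summing the product densities with weights \<open>c j\<close> gives the law, and
  \<open>L 0 = 1\<close> says that its mass is 1.\<close>

lemma gamma_mixture_exists:
  fixes c :: "nat \<Rightarrow> ennreal" and e :: "nat \<Rightarrow> 'n::finite \<Rightarrow> nat" and L :: "real^'n \<Rightarrow> real"
  assumes b: "b > 0" and d: "d > 0"
    and L: "\<And>\<alpha>. (\<And>i. \<alpha> $ i \<ge> 0) \<Longrightarrow>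
      ennreal (L \<alpha>) = (\<Sum>j. c j * ennreal (\<Prod>i\<in>UNIV. (1 + \<alpha> $ i / d) powr - (b + real (e j i))))"
    and L0: "L 0 = 1" and Lnn: "\<And>\<alpha>. L \<alpha> \<ge> 0"
  obtains \<mu> :: "(real^'n) measure" where "prob_space \<mu>" "sets \<mu> = sets borel" "AE x in \<mu>. \<forall>i. x $ i \<ge> 0"
    "\<And>\<alpha>. (\<And>i. \<alpha> $ i \<ge> 0) \<Longrightarrow> (\<integral>x. exp (- (1/2) * (\<Sum>i\<in>UNIV. \<alpha> $ i * x $ i)) \<partial>\<mu>) = L \<alpha>"
proof -
  interpret product_sigma_finite "\<lambda>_::'n. lborel :: real measure"
    by (simp add: product_sigma_finite_def sigma_finite_lborel)
  define P where "P = PiM (UNIV :: 'n set) (\<lambda>_. lborel :: real measure)"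
  define g where "g j x = (\<Prod>i\<in>UNIV. ennreal (gamma_density (b + real (e j i)) (x i)))" for j and x :: "'n \<Rightarrow> real"
  define dens where "dens x = (\<Sum>j. c j * g j x)" for x
  \<comment> \<open>Clipping at \<open>0\<close> makes the values nonnegative everywhere and is
    harmless, since the density vanishes unless all coordinates are positive.\<close>
  define T where "T x = (\<chi> i. (2 / d) * max 0 (x i))" for x :: "'n \<Rightarrow> real"
  define \<mu> where "\<mu> = distr (density P dens) borel T"
  have coord[measurable]: "(\<lambda>x. x i) \<in> borel_measurable P" for i
    unfolding P_def by measurable
  have g[measurable]: "g j \<in> borel_measurable P" for j
    unfolding g_def by measurable
  have dens[measurable]: "dens \<in> borel_measurable P"
    unfolding dens_def by measurable
  have T[measurable]: "T \<in> borel_measurable P"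
  proof (subst borel_measurable_euclidean_space, intro ballI)
    fix v :: "real^'n" assume "v \<in> Basis"
    then obtain i where "v = axis i 1" by (auto simp: Basis_vec_def)
    then have "(\<lambda>x. T x \<bullet> v) = (\<lambda>x. (2 / d) * max 0 (x i))" by (simp add: T_def inner_axis fun_eq_iff)
    then show "(\<lambda>x. T x \<bullet> v) \<in> borel_measurable P" by simp
  qed
  have key: "(\<integral>\<^sup>+x. ennreal (exp (- (1/2) * (\<Sum>i\<in>UNIV. \<alpha> $ i * x $ i))) \<partial>\<mu>) = ennreal (L \<alpha>)"
    if \<alpha>: "\<And>i. \<alpha> $ i \<ge> 0" for \<alpha>
  proof -
    let ?h = "\<lambda>j i x. ennreal (gamma_density (b + real (e j i)) x) * ennreal (exp (- (\<alpha> $ i / d) * x))"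
    have m: "(\<lambda>x. ennreal (exp (- (1/2) * (\<Sum>i\<in>UNIV. \<alpha> $ i * x $ i)))) \<in> borel_measurable borel"
      by measurable
    have eq: "g j x * ennreal (exp (- (1/2) * (\<Sum>i\<in>UNIV. \<alpha> $ i * T x $ i))) = (\<Prod>i\<in>UNIV. ?h j i (x i))" for j x
    proof -
      have "exp (- (1/2) * (\<Sum>i\<in>UNIV. \<alpha> $ i * T x $ i)) = (\<Prod>i\<in>UNIV. exp (- (\<alpha> $ i / d) * max 0 (x i)))"
        unfolding exp_sum[OF finite, symmetric] T_def
        by (simp add: sum_distrib_left sum_negf[symmetric])
      then have "ennreal (exp (- (1/2) * (\<Sum>i\<in>UNIV. \<alpha> $ i * T x $ i))) = (\<Prod>i\<in>UNIV. ennreal (exp (- (\<alpha> $ i / d) * max 0 (x i))))"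
        by (simp add: prod_ennreal)
      then have "g j x * ennreal (exp (- (1/2) * (\<Sum>i\<in>UNIV. \<alpha> $ i * T x $ i))) =
          (\<Prod>i\<in>UNIV. ennreal (gamma_density (b + real (e j i)) (x i)) * ennreal (exp (- (\<alpha> $ i / d) * max 0 (x i))))"
        by (simp only: g_def prod.distrib)
      also have "\<dots> = (\<Prod>i\<in>UNIV. ?h j i (x i))"
        by (rule prod.cong) (auto simp: gamma_density_def max_def)
      finally show ?thesis .
    qed
    have "(\<integral>\<^sup>+x. ennreal (exp (- (1/2) * (\<Sum>i\<in>UNIV. \<alpha> $ i * x $ i))) \<partial>\<mu>) =
       (\<integral>\<^sup>+x. dens x * ennreal (exp (- (1/2) * (\<Sum>i\<in>UNIV. \<alpha> $ i * T x $ i))) \<partial>P)"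
      unfolding \<mu>_def using m measurable_compose[OF T m]
      by (subst nn_integral_distr) (simp_all add: nn_integral_density)
    also have "\<dots> = (\<integral>\<^sup>+x. (\<Sum>j. c j * (\<Prod>i\<in>UNIV. ?h j i (x i))) \<partial>P)"
      unfolding dens_def by (simp only: ennreal_suminf_multc[symmetric] mult.assoc eq)
    also have "\<dots> = (\<Sum>j. \<integral>\<^sup>+x. c j * (\<Prod>i\<in>UNIV. ?h j i (x i)) \<partial>P)"
      by (rule nn_integral_suminf) measurable
    also have "\<dots> = (\<Sum>j. c j * (\<integral>\<^sup>+x. (\<Prod>i\<in>UNIV. ?h j i (x i)) \<partial>P))"
      by (intro suminf_cong nn_integral_cmult) measurable
    also have "\<dots> = (\<Sum>j. c j * (\<Prod>i\<in>UNIV. \<integral>\<^sup>+x. ?h j i x \<partial>lborel))"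
      unfolding P_def by (subst product_nn_integral_prod) (simp_all, measurable)
    also have "\<dots> = (\<Sum>j. c j * (\<Prod>i\<in>UNIV. ennreal ((1 + \<alpha> $ i / d) powr - (b + real (e j i)))))"
      using \<alpha> b d by (subst gamma_density_laplace) (auto simp: add_pos_nonneg)
    also have "\<dots> = (\<Sum>j. c j * ennreal (\<Prod>i\<in>UNIV. (1 + \<alpha> $ i / d) powr - (b + real (e j i))))"
      by (simp add: prod_ennreal)
    finally show ?thesis using L[OF \<alpha>] by simp
  qed
  have sets: "sets \<mu> = sets borel" by (simp add: \<mu>_def)
  show ?thesis
  proof
    show "prob_space \<mu>"
      using key[of 0] L0 by (intro prob_spaceI) (simp add: \<mu>_def)
    show "sets \<mu> = sets borel" by fact
    show "AE x in \<mu>. \<forall>i. x $ i \<ge> 0"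
      unfolding \<mu>_def using d by (subst AE_distr_iff) (auto simp: T_def)
    show "(\<integral>x. exp (- (1/2) * (\<Sum>i\<in>UNIV. \<alpha> $ i * x $ i)) \<partial>\<mu>) = L \<alpha>" if "\<And>i. \<alpha> $ i \<ge> 0" for \<alpha>
    proof (rule integral_eq_nn_integral[THEN trans])
      show "(\<lambda>x. exp (- (1/2) * (\<Sum>i\<in>UNIV. \<alpha> $ i * x $ i))) \<in> borel_measurable \<mu>"
        unfolding measurable_cong_sets[OF sets refl]
        by (intro borel_measurable_continuous_onI continuous_intros)
    qed (use key[OF that] Lnn in auto)
  qed
qed

section \<open>Permanental kernels\<close>

text \<open>A permutation moving a point outside \<open>I\<close> picks a zero from an identity row,
  so only permutations of \<open>I\<close> contribute. This links \<open>det_on\<close> to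
  \<open>det\<close> on the full type.\<close>

lemma det_identity_rows:
  fixes A :: "'n::finite \<Rightarrow> 'n \<Rightarrow> real"
  shows "det (\<chi> i j. if i \<in> I then A i j else if i = j then 1 else 0) = det_on I A"
proof -
  let ?A = "\<chi> i j. if i \<in> I then A i j else if i = j then 1 else 0"
  have "det ?A = (\<Sum>p\<in>{p. p permutes I}. of_int (sign p) * (\<Prod>i\<in>UNIV. ?A $ i $ p i))"
    unfolding det_def
  proof (rule sum.mono_neutral_right)
    show "finite {p. p permutes (UNIV::'n set)}" by (simp add: finite_permutations)
    show "{p. p permutes I} \<subseteq> {p. p permutes UNIV}" using permutes_subset by blast
    show "\<forall>p\<in>{p. p permutes UNIV} - {p. p permutes I}. of_int (sign p) * (\<Prod>i\<in>UNIV. ?A $ i $ p i) = 0"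
    proof
      fix p assume p: "p \<in> {p. p permutes UNIV} - {p. p permutes I}"
      then have "\<exists>i. i \<notin> I \<and> p i \<noteq> i" by (auto simp: permutes_def)
      then obtain i where "i \<notin> I" "i \<noteq> p i" by metis
      then have "\<exists>i\<in>UNIV. ?A $ i $ p i = 0" by (intro bexI[of _ i]) auto
      then show "of_int (sign p) * (\<Prod>i\<in>UNIV. ?A $ i $ p i) = 0"
        by (subst prod_zero) auto
    qed
  qed
  also have "\<dots> = det_on I A"
    unfolding det_on_def
  proof (rule sum.cong[OF refl])
    fix p assume p: "p \<in> {p. p permutes I}"
    have "(\<Prod>i\<in>UNIV. ?A $ i $ p i) = (\<Prod>i\<in>I. ?A $ i $ p i)"
      using p by (intro prod.mono_neutral_right) (auto simp: permutes_def)
    then show "of_int (sign p) * (\<Prod>i\<in>UNIV. ?A $ i $ p i) = of_int (sign p) * (\<Prod>i\<in>I. A i (p i))"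
      by simp
  qed
  finally show ?thesis .
qed

lemma det_on_scale_rows: "det_on I (\<lambda>i j. s i * A i j) = (\<Prod>i\<in>I. s i) * det_on I A"
  unfolding det_on_def by (simp add: prod.distrib sum_distrib_left mult_ac)

lemma det_on_cong: "(\<And>i j. i \<in> I \<Longrightarrow> j \<in> I \<Longrightarrow> A i j = B i j) \<Longrightarrow> det_on I A = det_on I B"
  unfolding det_on_def
  by (intro sum.cong prod.cong refl arg_cong2[where f="(*)"]) (auto simp: permutes_in_image)

lemma det_on_2:
  assumes "i \<noteq> j"
  shows "det_on {i, j} A = A i i * A j j - A i j * A j i"
proof -
  have f: "finite {j}" "i \<notin> {j}" using assms by auto
  show ?thesis
    unfolding det_on_def sum_over_permutations_insert[OF f] permutes_sing
    using assms by (simp add: sign_swap_id sign_id)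
qed

lemma det_on_3:
  assumes "i \<noteq> j" "j \<noteq> k" "i \<noteq> k"
  shows "det_on {i, j, k} A = A i i * A j j * A k k + A i j * A j k * A k i + A i k * A k j * A j i
     - A i i * A j k * A k j - A j j * A i k * A k i - A k k * A i j * A j i"
proof -
  have f: "finite {j, k}" "i \<notin> {j, k}" "finite {k}" "j \<notin> {k}" using assms by auto
  show ?thesis
    unfolding det_on_def sum_over_permutations_insert[OF f(1,2)] sum_over_permutations_insert[OF f(3,4)] permutes_sing
    using assms
    by (simp add: sign_swap_id permutation_swap_id sign_compose sign_id)
qed

text \<open>A determinant of order three depends only on the diagonal, the pair products and the sum
  of the two cyclic products. If the latter both equal \<open>x\<close>, then x^2 is the product of
  the pair products; hence the symmetric matrix of geometric means, with one common sign
  \<open>s\<close>, has the same data.\<close>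

lemma symmetrizable_on_3:
  fixes G :: "'n \<Rightarrow> 'n \<Rightarrow> real"
  assumes d: "i \<noteq> j" "j \<noteq> k" "i \<noteq> k"
    and nn: "G i j * G j i \<ge> 0" "G j k * G k j \<ge> 0" "G i k * G k i \<ge> 0"
    and eq: "G i j * G j k * G k i = G i k * G k j * G j i"
  shows "symmetrizable_on {i, j, k} G"
proof -
  define x where "x = G i j * G j k * G k i"
  define s :: real where "s = (if x \<ge> 0 then 1 else -1)"
  define B where "B a b = (if a = b then G a a else s * sqrt (G a b * G b a))" for a b
  have s2: "s * s = 1" by (simp add: s_def)
  have Bsym: "B a b = B b a" for a b by (simp add: B_def mult.commute)
  have pr: "B a b * B b a = G a b * G b a" if "a \<noteq> b" "G a b * G b a \<ge> 0" for a b
  proof -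
    have "B a b * B b a = (s * s) * (sqrt (G a b * G b a) * sqrt (G a b * G b a))"
      using that by (simp add: B_def mult_ac)
    then show ?thesis using that s2 by simp
  qed
  have "B i j * B j k * B k i = x"
  proof -
    have "x * x = (G i j * G j i) * (G j k * G k j) * (G i k * G k i)"
      using eq by (simp add: x_def mult_ac)
    then have "sqrt (G i j * G j i) * sqrt (G j k * G k j) * sqrt (G i k * G k i) = \<bar>x\<bar>"
      by (metis real_sqrt_abs2 real_sqrt_mult)
    moreover have "B i j * B j k * B k i = (s * s) * s * (sqrt (G i j * G j i) * sqrt (G j k * G k j) * sqrt (G i k * G k i))"
      using d by (simp add: B_def mult_ac)
    ultimately show ?thesis using s2 by (simp add: s_def)
  qed
  moreover have "B i k * B k j * B j i = B i j * B j k * B k i" using Bsym by (metis mult.assoc mult.commute)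
  ultimately have B3: "B i j * B j k * B k i = x" "B i k * B k j * B j i = x" by auto
  have "eff_equiv_on {i, j, k} G B"
    unfolding eff_equiv_on_def
  proof
    fix t :: "'n \<Rightarrow> real"
    let ?M = "\<lambda>A a b. (if a = b then 1 else 0) + t a * A a b :: real"
    have *: "det_on {i, j, k} (?M A) = (1 + t i * A i i) * (1 + t j * A j j) * (1 + t k * A k k)
        + t i * t j * t k * (A i j * A j k * A k i + A i k * A k j * A j i)
        - (1 + t i * A i i) * t j * t k * (A j k * A k j) - (1 + t j * A j j) * t i * t k * (A i k * A k i)
        - (1 + t k * A k k) * t i * t j * (A i j * A j i)" for A
      using d by (subst det_on_3[OF d]) (simp add: algebra_simps)
    have diag: "B a a = G a a" for a by (simp add: B_def)
    show "det_on {i, j, k} (?M G) = det_on {i, j, k} (?M B)"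
      unfolding * diag pr[OF d(1) nn(1)] pr[OF d(2) nn(2)] pr[OF d(3) nn(3)] B3
      using eq by (simp add: x_def)
  qed
  then show ?thesis unfolding symmetrizable_on_def using Bsym by blast
qed


section \<open>The determinant in the Laplace transform\<close>

definition kernel_det :: "real^'n::finite^'n \<Rightarrow> ('n \<Rightarrow> real) \<Rightarrow> real" where
  "kernel_det G a = det (\<chi> i j. (if i = j then 1 else 0) + a i * G $ i $ j)"

lemma diag_matrix_mult:
  fixes G :: "real^'n::finite^'n"
  shows "(\<chi> i j. if i = j then a i else 0) ** G = (\<chi> i j. a i * G $ i $ j)"
proof -
  have "(\<Sum>k\<in>UNIV. (if i = k then a i else 0) * G $ k $ j) = (\<Sum>k\<in>UNIV. if i = k then a i * G $ k $ j else 0)" for i j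
    by (rule sum.cong) auto
  then show ?thesis by (simp add: vec_eq_iff matrix_matrix_mult_def)
qed

lemma kernel_det_eq:
  "det (mat 1 + (\<chi> i j. if i = j then \<alpha> $ i else 0) ** G) = kernel_det G (\<lambda>i. \<alpha> $ i)"
  unfolding diag_matrix_mult kernel_det_def
  by (rule arg_cong[where f=det]) (simp add: vec_eq_iff mat_def)

lemma permanental_laplace:
  assumes "permanental_vector M psi G beta" "\<And>i. a i \<ge> 0"
  shows "(\<integral>\<omega>. exp (- (1/2) * (\<Sum>i\<in>UNIV. a i * psi \<omega> $ i)) \<partial>M) = kernel_det G a powr - beta"
proof -
  have eta: "(\<lambda>i. (\<chi> i. a i) $ i) = a" by simp
  have "\<forall>\<alpha>. (\<forall>i. \<alpha> $ i \<ge> 0) \<longrightarrow>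
      (\<integral>\<omega>. exp (- (1/2) * (\<Sum>i\<in>UNIV. \<alpha> $ i * psi \<omega> $ i)) \<partial>M) = kernel_det G (\<lambda>i. \<alpha> $ i) powr - beta"
    using assms(1) unfolding permanental_vector_def kernel_det_eq by blast
  from this[rule_format, of "\<chi> i. a i", unfolded eta] show ?thesis using assms(2) by simp
qed

text \<open>The integral is strictly positive while \<open>0 powr - beta = 0\<close>, so the
  determinant never vanishes. As \<open>powr\<close> is total, the identity alone does not exclude
  negative values; the sign is carried along the ray \<open>t * a\<close> from the value
  \<open>1\<close> at \<open>t = 0\<close>.\<close>

lemma permanental_det_pos:
  fixes G :: "real^'n::finite^'n"
  assumes perm: "permanental_vector M psi G beta" and a: "\<And>i. a i \<ge> 0"
  shows "kernel_det G a > 0"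
proof -
  interpret prob_space M using perm by (simp add: permanental_vector_def)
  have psi: "psi \<in> borel_measurable M" "\<And>\<omega> i. \<omega> \<in> space M \<Longrightarrow> psi \<omega> $ i \<ge> 0"
    using perm by (auto simp: permanental_vector_def)
  have nz: "kernel_det G (\<lambda>i. t * a i) \<noteq> 0" if "t \<ge> 0" for t
  proof
    let ?f = "\<lambda>\<omega>. exp (- (1/2) * (\<Sum>i\<in>UNIV. t * a i * psi \<omega> $ i))"
    assume "kernel_det G (\<lambda>i. t * a i) = 0"
    then have 0: "(\<integral>\<omega>. ?f \<omega> \<partial>M) = 0"
      using permanental_laplace[OF perm, of "\<lambda>i. t * a i"] a that by simp
    have m: "?f \<in> borel_measurable M"
    proof -
      have [measurable]: "(\<lambda>\<omega>. psi \<omega> $ i) \<in> borel_measurable M" for i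
        by (rule measurable_compose[OF psi(1)]) (intro borel_measurable_continuous_onI continuous_intros)
      show ?thesis by measurable
    qed
    have "integrable M ?f"
    proof (rule integrable_const_bound[OF _ m])
      show "AE \<omega> in M. norm (?f \<omega>) \<le> 1"
        using psi(2) a that by (intro AE_I2) (auto intro!: sum_nonneg mult_nonneg_nonneg)
    qed
    then have "AE \<omega> in M. ?f \<omega> = 0"
      using 0 integral_nonneg_eq_0_iff_AE[of M ?f] by simp
    then show False by simp
  qed
  have poly: "real_polynomial_function (\<lambda>t. kernel_det G (\<lambda>i. t * a i))"
    unfolding kernel_det_def
  proof (rule real_polynomial_function_det)
    fix i j
    show "real_polynomial_function (\<lambda>t. (\<chi> i j. (if i = j then 1 else 0) + t * a i * G $ i $ j) $ i $ j)"
      using real_polynomial_function_affine[of "if i = j then 1 else 0" "a i * G $ i $ j"]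
      by (simp add: mult.assoc)
  qed
  have k0: "kernel_det G (\<lambda>i. 0 * a i) = 1"
  proof -
    have "(\<chi> i j. (if i = j then 1 else 0) + 0 * a i * G $ i $ j) = (mat 1 :: real^'n^'n)"
      by (simp add: mat_def vec_eq_iff)
    then show ?thesis by (simp add: kernel_det_def)
  qed
  show ?thesis
  proof (rule ccontr)
    assume "\<not> kernel_det G a > 0"
    then have "kernel_det G (\<lambda>i. 1 * a i) \<le> 0" by simp
    then obtain t where "0 \<le> t" "kernel_det G (\<lambda>i. t * a i) = 0"
      using IVT2'[of "\<lambda>t. kernel_det G (\<lambda>i. t * a i)" 1 0 0] k0
        continuous_on_real_polynomial_function[OF poly, of "{0..1}"] by auto
    then show False using nz by blast
  qed
qed

text \<open>With S = Diag s, the matrix C = (I - S) + S A satisfies C (I + r G) = I + r (I - S) G.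
  Rows of C outside \<open>I\<close> are identity rows, and inside \<open>I\<close> the factor
  \<open>s i\<close> is taken out of each row.\<close>

lemma resolvent_det:
  fixes G :: "real^'n::finite^'n"
  assumes A: "A ** (mat 1 + r *\<^sub>R G) = mat 1"
    and s: "\<And>i. i \<in> I \<Longrightarrow> s i \<noteq> 0" "\<And>i. i \<notin> I \<Longrightarrow> s i = 0"
  shows "kernel_det G (\<lambda>i. r * (1 - s i)) = kernel_det G (\<lambda>_. r) * ((\<Prod>i\<in>I. s i) *
     det_on I (\<lambda>i j. if i = j then 1 / s i - 1 + A $ i $ i else A $ i $ j))"
proof -
  let ?K = "mat 1 + r *\<^sub>R G"
  define C :: "real^'n^'n" where "C = (\<chi> i j. (if i = j then 1 - s i else 0) + s i * A $ i $ j)"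
  have AK: "(\<Sum>k\<in>UNIV. A $ i $ k * ?K $ k $ j) = (if i = j then 1 else 0)" for i j
    using A by (simp add: matrix_matrix_mult_def vec_eq_iff mat_def)
  have "(C ** ?K) $ i $ j = (1 - s i) * ?K $ i $ j + s i * (if i = j then 1 else 0)" for i j
  proof -
    have "(C ** ?K) $ i $ j = (\<Sum>k\<in>UNIV. (if i = k then (1 - s i) * ?K $ k $ j else 0) + s i * (A $ i $ k * ?K $ k $ j))"
      unfolding matrix_matrix_mult_def C_def vec_lambda_beta by (rule sum.cong) (auto simp: algebra_simps)
    also have "\<dots> = (1 - s i) * ?K $ i $ j + s i * (\<Sum>k\<in>UNIV. A $ i $ k * ?K $ k $ j)"
      by (simp add: sum.distrib sum_distrib_left)
    finally show ?thesis unfolding AK .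
  qed
  then have "C ** ?K = (\<chi> i j. (if i = j then 1 else 0) + r * (1 - s i) * G $ i $ j)"
    by (auto simp: vec_eq_iff mat_def algebra_simps)
  then have "kernel_det G (\<lambda>i. r * (1 - s i)) = det C * det ?K"
    unfolding kernel_det_def by (metis det_mul)
  moreover have "det ?K = kernel_det G (\<lambda>_. r)"
    unfolding kernel_det_def by (rule arg_cong[where f=det]) (simp add: vec_eq_iff mat_def)
  moreover have "C = (\<chi> i j. if i \<in> I then s i * (if i = j then 1 / s i - 1 + A $ i $ i else A $ i $ j) else if i = j then 1 else 0)"
    using s by (auto simp: C_def vec_eq_iff field_simps)
  then have "det C = (\<Prod>i\<in>I. s i) * det_on I (\<lambda>i j. if i = j then 1 / s i - 1 + A $ i $ i else A $ i $ j)"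
    by (simp only: det_identity_rows det_on_scale_rows)
  ultimately show ?thesis by simp
qed

section \<open>Nonnegative power series from a permanental vector\<close>

interpretation powers: monomials "range (\<lambda>n h. h ^ n :: real)" "{0..<R}" for R :: real
proof
  show "(\<lambda>_. 1) \<in> range (\<lambda>n h. h ^ n :: real)" by (rule range_eqI[of _ _ 0]) simp
  show "(\<lambda>x. m x * m' x) \<in> range (\<lambda>n h. h ^ n)" if "m \<in> range (\<lambda>n h. h ^ n)" "m' \<in> range (\<lambda>n h. h ^ n)"
    for m m' :: "real \<Rightarrow> real"
    using that by (auto simp: power_add[symmetric])
qed auto

text \<open>Terms with equal exponent are collected by exchanging sums in \<open>ennreal\<close>. A
  collected coefficient is finite because the series is finite at \<open>R / 2\<close>.\<close>

lemma power_series_collect: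
  fixes f :: "real \<Rightarrow> real"
  assumes ser: "nonneg_series (range (\<lambda>n h. h ^ n)) {0..<R} (count_space (UNIV::unit set)) (\<lambda>_ h. ennreal (f h))"
    and nn: "\<And>h. 0 \<le> h \<Longrightarrow> h < R \<Longrightarrow> f h \<ge> 0" and R: "R > 0"
  obtains a where "\<And>n. a n \<ge> (0::real)" "\<And>h. 0 \<le> h \<Longrightarrow> h < R \<Longrightarrow> (\<lambda>n. a n * h ^ n) sums f h"
proof -
  obtain c m where cm: "\<And>j. m j \<in> range (\<lambda>n h. h ^ n :: real)"
    "\<And>h. h \<in> {0..<R} \<Longrightarrow> ennreal (f h) = (\<Sum>j. c j () * ennreal (m j h))"
  proof -
    obtain c m where "\<forall>j. m j \<in> range (\<lambda>n h. h ^ n :: real)"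
      "\<forall>\<omega>::unit\<in>UNIV. \<forall>h\<in>{0..<R}. ennreal (f h) = (\<Sum>j. c j \<omega> * ennreal (m j h))"
      using ser unfolding nonneg_series_def by auto
    then show ?thesis using that[of m c] by blast
  qed
  have "\<forall>j. \<exists>n. m j = (\<lambda>h. h ^ n)" using cm(1) by (simp add: image_iff)
  then obtain e where "\<forall>j. m j = (\<lambda>h. h ^ e j)" by (rule choice[THEN exE])
  then have e: "\<And>j h. m j h = h ^ e j" by simp
  define b where "b n = (\<Sum>j. if e j = n then c j () else 0)" for n
  have fb: "ennreal (f h) = (\<Sum>n. b n * ennreal (h ^ n))" if h: "0 \<le> h" "h < R" for h
  proof -
    have "ennreal (f h) = (\<Sum>j. \<Sum>n. if e j = n then c j () * ennreal (h ^ n) else 0)"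
    proof -
      have "(\<Sum>n. if e j = n then c j () * ennreal (h ^ n) else 0) = (\<Sum>n\<in>{e j}. if e j = n then c j () * ennreal (h ^ n) else 0)" for j
        by (rule suminf_finite) auto
      then show ?thesis using cm(2)[of h] h by (simp add: e)
    qed
    also have "\<dots> = (\<Sum>n. \<Sum>j. if e j = n then c j () * ennreal (h ^ n) else 0)"
      using nn_integral_suminf[of "\<lambda>n j. if e j = n then c j () * ennreal (h ^ n) else 0" "count_space UNIV"]
      by (simp add: nn_integral_count_space_nat)
    also have "\<dots> = (\<Sum>n. b n * ennreal (h ^ n))"
      unfolding b_def ennreal_suminf_multc[symmetric] by (intro suminf_cong) auto
    finally show ?thesis .
  qed
  have bfin: "b n < top" for n
  proof (rule ccontr)
    assume "\<not> b n < top"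
    then have "b n = top" by (metis less_top)
    then have "b n * ennreal ((R / 2) ^ n) = top" using R by (simp add: ennreal_top_mult)
    moreover have "b n * ennreal ((R / 2) ^ n) \<le> (\<Sum>n. b n * ennreal ((R / 2) ^ n))"
      using sum_le_suminf[of "\<lambda>n. b n * ennreal ((R / 2) ^ n)" "{n}"] by simp
    ultimately show False using fb[of "R / 2"] R by (simp add: top_unique)
  qed
  show ?thesis
  proof
    show "enn2real (b n) \<ge> 0" for n by simp
    fix h :: real assume h: "0 \<le> h" "h < R"
    have "(\<Sum>n. ennreal (enn2real (b n) * h ^ n)) = ennreal (f h)"
      using fb[OF h] h bfin by (simp add: ennreal_mult)
    moreover from this have sm: "summable (\<lambda>n. enn2real (b n) * h ^ n)"
      using h by (intro summable_suminf_not_top) auto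
    ultimately have "ennreal (\<Sum>n. enn2real (b n) * h ^ n) = ennreal (f h)"
      using h by (subst suminf_ennreal2[symmetric]) auto
    then have "(\<Sum>n. enn2real (b n) * h ^ n) = f h"
      using nn[OF h] sm h by (subst (asm) ennreal_inj) (auto intro!: suminf_nonneg)
    then show "(\<lambda>n. enn2real (b n) * h ^ n) sums f h" using sm by (simp add: sums_iff)
  qed
qed


text \<open>
  Given \<open>psi\<close>, let \<open>N\<close> be a vector of independent Poisson variables with means \<open>r psi / 2\<close>. Its generating function at
  \<open>s\<close> is the Laplace transform of \<open>psi\<close> at \<open>r (1 - s)\<close>. Setting \<open>s = 0\<close> off \<open>I\<close> isolates the
  principal submatrix of the resolvent, and \<open>s i = 1 / (1 + u i (T - h) - A i i)\<close> on \<open>I\<close> replaces its diagonal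
  by \<open>u i (T - h)\<close>.
\<close>

lemma permanental_power_series:
  fixes G :: "real^'n::finite^'n"
  assumes perm: "permanental_vector M psi G beta" and beta: "beta > 0" and r: "r > 0"
    and A: "A ** (mat 1 + r *\<^sub>R G) = mat 1"
    and R: "R > 0" and u: "\<And>i. i \<in> I \<Longrightarrow> u i > 0" and T: "\<And>i. i \<in> I \<Longrightarrow> A $ i $ i \<le> u i * (T - R)"
  defines "q \<equiv> \<lambda>h. det_on I (\<lambda>i j. if i = j then u i * (T - h) else A $ i $ j)"
  shows "\<exists>a. (\<forall>n. a n \<ge> (0::real)) \<and> (\<forall>h. 0 \<le> h \<longrightarrow> h < R \<longrightarrow> (\<lambda>n. a n * h ^ n) sums (q h powr - beta))"
proof -
  interpret prob_space M using perm by (simp add: permanental_vector_def)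
  have psi: "psi \<in> borel_measurable M" "\<And>\<omega> i. \<omega> \<in> space M \<Longrightarrow> psi \<omega> $ i \<ge> 0"
    using perm by (auto simp: permanental_vector_def)
  have psi_i[measurable]: "(\<lambda>\<omega>. psi \<omega> $ i) \<in> borel_measurable M" for i
    by (rule measurable_compose[OF psi(1)]) (intro borel_measurable_continuous_onI continuous_intros)
  \<comment> \<open>Chosen so that \<open>1 / s h i = \<rho> i - u i * h\<close>. The hypothesis on
    \<open>T\<close> bounds this below by 1 for \<open>h < R\<close>, which keeps
    \<open>s h i\<close> in the unit interval.\<close>
  define \<rho> where "\<rho> i = 1 + u i * T - A $ i $ i" for i
  define s where "s h i = (if i \<in> I then 1 / (\<rho> i - u i * h) else 0)" for h i
  have \<rho>: "\<rho> i - u i * h \<ge> 1" if "i \<in> I" "h < R" for i h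
  proof -
    have "u i * h \<le> u i * R" using u[OF that(1)] that(2) by simp
    then show ?thesis using T[OF that(1)] by (simp add: \<rho>_def right_diff_distrib)
  qed
  have \<rho>0: "\<rho> i > 0" if "i \<in> I" for i using \<rho>[OF that R] \<rho>[OF that, of 0] R by simp
  have s01: "0 \<le> s h i" "s h i \<le> 1" if "h < R" for h i
    using \<rho>[OF _ that, of i] by (auto simp: s_def)
  have s_inv: "1 / s h i = \<rho> i - u i * h" if "i \<in> I" for h i using that by (simp add: s_def)
  have s_pos: "s h i > 0" if "i \<in> I" "h < R" for h i using \<rho>[OF that] that by (simp add: s_def)
  define k where "k = kernel_det G (\<lambda>_. r)"
  have k: "k > 0" unfolding k_def using permanental_det_pos[OF perm] r by simp
  have dets: "kernel_det G (\<lambda>i. r * (1 - s h i)) = k * ((\<Prod>i\<in>I. s h i) * q h)" if "h < R" for h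
  proof -
    have "det_on I (\<lambda>i j. if i = j then 1 / s h i - 1 + A $ i $ i else A $ i $ j) = q h"
      unfolding q_def by (rule det_on_cong) (auto simp: s_inv \<rho>_def algebra_simps)
    then show ?thesis
      using resolvent_det[OF A, of I "s h"] s_pos[OF _ that] by (force simp: k_def s_def)
  qed
  have ps: "(\<Prod>i\<in>I. s h i) > 0" if "h < R" for h using s_pos that by (intro prod_pos) auto
  have q: "q h > 0" if "h < R" for h
  proof -
    have "0 < kernel_det G (\<lambda>i. r * (1 - s h i))"
      using permanental_det_pos[OF perm] s01[OF that] r by simp
    then show ?thesis using dets[OF that] k ps[OF that] by (simp add: zero_less_mult_iff)
  qed
  \<comment> \<open>The integrand is split so that \<open>h\<close> occurs only in the second
    product, inside exponentials of nonnegative multiples of \<open>s h i\<close>; these are series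
    with nonnegative random coefficients.\<close>
  have lap: "(\<integral>\<^sup>+\<omega>. (\<Prod>i\<in>UNIV. ennreal (exp (- (r/2) * psi \<omega> $ i))) * (\<Prod>i\<in>I. ennreal (exp ((r/2) * psi \<omega> $ i * s h i))) \<partial>M)
     = ennreal ((k * ((\<Prod>i\<in>I. s h i) * q h)) powr - beta)" if h: "h < R" for h
  proof -
    let ?f = "\<lambda>\<omega>. exp (- (1/2) * (\<Sum>i\<in>UNIV. r * (1 - s h i) * psi \<omega> $ i))"
    have "?f \<omega> = (\<Prod>i\<in>UNIV. exp (- (r/2) * psi \<omega> $ i)) * (\<Prod>i\<in>I. exp ((r/2) * psi \<omega> $ i * s h i))" for \<omega>
    proof -
      have "(\<Sum>i\<in>I. (r/2) * psi \<omega> $ i * s h i) = (\<Sum>i\<in>UNIV. (r/2) * psi \<omega> $ i * s h i)"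
        by (rule sum.mono_neutral_left) (auto simp: s_def)
      then have "- (1/2) * (\<Sum>i\<in>UNIV. r * (1 - s h i) * psi \<omega> $ i) =
          (\<Sum>i\<in>UNIV. - (r/2) * psi \<omega> $ i) + (\<Sum>i\<in>I. (r/2) * psi \<omega> $ i * s h i)"
        by (simp add: sum_distrib_left sum.distrib[symmetric] algebra_simps)
      then show ?thesis by (simp only: exp_add exp_sum[OF finite])
    qed
    then have "(\<integral>\<^sup>+\<omega>. (\<Prod>i\<in>UNIV. ennreal (exp (- (r/2) * psi \<omega> $ i))) * (\<Prod>i\<in>I. ennreal (exp ((r/2) * psi \<omega> $ i * s h i))) \<partial>M)
       = (\<integral>\<^sup>+\<omega>. ennreal (?f \<omega>) \<partial>M)"
      by (simp add: prod_ennreal prod_nonneg ennreal_mult)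
    also have "\<dots> = ennreal (\<integral>\<omega>. ?f \<omega> \<partial>M)"
    proof (rule nn_integral_eq_integral)
      show "integrable M ?f"
      proof (rule integrable_const_bound[of _ 1])
        show "AE \<omega> in M. norm (?f \<omega>) \<le> 1"
          using psi(2) s01[OF h] r by (intro AE_I2) (auto intro!: sum_nonneg mult_nonneg_nonneg)
      qed measurable
    qed simp
    also have "\<dots> = ennreal (kernel_det G (\<lambda>i. r * (1 - s h i)) powr - beta)"
      using permanental_laplace[OF perm, of "\<lambda>i. r * (1 - s h i)"] s01[OF h] r by simp
    finally show ?thesis unfolding dets[OF h] .
  qed
  let ?N = "count_space (UNIV::unit set)"
  \<comment> \<open>The power of \<open>s h i\<close> is \<open>\<rho> i powr - b\<close> times the
    binomial series in \<open>u i / \<rho> i * h\<close>.\<close>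
  have s_ser: "powers.series R N (\<lambda>_ h. ennreal (s h i powr b))" if i: "i \<in> I" and b: "b > 0" for i b and N :: "'z measure"
  proof -
    have ur: "0 \<le> u i / \<rho> i * h \<and> u i / \<rho> i * h < 1" if "h \<in> {0..<R}" for h
      using \<rho>[OF i, of h] that \<rho>0[OF i] u[OF i] by (auto simp: field_simps)
    have "powers.series R N (\<lambda>_ h. ennreal (u i / \<rho> i) * ennreal (h ^ 1))"
      by (rule powers.series_monomial[OF _ rangeI]) simp
    then have "powers.series R N (\<lambda>_ h. ennreal (u i / \<rho> i * h))"
      by (rule powers.series_cong) (use u[OF i] \<rho>0[OF i] in \<open>auto simp flip: ennreal_mult\<close>)
    then have "powers.series R N (\<lambda>_ h. ennreal ((1 - u i / \<rho> i * h) powr - b))"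
      by (rule powers.series_binomial) (use ur b in auto)
    then have "powers.series R N (\<lambda>_ h. ennreal (\<rho> i powr - b) * ennreal ((1 - u i / \<rho> i * h) powr - b))"
      by (intro powers.series_mult powers.series_const) auto
    then show ?thesis
    proof (rule powers.series_cong)
      fix h assume h: "h \<in> {0..<R}"
      have "\<rho> i powr - b * (1 - u i / \<rho> i * h) powr - b = (\<rho> i * (1 - u i / \<rho> i * h)) powr - b"
        using ur[OF h] \<rho>0[OF i] by (simp add: powr_mult)
      also have "\<rho> i * (1 - u i / \<rho> i * h) = \<rho> i - u i * h" using \<rho>0[OF i] by (simp add: right_diff_distrib)
      also have "(\<rho> i - u i * h) powr - b = s h i powr b"
        using \<rho>[OF i, of h] h i by (simp add: s_def powr_minus_divide powr_divide)
      finally show "ennreal (\<rho> i powr - b) * ennreal ((1 - u i / \<rho> i * h) powr - b) = ennreal (s h i powr b)"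
        by (simp flip: ennreal_mult)
    qed
  qed
  have exp_ser: "powers.series R M (\<lambda>\<omega> h. ennreal (exp ((r/2) * psi \<omega> $ i * s h i)))" if i: "i \<in> I" for i
  proof (rule powers.series_exp)
    have "powers.series R M (\<lambda>\<omega> h. ennreal ((r/2) * psi \<omega> $ i) * ennreal (s h i powr 1))"
      by (intro powers.series_mult powers.series_const s_ser i) auto
    then show "powers.series R M (\<lambda>\<omega> h. ennreal ((r/2) * psi \<omega> $ i * s h i))"
      by (rule powers.series_cong) (use s01 psi(2) r in \<open>auto simp flip: ennreal_mult\<close>)
  qed (use s01 psi(2) r in auto)
  have ser1: "powers.series R ?N (\<lambda>_ h. \<Prod>i\<in>I. ennreal (s h i powr beta))"
    by (rule powers.series_prod[OF finite s_ser[OF _ beta]])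
  have ser2: "powers.series R M (\<lambda>\<omega> h. \<Prod>i\<in>I. ennreal (exp ((r/2) * psi \<omega> $ i * s h i)))"
    by (rule powers.series_prod[OF finite exp_ser])
  have "(\<lambda>\<omega>. \<Prod>i\<in>UNIV. ennreal (exp (- (r/2) * psi \<omega> $ i))) \<in> borel_measurable M" by measurable
  from powers.series_integral[OF powers.series_mult[OF powers.series_const[OF this] ser2]]
  have "powers.series R ?N (\<lambda>_ h. \<integral>\<^sup>+\<omega>. (\<Prod>i\<in>UNIV. ennreal (exp (- (r/2) * psi \<omega> $ i))) *
      (\<Prod>i\<in>I. ennreal (exp ((r/2) * psi \<omega> $ i * s h i))) \<partial>M)" .
  \<comment> \<open>The transform is the power \<open>- beta\<close> of k times the product of the
    \<open>s h i\<close> times \<open>q h\<close>. Multiplying by the power \<open>beta\<close> of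
    the first two, again a nonnegative series, leaves \<open>q h powr - beta\<close>.\<close>
  from powers.series_mult[OF powers.series_const powers.series_mult[OF ser1 this], of "\<lambda>_. ennreal (k powr beta)"]
  have "powers.series R ?N (\<lambda>_ h. ennreal (k powr beta) * ((\<Prod>i\<in>I. ennreal (s h i powr beta)) *
     (\<integral>\<^sup>+\<omega>. (\<Prod>i\<in>UNIV. ennreal (exp (- (r/2) * psi \<omega> $ i))) * (\<Prod>i\<in>I. ennreal (exp ((r/2) * psi \<omega> $ i * s h i))) \<partial>M)))"
    by simp
  then have "powers.series R ?N (\<lambda>_ h. ennreal (q h powr - beta))"
  proof (rule powers.series_cong)
    fix h assume "h \<in> {0..<R}"
    then have h: "h < R" by simp
    have "k powr beta * ((\<Prod>i\<in>I. s h i powr beta) * (k * ((\<Prod>i\<in>I. s h i) * q h)) powr - beta) = q h powr - beta"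
    proof -
      have "(\<Prod>i\<in>I. s h i powr beta) = (\<Prod>i\<in>I. s h i) powr beta"
        using s01[OF h] by (simp add: prod_powr_distrib)
      moreover have "k powr beta * (P powr beta * (k * (P * q h)) powr - beta) = q h powr - beta" if "P > 0" for P
        using k that q[OF h] by (simp add: powr_mult powr_minus field_simps)
      ultimately show ?thesis using ps[OF h] by simp
    qed
    then show "ennreal (k powr beta) * ((\<Prod>i\<in>I. ennreal (s h i powr beta)) *
       (\<integral>\<^sup>+\<omega>. (\<Prod>i\<in>UNIV. ennreal (exp (- (r/2) * psi \<omega> $ i))) * (\<Prod>i\<in>I. ennreal (exp ((r/2) * psi \<omega> $ i * s h i))) \<partial>M))
       = ennreal (q h powr - beta)"
      unfolding lap[OF h] by (simp add: prod_ennreal prod_nonneg flip: ennreal_mult)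
  qed
  from power_series_collect[OF this _ R] show ?thesis by (metis powr_ge_zero)
qed

section \<open>Signs of pair and cyclic products in the resolvent\<close>

text \<open>With a negative product the determinant is (T - h)^2 + b with \<open>b > 0\<close>:
  positive on the real line but with non-real zeros, against the Pringsheim lemma.\<close>

lemma permanental_pair:
  fixes G :: "real^'n::finite^'n"
  assumes perm: "permanental_vector M psi G beta" and beta: "beta > 0" and r: "r > 0"
    and A: "A ** (mat 1 + r *\<^sub>R G) = mat 1" and ij: "i \<noteq> j"
  shows "A $ i $ j * A $ j $ i \<ge> 0"
proof (rule ccontr)
  define b where "b = - (A $ i $ j * A $ j $ i)"
  assume "\<not> A $ i $ j * A $ j $ i \<ge> 0"
  then have b: "b > 0" by (simp add: b_def)
  define T where "T = 1 + \<bar>A $ i $ i\<bar> + \<bar>A $ j $ j\<bar>"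
  define q where "q h = det_on {i, j} (\<lambda>i j. if i = j then 1 * (T - h) else A $ i $ j)" for h
  have q: "q h = (T - h)^2 + b" for h
    unfolding q_def using ij by (simp add: det_on_2[OF ij] b_def power2_eq_square)
  obtain a where a: "\<And>n. a n \<ge> (0::real)" "\<And>h. 0 \<le> h \<Longrightarrow> h < 1 \<Longrightarrow> (\<lambda>n. a n * h ^ n) sums (q h powr - beta)"
  proof -
    have "A $ l $ l \<le> 1 * (T - 1)" if "l \<in> {i, j}" for l using that by (auto simp: T_def)
    from permanental_power_series[OF perm beta r A zero_less_one zero_less_one this]
    show ?thesis using that unfolding q_def by blast
  qed
  show False
  proof (rule nonneg_power_series_smallest_root[OF _ _ a(1) _ a(2) beta, of "\<lambda>z. (of_real T - z)^2 + of_real b" 1 "of_real T - \<i> * of_real (sqrt b)"])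
    show "(\<lambda>z. (of_real T - z)^2 + of_real b) holomorphic_on (UNIV :: complex set)"
      by (intro holomorphic_intros)
    show "(of_real T - (of_real T - \<i> * of_real (sqrt b)))^2 + of_real b = (0 :: complex)"
      using b by (simp add: power_mult_distrib flip: of_real_power)
    show "q x > 0" for x using b by (simp add: q add_nonneg_pos)
  qed (auto simp: q)
qed


text \<open>For \<open>e = 3\<close> the minimum of the cubic on the positive axis is z - 2 / sqrt
  U, which gives the bound 4; smaller \<open>e\<close> only raises the cubic there. The real root
  \<open>t0\<close> is therefore negative, and as the roots sum to zero the non-real pair has
  positive real part - t0 / 2.\<close>

lemma cubic_root_of_large_real_part:
  fixes U e z :: real
  assumes U: "U > 0" and e: "0 \<le> e" "e \<le> 3" and z: "z > 0" and Uz: "U * z\<^sup>2 > 4"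
  obtains t0 w where "t0 < 0" "t0\<^sup>2 < 4 * w" "\<And>t. U * t ^ 3 - e * t + z = U * (t - t0) * (t\<^sup>2 + t0 * t + w)"
proof -
  define g where "g t = U * t ^ 3 - e * t + z" for t :: real
  have gpos: "g t > 0" if "t \<ge> 0" for t
  proof (cases "t = 0")
    case True
    then show ?thesis using z by (simp add: g_def)
  next
    case False
    then have t: "t > 0" using that by simp
    have "4 * t ^ 3 < U * z\<^sup>2 * t ^ 3" using Uz t by simp
    moreover have "e * t * z\<^sup>2 \<le> 3 * t * z\<^sup>2" using e t by (intro mult_right_mono) auto
    moreover have "4 * t ^ 3 - 3 * t * z\<^sup>2 + z ^ 3 = (t + z) * (2 * t - z)\<^sup>2"
      by (simp add: power2_eq_square power3_eq_cube algebra_simps)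
    moreover have "(t + z) * (2 * t - z)\<^sup>2 \<ge> 0" using t z by simp
    moreover have "g t * z\<^sup>2 = U * z\<^sup>2 * t ^ 3 - e * t * z\<^sup>2 + z ^ 3"
      by (simp add: g_def power2_eq_square power3_eq_cube algebra_simps)
    ultimately have "g t * z\<^sup>2 > 0" by linarith
    then show ?thesis using z by (simp add: zero_less_mult_iff)
  qed
  define n where "n = 1 + (e + z) / U"
  have n: "n \<ge> 1" using U e z by (simp add: n_def)
  have "g (- n) < 0"
  proof -
    have "U * n = U + (e + z)" using U by (simp add: n_def field_simps)
    then have "e + z < U * n" using U by simp
    also have "\<dots> \<le> U * (n * n)" using n U by simp
    finally have "(e + z) * n < U * (n * n) * n" using n by simp
    moreover have "z \<le> z * n" using z n by simp
    ultimately have "e * n + z < U * n ^ 3" by (simp add: power3_eq_cube algebra_simps)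
    then show ?thesis by (simp add: g_def)
  qed
  moreover have "g 0 > 0" by (rule gpos) simp
  moreover have "continuous_on {- n..0} g" unfolding g_def by (intro continuous_intros)
  ultimately obtain t0 where t0: "- n \<le> t0" "t0 \<le> 0" "g t0 = 0"
    using IVT'[of g "- n" 0 0] n by auto
  have t0n: "t0 < 0" using t0 gpos[of 0] by (cases "t0 = 0") auto
  define w where "w = t0\<^sup>2 - e / U"
  have Uw: "U * w = U * t0\<^sup>2 - e" using U by (simp add: w_def right_diff_distrib)
  have fact: "g t = U * (t - t0) * (t\<^sup>2 + t0 * t + w)" for t
  proof -
    have "U * (t - t0) * (t\<^sup>2 + t0 * t + w) = U * t ^ 3 - U * t0\<^sup>2 * t + (U * w) * t - (U * w) * t0"
      by (simp add: power2_eq_square power3_eq_cube algebra_simps)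
    also have "\<dots> = U * t ^ 3 - e * t - (U * t0 ^ 3 - e * t0)"
      unfolding Uw by (simp add: power2_eq_square power3_eq_cube algebra_simps)
    also have "U * t0 ^ 3 - e * t0 = - z" using t0(3) by (simp add: g_def)
    finally show ?thesis by (simp add: g_def)
  qed
  have "t0\<^sup>2 < 4 * w"
  proof (rule ccontr)
    assume "\<not> t0\<^sup>2 < 4 * w"
    then have d: "t0\<^sup>2 - 4 * w \<ge> 0" by simp
    \<comment> \<open>The larger root of the quadratic factor would be nonnegative because
      \<open>t0 < 0\<close>, but the cubic is positive on the nonnegative axis.\<close>
    define t1 where "t1 = (- t0 + sqrt (t0\<^sup>2 - 4 * w)) / 2"
    have "sqrt (t0\<^sup>2 - 4 * w) \<ge> 0" using d by simp
    moreover have t1: "2 * t1 + t0 = sqrt (t0\<^sup>2 - 4 * w)" by (simp add: t1_def field_simps)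
    ultimately have "t1 \<ge> 0" using t0n by linarith
    have "(2 * t1 + t0)\<^sup>2 = t0\<^sup>2 - 4 * w" unfolding t1 using d by simp
    then have "t1\<^sup>2 + t0 * t1 + w = 0" by (simp add: power2_eq_square algebra_simps)
    then have "g t1 = 0" unfolding fact by simp
    then show False using gpos[OF \<open>t1 \<ge> 0\<close>] by simp
  qed
  then show ?thesis using that[OF t0n] fact unfolding g_def by blast
qed

text \<open>On the diagonal \<open>u l * (T - h)\<close> the minor is a cubic in T - h without
  quadratic term. Distinct cyclic products make z^2 exceed 4 a b c, so weights exist for which the
  non-real roots lie to the right of the real one. In the variable \<open>h\<close> and for large
  \<open>T\<close> they are then the roots nearest to \<open>0\<close>, which the Pringsheim lemma
  forbids.\<close>

lemma permanental_triple:
  fixes G :: "real^'n::finite^'n"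
  assumes perm: "permanental_vector M psi G beta" and beta: "beta > 0" and r: "r > 0"
    and A: "A ** (mat 1 + r *\<^sub>R G) = mat 1" and d: "i \<noteq> j" "j \<noteq> k" "i \<noteq> k"
    and ne: "A $ i $ j * A $ j $ k * A $ k $ i \<noteq> A $ i $ k * A $ k $ j * A $ j $ i"
  shows "A $ i $ j * A $ j $ k * A $ k $ i + A $ i $ k * A $ k $ j * A $ j $ i \<le> 0"
proof (rule ccontr)
  define x y where "x = A $ i $ j * A $ j $ k * A $ k $ i" and "y = A $ i $ k * A $ k $ j * A $ j $ i"
  define a b c where "a = A $ j $ k * A $ k $ j" and "b = A $ i $ k * A $ k $ i" and "c = A $ i $ j * A $ j $ i"
  define z where "z = x + y"
  assume "\<not> A $ i $ j * A $ j $ k * A $ k $ i + A $ i $ k * A $ k $ j * A $ j $ i \<le> 0"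
  then have z: "z > 0" by (simp add: z_def x_def y_def)
  have abc: "a \<ge> 0" "b \<ge> 0" "c \<ge> 0"
    unfolding a_def b_def c_def using permanental_pair[OF perm beta r A] d by auto
  have xy: "x * y = a * b * c" by (simp add: x_def y_def a_def b_def c_def mult_ac)
  have "(x - y)\<^sup>2 > 0" using ne by (simp add: x_def y_def)
  then have z4: "4 * ((a + 0) * (b + 0) * (c + 0)) < z\<^sup>2"
    using xy by (simp add: z_def power2_eq_square algebra_simps)
  have "((\<lambda>\<eta>. 4 * ((a + \<eta>) * (b + \<eta>) * (c + \<eta>))) \<longlongrightarrow> 4 * ((a + 0) * (b + 0) * (c + 0))) (at_right 0)"
    by (intro tendsto_intros)
  from order_tendstoD(2)[OF this z4]
  have "\<forall>\<^sub>F \<eta> in at_right 0. 4 * ((a + \<eta>) * (b + \<eta>) * (c + \<eta>)) < z\<^sup>2 \<and> \<eta> > 0"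
    by (intro eventually_conj eventually_at_right_less)
  then obtain \<eta> where \<eta>: "4 * ((a + \<eta>) * (b + \<eta>) * (c + \<eta>)) < z\<^sup>2" "\<eta> > 0"
    using eventually_happens trivial_limit_at_right_real by blast
  \<comment> \<open>These weights make \<open>e\<^sup>3 / U\<close> nearly minimal (equality case of AM-GM); \<open>\<eta>\<close> takes care of vanishing products.\<close>
  define u where "u l = (if l = i then 1 / (a + \<eta>) else if l = j then 1 / (b + \<eta>) else 1 / (c + \<eta>))" for l
  have u: "u l > 0" for l using abc \<eta> by (simp add: u_def)
  define U where "U = u i * u j * u k"
  define e where "e = u i * a + u j * b + u k * c"
  have U: "U > 0" using u by (simp add: U_def)
  have e: "0 \<le> e" "e \<le> 3"
  proof -
    have "u i * a \<le> 1" "u j * b \<le> 1" "u k * c \<le> 1" using abc \<eta> d by (auto simp: u_def)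
    then show "e \<le> 3" by (simp add: e_def)
    show "0 \<le> e" unfolding e_def using u abc by (intro add_nonneg_nonneg mult_nonneg_nonneg) (auto intro: less_imp_le)
  qed
  have Uz: "U * z\<^sup>2 > 4"
  proof -
    have "U = 1 / ((a + \<eta>) * (b + \<eta>) * (c + \<eta>))" using d by (simp add: U_def u_def)
    then have "U * z\<^sup>2 = z\<^sup>2 / ((a + \<eta>) * (b + \<eta>) * (c + \<eta>))" by simp
    moreover have "(a + \<eta>) * (b + \<eta>) * (c + \<eta>) > 0" using abc \<eta> by (intro mult_pos_pos) auto
    ultimately show ?thesis using \<eta>(1) by (simp only: pos_less_divide_eq)
  qed
  obtain t0 w where t0: "t0 < 0" and w: "t0\<^sup>2 < 4 * w"
    and fact: "\<And>t. U * t ^ 3 - e * t + z = U * (t - t0) * (t\<^sup>2 + t0 * t + w)"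
    using cubic_root_of_large_real_part[OF U e z Uz] by blast
  \<comment> \<open>The middle terms give the diagonal bound needed for radius 1. The last makes the
    non-real root closer to \<open>0\<close> than T - t0: comparing squares, this means w - t0^2 < -
    3 t0 T.\<close>
  define T where "T = 1 + \<bar>A $ i $ i / u i\<bar> + \<bar>A $ j $ j / u j\<bar> + \<bar>A $ k $ k / u k\<bar> + \<bar>(w - t0\<^sup>2) / (- 3 * t0)\<bar>"
  define q where "q h = det_on {i, j, k} (\<lambda>i j. if i = j then u i * (T - h) else A $ i $ j)" for h
  have q: "q h = U * (T - h) ^ 3 - e * (T - h) + z" for h
    unfolding q_def using d
    by (simp add: det_on_3[OF d] U_def e_def z_def x_def y_def a_def b_def c_def power3_eq_cube algebra_simps)
  obtain s where s: "\<And>n. s n \<ge> (0::real)" "\<And>h. 0 \<le> h \<Longrightarrow> h < 1 \<Longrightarrow> (\<lambda>n. s n * h ^ n) sums (q h powr - beta)"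
  proof -
    have "A $ l $ l \<le> u l * (T - 1)" if "l \<in> {i, j, k}" for l
    proof -
      have "A $ l $ l / u l \<le> T - 1" using that unfolding T_def by (elim insertE emptyE; simp only:; linarith)
      then show ?thesis using u[of l] by (simp add: pos_divide_le_eq mult.commute)
    qed
    from permanental_power_series[OF perm beta r A zero_less_one u this]
    show ?thesis using that unfolding q_def by blast
  qed
  define v where "v = sqrt (4 * w - t0\<^sup>2) / 2"
  have v2: "v\<^sup>2 = w - t0\<^sup>2 / 4" using w by (simp add: v_def power_divide diff_divide_distrib)
  define \<zeta> where "\<zeta> = Complex (- t0 / 2) v"
  have \<zeta>: "\<zeta>\<^sup>2 + of_real t0 * \<zeta> + of_real w = 0"
    using v2 by (simp add: \<zeta>_def complex_eq_iff power2_eq_square algebra_simps)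
  have norm_root: "(norm (of_real T - \<zeta>))\<^sup>2 = T\<^sup>2 + t0 * T + w"
  proof -
    have "(norm (of_real T - \<zeta>))\<^sup>2 = (T + t0 / 2)\<^sup>2 + v\<^sup>2" by (simp add: cmod_power2 \<zeta>_def)
    then show ?thesis using v2 by (simp add: power2_eq_square algebra_simps)
  qed
  have T: "T > 0" "w - t0\<^sup>2 < T * (- 3 * t0)"
  proof -
    show "T > 0" unfolding T_def by linarith
    have "(w - t0\<^sup>2) / (- 3 * t0) < T" unfolding T_def by linarith
    then show "w - t0\<^sup>2 < T * (- 3 * t0)" using t0 by (subst (asm) pos_divide_less_eq) auto
  qed
  have "norm (of_real T - \<zeta>) < T - t0"
  proof (rule power2_less_imp_less)
    show "(norm (of_real T - \<zeta>))\<^sup>2 < (T - t0)\<^sup>2"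
      unfolding norm_root using T by (simp add: power2_eq_square algebra_simps)
  qed (use T t0 in simp)
  then have pos: "q h > 0" if "0 \<le> h" "h \<le> norm (of_real T - \<zeta>)" for h
  proof -
    have 1: "T - h - t0 > 0" using that \<open>norm (of_real T - \<zeta>) < T - t0\<close> by simp
    have "4 * ((T - h)\<^sup>2 + t0 * (T - h) + w) = (2 * (T - h) + t0)\<^sup>2 + (4 * w - t0\<^sup>2)"
      by (simp add: power2_eq_square algebra_simps)
    moreover have "(2 * (T - h) + t0)\<^sup>2 + (4 * w - t0\<^sup>2) > 0"
      by (rule add_nonneg_pos) (use w in simp_all)
    ultimately have 2: "(T - h)\<^sup>2 + t0 * (T - h) + w > 0" by (metis zero_less_mult_pos zero_less_numeral)
    show ?thesis unfolding q fact using U 1 2 by (intro mult_pos_pos) auto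
  qed
  show False
  proof (rule nonneg_power_series_smallest_root[OF _ _ s(1) _ s(2) beta,
        of "\<lambda>h. of_real U * (of_real T - h) ^ 3 - of_real e * (of_real T - h) + of_real z" 1 "of_real T - \<zeta>"])
    show "(\<lambda>h. of_real U * (of_real T - h) ^ 3 - of_real e * (of_real T - h) + of_real z) holomorphic_on (UNIV :: complex set)"
      by (intro holomorphic_intros)
    \<comment> \<open>Three values of the real factorisation determine the coefficients, so that it
      can be restated over the complex numbers.\<close>
    have Uw: "U * w = U * t0\<^sup>2 - e" and zt: "z = - (U * w) * t0"
      using fact[of 1] fact[of "-1"] fact[of 0] by (simp_all add: power2_eq_square power3_eq_cube algebra_simps)
    have "of_real U * \<zeta> ^ 3 - of_real e * \<zeta> + of_real z = of_real U * (\<zeta> - of_real t0) * (\<zeta>\<^sup>2 + of_real t0 * \<zeta> + of_real w)"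
    proof -
      have e: "e = U * t0\<^sup>2 - U * w" using Uw by simp
      show ?thesis unfolding zt e by (simp add: power2_eq_square power3_eq_cube algebra_simps)
    qed
    then show "of_real U * (of_real T - (of_real T - \<zeta>)) ^ 3 - of_real e * (of_real T - (of_real T - \<zeta>)) + of_real z = (0::complex)"
      using \<zeta> by simp
    show "of_real U * (of_real T - of_real h) ^ 3 - of_real e * (of_real T - of_real h) + of_real z = (of_real (q h) :: complex)" for h
      by (simp add: q)
  qed (use pos in auto)
qed

section \<open>Sign conjugation and symmetric triples\<close>

text \<open>This is D M D with D = Diag \<sigma>. For signs, D is its own inverse, so the
  determinants in the Laplace transform, and with them the property of being a kernel of
  \<open>psi\<close>, are preserved.\<close>

definition sign_conj :: "('n \<Rightarrow> real) \<Rightarrow> real^'n::finite^'n \<Rightarrow> real^'n^'n" where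
  "sign_conj \<sigma> M = (\<chi> i j. \<sigma> i * \<sigma> j * M $ i $ j)"

lemma det_sign_conj:
  fixes M :: "real^'n::finite^'n"
  assumes "\<And>i. \<sigma> i = 1 \<or> \<sigma> i = -1"
  shows "det (sign_conj \<sigma> M) = det M"
  unfolding det_def
proof (rule sum.cong[OF refl])
  fix p :: "'n \<Rightarrow> 'n" assume "p \<in> {p. p permutes UNIV}"
  then have p: "p permutes UNIV" by simp
  have "(\<Prod>i\<in>UNIV. sign_conj \<sigma> M $ i $ p i) = (\<Prod>i\<in>UNIV. \<sigma> i) * (\<Prod>i\<in>UNIV. \<sigma> (p i)) * (\<Prod>i\<in>UNIV. M $ i $ p i)"
    by (simp add: sign_conj_def prod.distrib)
  also have "(\<Prod>i\<in>UNIV. \<sigma> (p i)) = (\<Prod>i\<in>UNIV. \<sigma> i)"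
    using prod.permute[OF p, of \<sigma>] by (simp add: comp_def)
  also have "(\<Prod>i\<in>UNIV. \<sigma> i) * (\<Prod>i\<in>UNIV. \<sigma> i) = 1"
  proof -
    have "\<sigma> i * \<sigma> i = 1" for i using assms[of i] by auto
    then show ?thesis by (simp flip: prod.distrib)
  qed
  finally show "of_int (sign p) * (\<Prod>i\<in>UNIV. sign_conj \<sigma> M $ i $ p i) = of_int (sign p) * (\<Prod>i\<in>UNIV. M $ i $ p i)"
    by simp
qed

lemma kernel_det_sign_conj:
  fixes G :: "real^'n::finite^'n"
  assumes "\<And>i. \<sigma> i = 1 \<or> \<sigma> i = -1"
  shows "kernel_det (sign_conj \<sigma> G) a = kernel_det G a"
proof -
  have sq: "\<sigma> i * \<sigma> i = 1" for i using assms[of i] by auto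
  have "(\<chi> i j. (if i = j then 1 else 0) + a i * sign_conj \<sigma> G $ i $ j) =
     sign_conj \<sigma> (\<chi> i j. (if i = j then 1 else 0) + a i * G $ i $ j)"
    using sq by (auto simp: sign_conj_def vec_eq_iff algebra_simps)
  then show ?thesis using det_sign_conj[OF assms] by (simp add: kernel_det_def)
qed

lemma permanental_sign_conj:
  fixes G :: "real^'n::finite^'n"
  assumes "permanental_vector M psi G beta" "\<And>i. \<sigma> i = 1 \<or> \<sigma> i = -1"
  shows "permanental_vector M psi (sign_conj \<sigma> G) beta"
  using assms(1) kernel_det_sign_conj[of \<sigma>, OF assms(2)] unfolding permanental_vector_def kernel_det_eq by simp

definition tri :: "real^'n^'n \<Rightarrow> 'n \<Rightarrow> 'n \<Rightarrow> 'n \<Rightarrow> real" where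
  "tri G i j k = G $ i $ j * G $ j $ k * G $ k $ i"

text \<open>Reordering the indices fixes or swaps the two cyclic products, so this is a property of
  the set. Given nonnegative pair products it implies symmetrizability by
  \<open>symmetrizable_on_3\<close>.\<close>

definition sym_triple :: "real^'n^'n \<Rightarrow> 'n set \<Rightarrow> bool" where
  "sym_triple G I \<longleftrightarrow> (\<exists>i j k. I = {i, j, k} \<and> i \<noteq> j \<and> j \<noteq> k \<and> i \<noteq> k \<and> tri G i j k = tri G i k j)"

lemma not_sym_tripleD:
  "\<not> sym_triple G {i, j, k} \<Longrightarrow> i \<noteq> j \<Longrightarrow> j \<noteq> k \<Longrightarrow> i \<noteq> k \<Longrightarrow> tri G i j k \<noteq> tri G i k j"
  unfolding sym_triple_def by blast

lemma real_polynomial_function_eventually_nonzero: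
  fixes h :: "real \<Rightarrow> real"
  assumes h: "real_polynomial_function h" and "h x0 \<noteq> 0"
  shows "eventually (\<lambda>r. h r \<noteq> 0) at_top"
proof -
  obtain a n where hn: "h = (\<lambda>x. \<Sum>i\<le>n. a i * x ^ i)"
    using real_polynomial_function_imp_sum[OF h] by blast
  have "\<exists>i\<le>n. a i \<noteq> 0"
  proof (rule ccontr)
    assume "\<not> (\<exists>i\<le>n. a i \<noteq> 0)"
    then have "h x0 = 0" unfolding hn by (intro sum.neutral) auto
    then show False using assms(2) by simp
  qed
  then have fin: "finite {x. h x = 0}" unfolding hn using polyfun_finite_roots by blast
  then obtain b where b: "\<And>x. x \<in> {x. h x = 0} \<Longrightarrow> x \<le> b"
    by (meson bdd_above_def bdd_above_finite)
  show ?thesis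
    using eventually_gt_at_top[of b] by eventually_elim (use b in force)
qed

section \<open>Dependence of the resolvent on r\<close>

definition resolvent :: "real^'n::finite^'n \<Rightarrow> real \<Rightarrow> real^'n^'n" where
  "resolvent G r = matrix_inv (mat 1 + r *\<^sub>R G)"

lemma det_resolvent_kernel: "det (mat 1 + r *\<^sub>R G) = kernel_det G (\<lambda>_. r)"
  unfolding kernel_det_def by (rule arg_cong[where f=det]) (simp add: vec_eq_iff mat_def)

lemma resolvent_inverse:
  fixes G :: "real^'n::finite^'n"
  assumes "permanental_vector M psi G beta" "r \<ge> 0"
  shows "resolvent G r ** (mat 1 + r *\<^sub>R G) = mat 1" "(mat 1 + r *\<^sub>R G) ** resolvent G r = mat 1"
proof -
  have "invertible (mat 1 + r *\<^sub>R G)"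
    using permanental_det_pos[OF assms(1), of "\<lambda>_. r"] assms(2)
    by (simp add: invertible_det_nz det_resolvent_kernel)
  then show "resolvent G r ** (mat 1 + r *\<^sub>R G) = mat 1" "(mat 1 + r *\<^sub>R G) ** resolvent G r = mat 1"
    unfolding resolvent_def matrix_inv_def invertible_def by (metis (mono_tags, lifting) someI_ex)+
qed

text \<open>
  \<open>E = G adj (I + r G)\<close>: dividing the factor \<open>r\<close> out of the off-diagonal cofactors leaves polynomials with
  value \<open>G\<close> at \<open>r = 0\<close>, so asymmetry of a triple of \<open>G\<close> survives for all large \<open>r\<close>.
\<close>

lemma resolvent_polynomial:
  fixes G :: "real^'n::finite^'n"
  assumes perm: "permanental_vector M psi G beta"
  obtains E where "\<And>i j. real_polynomial_function (\<lambda>r. E r i j)" "\<And>i j. E 0 i j = G $ i $ j"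
    "\<And>r i j. r \<ge> 0 \<Longrightarrow> i \<noteq> j \<Longrightarrow> resolvent G r $ i $ j = - (r / kernel_det G (\<lambda>_. r)) * E r i j"
proof -
  define K where "K r = mat 1 + r *\<^sub>R G" for r
  \<comment> \<open>By Cramer's rule \<open>C r k j\<close> is the entry \<open>k\<close>,
    \<open>j\<close> of the adjugate of \<open>K r\<close>.\<close>
  define C where "C r k j = det (\<chi> i l. if l = k then (if i = j then 1 else 0) else K r $ i $ l)" for r k j
  define E where "E r i j = (\<Sum>k\<in>UNIV. G $ i $ k * C r k j)" for r i j
  have Kpoly: "real_polynomial_function (\<lambda>r. K r $ i $ l)" for i l
    using real_polynomial_function_affine[of "mat 1 $ i $ l" "G $ i $ l"] by (simp add: K_def)
  have Cpoly: "real_polynomial_function (\<lambda>r. C r k j)" for k j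
    unfolding C_def
  proof (rule real_polynomial_function_det)
    fix i l
    show "real_polynomial_function (\<lambda>r. (\<chi> i l. if l = k then (if i = j then 1 else 0) else K r $ i $ l) $ i $ l)"
      using Kpoly[of i l] by (simp add: real_polynomial_function_if real_polynomial_function.intros(2))
  qed
  show ?thesis
  proof
    show "real_polynomial_function (\<lambda>r. E r i j)" for i j
      unfolding E_def
      by (intro real_polynomial_function_sum real_polynomial_function.intros(4)
          real_polynomial_function.intros(2) Cpoly) auto
    have C0: "C 0 k j = (if k = j then 1 else 0)" for k j
    proof -
      have "(\<chi> i l. if l = k then (if i = j then 1 else 0) else K 0 $ i $ l) =
        (\<chi> i l. if l = k then (if i = j then 1 else 0) else if i = l then 1 else (0::real))"
        by (auto simp: K_def mat_def vec_eq_iff)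
      then show ?thesis unfolding C_def by (simp only: det_replace_column)
    qed
    show "E 0 i j = G $ i $ j" for i j
    proof -
      have "E 0 i j = (\<Sum>k\<in>UNIV. if k = j then G $ i $ k else 0)"
        unfolding E_def C0 by (rule sum.cong) auto
      then show ?thesis by simp
    qed
    fix r :: real and i j :: 'n assume r: "r \<ge> 0" and ij: "i \<noteq> j"
    have dK: "det (K r) = kernel_det G (\<lambda>_. r)" unfolding K_def by (rule det_resolvent_kernel)
    have nz: "det (K r) \<noteq> 0" using permanental_det_pos[OF perm, of "\<lambda>_. r"] r by (simp add: dK)
    have KA: "K r ** resolvent G r = mat 1" unfolding K_def by (rule resolvent_inverse(2)[OF perm r])
    have A: "resolvent G r $ k $ j = C r k j / det (K r)" for k
    proof -
      have "K r *v (\<chi> k. resolvent G r $ k $ j) = (\<chi> i. if i = j then 1 else 0)"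
        using KA by (simp add: vec_eq_iff matrix_matrix_mult_def matrix_vector_mult_def mat_def)
      then have "(\<chi> k. resolvent G r $ k $ j) = (\<chi> k. det (\<chi> i l. if l = k then (\<chi> i. if i = j then 1 else 0) $ i else K r $ i $ l) / det (K r))"
        using cramer[OF nz] by blast
      then show ?thesis unfolding vec_eq_iff vec_lambda_beta C_def by blast
    qed
    \<comment> \<open>An off-diagonal entry of (I + r G) A = I gives A_ij = - r (G A)_ij, which is
      where the factor \<open>r\<close> comes from.\<close>
    have "(\<Sum>k\<in>UNIV. ((if i = k then 1 else 0) + r * G $ i $ k) * resolvent G r $ k $ j) = 0"
      using KA ij by (simp add: vec_eq_iff matrix_matrix_mult_def mat_def K_def)
    moreover have "(\<Sum>k\<in>UNIV. ((if i = k then 1 else 0) + r * G $ i $ k) * resolvent G r $ k $ j) =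
        resolvent G r $ i $ j + r * (\<Sum>k\<in>UNIV. G $ i $ k * resolvent G r $ k $ j)"
    proof -
      have "(\<Sum>k\<in>UNIV. ((if i = k then 1 else 0) + r * G $ i $ k) * resolvent G r $ k $ j) =
        (\<Sum>k\<in>UNIV. (if i = k then resolvent G r $ k $ j else 0) + r * (G $ i $ k * resolvent G r $ k $ j))"
        by (rule sum.cong) (auto simp: algebra_simps)
      then show ?thesis by (simp add: sum.distrib sum_distrib_left)
    qed
    ultimately have "resolvent G r $ i $ j = - r * (\<Sum>k\<in>UNIV. G $ i $ k * resolvent G r $ k $ j)" by simp
    then show "resolvent G r $ i $ j = - (r / kernel_det G (\<lambda>_. r)) * E r i j"
      unfolding A E_def dK[symmetric] by (simp add: sum_divide_distrib sum_distrib_left divide_inverse mult_ac)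
  qed
qed

text \<open>The sign found for the resolvent passes to the kernel as r decreases to 0, since the
  rescaled off-diagonal entries \<open>E r i j\<close> tend to those of \<open>G\<close>.\<close>

lemma permanental_kernel_pair:
  fixes G :: "real^'n::finite^'n"
  assumes perm: "permanental_vector M psi G beta" and beta: "beta > 0" and ij: "i \<noteq> j"
  shows "G $ i $ j * G $ j $ i \<ge> 0"
proof -
  obtain E where E: "\<And>i j. real_polynomial_function (\<lambda>r. E r i j)" "\<And>i j. E 0 i j = G $ i $ j"
    "\<And>r i j. r \<ge> 0 \<Longrightarrow> i \<noteq> j \<Longrightarrow> resolvent G r $ i $ j = - (r / kernel_det G (\<lambda>_. r)) * E r i j"
    using resolvent_polynomial[OF perm] by blast
  have nn: "E r i j * E r j i \<ge> 0" if r: "r > 0" for r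
  proof -
    define c where "c = r / kernel_det G (\<lambda>_. r)"
    have c: "c > 0" using permanental_det_pos[OF perm, of "\<lambda>_. r"] r by (simp add: c_def)
    have "resolvent G r $ i $ j * resolvent G r $ j $ i \<ge> 0"
      using permanental_pair[OF perm beta r resolvent_inverse(1)[OF perm] ij] r by simp
    also have "resolvent G r $ i $ j * resolvent G r $ j $ i = c * c * (E r i j * E r j i)"
      using E(3)[of r i j] E(3)[of r j i] r ij by (simp add: c_def)
    finally show ?thesis using c by (metis mult_le_cancel_left_pos mult_zero_right mult_pos_pos)
  qed
  have "continuous_on UNIV (\<lambda>r. E r i j * E r j i)"
    by (intro continuous_intros continuous_on_real_polynomial_function E)
  then have "((\<lambda>r. E r i j * E r j i) \<longlongrightarrow> E 0 i j * E 0 j i) (at 0)"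
    by (simp add: continuous_on_def)
  then have "((\<lambda>r. E r i j * E r j i) \<longlongrightarrow> E 0 i j * E 0 j i) (at_right 0)"
    by (rule filterlim_mono) (auto simp: at_le)
  moreover have "\<forall>\<^sub>F r in at_right 0. 0 \<le> E r i j * E r j i"
    using eventually_at_right_less[of 0] by eventually_elim (rule nn)
  ultimately have "0 \<le> E 0 i j * E 0 j i" by (intro tendsto_lowerbound) auto
  then show ?thesis by (simp add: E(2))
qed

text \<open>The difference of the cyclic products of the resolvent is a nonzero factor times a
  polynomial in \<open>r\<close> that does not vanish at \<open>0\<close>; it has finitely many
  zeros, and there are finitely many triples.\<close>

lemma resolvent_eventually_asymmetric:
  fixes G :: "real^'n::finite^'n"
  assumes perm: "permanental_vector M psi G beta"
  shows "eventually (\<lambda>r. r > 0 \<and> (\<forall>i j k. i \<noteq> j \<longrightarrow> j \<noteq> k \<longrightarrow> i \<noteq> k \<longrightarrow> tri G i j k \<noteq> tri G i k j \<longrightarrow>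
     tri (resolvent G r) i j k \<noteq> tri (resolvent G r) i k j)) at_top"
proof -
  obtain E where E: "\<And>i j. real_polynomial_function (\<lambda>r. E r i j)" "\<And>i j. E 0 i j = G $ i $ j"
    "\<And>r i j. r \<ge> 0 \<Longrightarrow> i \<noteq> j \<Longrightarrow> resolvent G r $ i $ j = - (r / kernel_det G (\<lambda>_. r)) * E r i j"
    using resolvent_polynomial[OF perm] by blast
  have one: "eventually (\<lambda>r. i \<noteq> j \<longrightarrow> j \<noteq> k \<longrightarrow> i \<noteq> k \<longrightarrow> tri G i j k \<noteq> tri G i k j \<longrightarrow>
     tri (resolvent G r) i j k \<noteq> tri (resolvent G r) i k j) at_top" for i j k
  proof (cases "i \<noteq> j \<and> j \<noteq> k \<and> i \<noteq> k \<and> tri G i j k \<noteq> tri G i k j")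
    case True
    let ?h = "\<lambda>r. E r i j * E r j k * E r k i - E r i k * E r k j * E r j i"
    have "eventually (\<lambda>r. ?h r \<noteq> 0) at_top"
    proof (rule real_polynomial_function_eventually_nonzero)
      show "real_polynomial_function ?h"
        by (intro real_polynomial_function_diff real_polynomial_function.intros(4) E)
      show "?h 0 \<noteq> 0" using True by (simp add: E(2) tri_def)
    qed
    then show ?thesis
      using eventually_gt_at_top[of 0]
    proof eventually_elim
      case (elim r)
      define c where "c = - (r / kernel_det G (\<lambda>_. r))"
      have c: "c \<noteq> 0" using permanental_det_pos[OF perm, of "\<lambda>_. r"] elim(2) by (simp add: c_def)
      have A: "resolvent G r $ a $ b = c * E r a b" if "a \<noteq> b" for a b
        using E(3)[of r a b] elim(2) that by (simp add: c_def)
      have "tri (resolvent G r) i j k - tri (resolvent G r) i k j = c ^ 3 * ?h r"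
      proof -
        have d: "i \<noteq> j" "j \<noteq> i" "j \<noteq> k" "k \<noteq> j" "i \<noteq> k" "k \<noteq> i" using True by auto
        show ?thesis
          unfolding tri_def A[OF d(1)] A[OF d(2)] A[OF d(3)] A[OF d(4)] A[OF d(5)] A[OF d(6)]
          by (simp add: power3_eq_cube algebra_simps)
      qed
      then show ?case using c elim(1) by auto
    qed
  qed auto
  have "eventually (\<lambda>r. \<forall>i j k. i \<noteq> j \<longrightarrow> j \<noteq> k \<longrightarrow> i \<noteq> k \<longrightarrow> tri G i j k \<noteq> tri G i k j \<longrightarrow>
     tri (resolvent G r) i j k \<noteq> tri (resolvent G r) i k j) at_top"
    by (intro eventually_all_finite one)
  then show ?thesis by (intro eventually_conj eventually_gt_at_top)
qed

section \<open>M-matrix structure of the resolvent and its limit\<close>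

lemma matrix_entry_mult: "(A ** B) $ i $ j = (\<Sum>k\<in>UNIV. A $ i $ k * B $ k $ j)"
  by (simp add: matrix_matrix_mult_def)

text \<open>For an asymmetric triple the cyclic products of A differ and have nonpositive sum, so
  one is negative and \<open>- A\<close> has a positive cyclic product: the input for
  \<open>signature_exists\<close>. The conjugated resolvent is then an M-matrix, and its inverse is
  entrywise nonnegative because each column \<open>u\<close> of it solves Z u = e_j.\<close>

lemma resolvent_signature:
  fixes G :: "real^'n::finite^'n"
  assumes perm: "permanental_vector M psi G beta" and beta: "beta > 0" and card: "CARD('n) > 3"
    and one: "\<forall>I J. sym_triple G I \<longrightarrow> sym_triple G J \<longrightarrow> I = J"
    and r: "r > 0" and gen: "\<forall>i j k. i \<noteq> j \<longrightarrow> j \<noteq> k \<longrightarrow> i \<noteq> k \<longrightarrow> tri G i j k \<noteq> tri G i k j \<longrightarrow>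
     tri (resolvent G r) i j k \<noteq> tri (resolvent G r) i k j"
  obtains \<sigma> v where "\<And>i. \<sigma> i = 1 \<or> \<sigma> i = -1"
    "\<And>i j. i \<noteq> j \<Longrightarrow> sign_conj \<sigma> (resolvent G r) $ i $ j \<le> 0"
    "\<And>i j. 0 \<le> sign_conj \<sigma> (mat 1 + r *\<^sub>R G) $ i $ j"
    "\<And>i. v $ i > 0" "sign_conj \<sigma> (resolvent G r) *v v = (\<chi> i. 1)"
proof -
  define A where "A = resolvent G r"
  define K where "K = mat 1 + r *\<^sub>R G"
  have AK: "A ** K = mat 1" unfolding A_def K_def using resolvent_inverse(1)[OF perm] r by simp
  note pair = permanental_pair[OF perm beta r AK[unfolded K_def]]
  note triple = permanental_triple[OF perm beta r AK[unfolded K_def]]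
  obtain \<sigma> where \<sigma>: "\<And>i. \<sigma> i = 1 \<or> \<sigma> i = -1" "\<And>i j. i \<noteq> j \<Longrightarrow> \<sigma> i * \<sigma> j * (- A $ i $ j) \<ge> (0::real)"
  proof (rule signature_exists[OF card, of "\<lambda>i j. - A $ i $ j" "sym_triple G"])
    show "- A $ i $ j * - A $ j $ i \<ge> 0" if "i \<noteq> j" for i j using pair[OF that] by simp
    fix i j k assume d: "i \<noteq> j" "j \<noteq> k" "i \<noteq> k" and ns: "\<not> sym_triple G {i, j, k}"
    let ?x = "A $ i $ j * A $ j $ k * A $ k $ i" and ?y = "A $ i $ k * A $ k $ j * A $ j $ i"
    have ne: "?x \<noteq> ?y" using gen d not_sym_tripleD[OF ns d] by (simp add: tri_def A_def)
    then have s: "?x + ?y \<le> 0" using triple[OF d] by simp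
    from ne s have "?x < 0 \<or> ?y < 0" by linarith
    then show "- A $ i $ j * - A $ j $ k * - A $ k $ i > 0 \<or> - A $ i $ k * - A $ k $ j * - A $ j $ i > 0" by simp
  qed (use one in blast)+
  have sq: "\<sigma> i * \<sigma> i = 1" for i using \<sigma>(1)[of i] by auto
  define Z where "Z = sign_conj \<sigma> A"
  have off: "Z $ i $ j \<le> 0" if "i \<noteq> j" for i j using \<sigma>(2)[OF that] by (simp add: Z_def sign_conj_def)
  \<comment> \<open>The value \<open>s = 1 / (1 + t)\<close> at all indices turns
    \<open>resolvent_det\<close> into a formula for det (A + t I), with positive kernel determinants
    on both sides.\<close>
  have dt: "det (Z + t *\<^sub>R mat 1) > 0" if t: "t \<ge> 0" for t
  proof -
    define s where "s = 1 / (1 + t)"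
    have s: "0 < s" "s \<le> 1" "1 / s - 1 = t" using t by (auto simp: s_def)
    have "Z + t *\<^sub>R mat 1 = sign_conj \<sigma> (A + t *\<^sub>R mat 1)"
      using sq by (auto simp: Z_def sign_conj_def vec_eq_iff mat_def algebra_simps)
    then have "det (Z + t *\<^sub>R mat 1) = det (A + t *\<^sub>R mat 1)" using det_sign_conj[OF \<sigma>(1)] by simp
    also have "A + t *\<^sub>R mat 1 = (\<chi> i j. if i \<in> UNIV then (if i = j then 1 / s - 1 + A $ i $ i else A $ i $ j) else if i = j then 1 else 0)"
      using s(3) by (auto simp: vec_eq_iff mat_def)
    also have "det \<dots> = det_on UNIV (\<lambda>i j. if i = j then 1 / s - 1 + A $ i $ i else A $ i $ j)"
      by (rule det_identity_rows)
    finally have "kernel_det G (\<lambda>_. r * (1 - s)) = kernel_det G (\<lambda>_. r) * ((\<Prod>i\<in>(UNIV::'n set). s) * det (Z + t *\<^sub>R mat 1))"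
      using resolvent_det[OF AK[unfolded K_def], of UNIV "\<lambda>_. s"] s(1) by simp
    moreover have "kernel_det G (\<lambda>_. r * (1 - s)) > 0" "kernel_det G (\<lambda>_. r) > 0"
      using permanental_det_pos[OF perm] s r by auto
    moreover have "(\<Prod>i\<in>(UNIV::'n set). s) > 0" using s by (intro prod_pos) auto
    ultimately show ?thesis by (metis zero_less_mult_pos)
  qed
  obtain v where v: "\<And>i. v $ i > 0" "Z *v v = (\<chi> i. 1)" using M_matrix_positive_vector[OF off dt] by blast
  have W: "0 \<le> sign_conj \<sigma> K $ i $ j" for i j
  proof -
    define u where "u = (\<chi> i. sign_conj \<sigma> K $ i $ j)"
    have Zu: "(Z *v u) $ l = (if l = j then 1 else 0)" for l
    proof -
      have "(Z *v u) $ l = (\<Sum>k\<in>UNIV. \<sigma> l * \<sigma> j * (A $ l $ k * K $ k $ j))"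
        unfolding matrix_vector_mult_def Z_def u_def sign_conj_def vec_lambda_beta
      proof (rule sum.cong[OF refl])
        fix k
        have "\<sigma> l * \<sigma> k * A $ l $ k * (\<sigma> k * \<sigma> j * K $ k $ j) = \<sigma> l * \<sigma> j * (A $ l $ k * K $ k $ j) * (\<sigma> k * \<sigma> k)"
          by (simp add: mult_ac)
        then show "\<sigma> l * \<sigma> k * A $ l $ k * (\<sigma> k * \<sigma> j * K $ k $ j) = \<sigma> l * \<sigma> j * (A $ l $ k * K $ k $ j)"
          by (simp add: sq)
      qed
      also have "\<dots> = \<sigma> l * \<sigma> j * (A ** K) $ l $ j" by (simp add: matrix_entry_mult sum_distrib_left)
      finally show ?thesis unfolding AK by (simp add: mat_def sq)
    qed
    have "u $ i \<ge> 0"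
    proof (rule Z_matrix_monotone[OF off v(1)])
      show "0 < (Z *v v) $ l" for l by (simp add: v(2))
      show "0 \<le> (Z *v u) $ l" for l by (simp add: Zu)
    qed
    then show ?thesis by (simp add: u_def)
  qed
  show ?thesis
    by (rule that[of \<sigma> v]) (use \<sigma>(1) off v W in \<open>simp_all add: Z_def A_def K_def\<close>)
qed


text \<open>Among four indices every pair lies in two different triples, and at most one of them is
  symmetric.\<close>

lemma asymmetric_triple_exists:
  fixes G :: "real^'n::finite^'n"
  assumes card: "CARD('n) > 3" and one: "\<forall>I J. sym_triple G I \<longrightarrow> sym_triple G J \<longrightarrow> I = J"
    and ij: "i \<noteq> j"
  obtains k where "k \<noteq> i" "k \<noteq> j" "tri G i j k \<noteq> tri G i k j"
proof -
  obtain k where k: "k \<noteq> i" "k \<noteq> j" using other_index[OF card, of i j j] by blast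
  obtain l where l: "l \<noteq> i" "l \<noteq> j" "l \<noteq> k" using other_index[OF card, of i j k] by blast
  have "{i, j, k} \<noteq> {i, j, l}" using k l by auto
  then have "\<not> sym_triple G {i, j, k} \<or> \<not> sym_triple G {i, j, l}" using one by blast
  then show ?thesis
    using that[OF k] that[OF l(1,2)] not_sym_tripleD[of G i j k] not_sym_tripleD[of G i j l] ij k l by metis
qed

text \<open>Nonnegative off-diagonal entries make the signature trivial at every good
  \<open>r\<close>, so all resolvents are M-matrices themselves and sign conditions and inequalities
  survive the limit in \<open>r\<close>.\<close>

lemma nonneg_kernel_inverse:
  fixes G :: "real^'n::finite^'n"
  assumes perm: "permanental_vector M psi G beta" and beta: "beta > 0" and card: "CARD('n) > 3"
    and one: "\<forall>I J. sym_triple G I \<longrightarrow> sym_triple G J \<longrightarrow> I = J"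
    and off: "\<And>i j. i \<noteq> j \<Longrightarrow> G $ i $ j \<ge> 0"
  obtains B where "B ** G = mat 1" "\<And>i j. i \<noteq> j \<Longrightarrow> B $ i $ j \<le> 0" "\<And>i j. G $ i $ j \<ge> 0" "\<And>i. G $ i $ i > 0"
proof -
  define good where "good r \<longleftrightarrow> r > 0 \<and> (\<forall>i j k. i \<noteq> j \<longrightarrow> j \<noteq> k \<longrightarrow> i \<noteq> k \<longrightarrow> tri G i j k \<noteq> tri G i k j \<longrightarrow>
     tri (resolvent G r) i j k \<noteq> tri (resolvent G r) i k j)" for r
  have ev: "eventually good at_top"
    unfolding good_def by (rule resolvent_eventually_asymmetric[OF perm])
  have nz: "G $ i $ j > 0 \<or> G $ j $ i > 0" if ij: "i \<noteq> j" for i j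
  proof -
    obtain k where "k \<noteq> i" "k \<noteq> j" "tri G i j k \<noteq> tri G i k j"
      using asymmetric_triple_exists[OF card one ij] by blast
    then have "G $ i $ j \<noteq> 0 \<or> G $ j $ i \<noteq> 0" by (auto simp: tri_def)
    then show ?thesis using off[OF ij] off[of j i] ij by force
  qed
  have res: "(\<forall>i j. i \<noteq> j \<longrightarrow> resolvent G r $ i $ j \<le> 0) \<and> (\<forall>i j. 0 \<le> (mat 1 + r *\<^sub>R G) $ i $ j) \<and>
      (\<exists>v. (\<forall>i. v $ i > 0) \<and> resolvent G r *v v = (\<chi> i. 1))" if r: "good r" for r
  proof -
    have r0: "r > 0" using r by (simp add: good_def)
    note gen = r[unfolded good_def, THEN conjunct2]
    obtain \<sigma> v where \<sigma>: "\<And>i. \<sigma> i = 1 \<or> \<sigma> i = -1"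
      "\<And>i j. i \<noteq> j \<Longrightarrow> sign_conj \<sigma> (resolvent G r) $ i $ j \<le> 0"
      "\<And>i j. 0 \<le> sign_conj \<sigma> (mat 1 + r *\<^sub>R G) $ i $ j"
      "\<And>i. v $ i > 0" "sign_conj \<sigma> (resolvent G r) *v v = (\<chi> i. 1)"
      by (rule resolvent_signature[OF perm beta card one r0 gen]) blast
    \<comment> \<open>By \<open>nz\<close> each pair of indices carries a positive entry of
      \<open>G\<close> in one of the two directions, and conjugation keeps it nonnegative only if
      the two signs agree.\<close>
    have s1: "\<sigma> i * \<sigma> j = 1" for i j
    proof (cases "i = j")
      case True
      then show ?thesis using \<sigma>(1)[of i] by auto
    next
      case False
      have *: "\<sigma> a * \<sigma> b = 1" if "a \<noteq> b" "G $ a $ b > 0" for a b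
      proof -
        have "0 \<le> \<sigma> a * \<sigma> b * (r * G $ a $ b)"
          using \<sigma>(3)[of a b] that(1) by (simp add: sign_conj_def mat_def)
        moreover have "r * G $ a $ b > 0" using r0 that(2) by simp
        ultimately have "0 \<le> \<sigma> a * \<sigma> b" by (metis zero_le_mult_iff not_le)
        then show ?thesis using \<sigma>(1)[of a] \<sigma>(1)[of b] by auto
      qed
      show ?thesis using nz[OF False] *[of i j] *[of j i] False by (auto simp: mult.commute)
    qed
    have id: "sign_conj \<sigma> X = X" for X :: "real^'n^'n" by (simp add: sign_conj_def s1 vec_eq_iff)
    show ?thesis using \<sigma>(2-5) unfolding id by blast
  qed
  have AK: "(\<Sum>k\<in>UNIV. resolvent G r $ i $ k * (mat 1 + r *\<^sub>R G) $ k $ j) = (if i = j then 1 else 0)" if "good r" for r i j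
    using resolvent_inverse(1)[OF perm, of r] that unfolding good_def
    by (simp add: vec_eq_iff matrix_entry_mult mat_def)
  \<comment> \<open>The path-product inequality for inverses of M-matrices. The vector
    \<open>u\<close> has image K_cc e_b - K_cb e_c; the possibly negative entry sits at
    \<open>c\<close>, where \<open>u\<close> itself vanishes.\<close>
  have ineqK: "(mat 1 + r *\<^sub>R G) $ a $ c * (mat 1 + r *\<^sub>R G) $ c $ b \<le> (mat 1 + r *\<^sub>R G) $ a $ b * (mat 1 + r *\<^sub>R G) $ c $ c"
    if r: "good r" for r a b c
  proof -
    define K where "K = mat 1 + r *\<^sub>R G"
    define A where "A = resolvent G r"
    obtain v where v: "\<And>i. v $ i > 0" "A *v v = (\<chi> i. 1)" using res[OF r] unfolding A_def by blast
    have Aoff: "A $ i $ j \<le> 0" if "i \<noteq> j" for i j using res[OF r] that unfolding A_def by blast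
    define u where "u = (\<chi> i. K $ i $ b * K $ c $ c - K $ i $ c * K $ c $ b)"
    have Au: "(A *v u) $ i = (if i = b then 1 else 0) * K $ c $ c - (if i = c then 1 else 0) * K $ c $ b" for i
    proof -
      have "(A *v u) $ i = (\<Sum>k\<in>UNIV. A $ i $ k * K $ k $ b) * K $ c $ c - (\<Sum>k\<in>UNIV. A $ i $ k * K $ k $ c) * K $ c $ b"
        unfolding matrix_vector_mult_def u_def vec_lambda_beta sum_distrib_right sum_subtractf[symmetric]
        by (rule sum.cong) (auto simp: algebra_simps)
      then show ?thesis using AK[OF r] unfolding A_def K_def by simp
    qed
    have "u $ a \<ge> 0"
    proof (rule Z_matrix_monotone[OF Aoff v(1)])
      show "0 < (A *v v) $ i" for i by (simp add: v(2))
      show "0 \<le> (A *v u) $ i" if "u $ i < 0" for i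
      proof -
        have "i \<noteq> c" using that by (auto simp: u_def)
        moreover have "K $ c $ c \<ge> 0" using res[OF r] unfolding K_def by blast
        ultimately show ?thesis by (simp add: Au)
      qed
    qed
    then show ?thesis by (simp add: u_def K_def)
  qed
  have lim: "((\<lambda>r. (mat 1 + r *\<^sub>R G) $ a $ b / r) \<longlongrightarrow> G $ a $ b) at_top" for a b
  proof -
    have "((\<lambda>r. (mat 1 :: real^'n^'n) $ a $ b / r + G $ a $ b) \<longlongrightarrow> 0 + G $ a $ b) at_top"
      by (intro tendsto_add tendsto_const tendsto_divide_0[OF tendsto_const] filterlim_at_top_imp_at_infinity filterlim_ident)
    then have "((\<lambda>r. (mat 1 :: real^'n^'n) $ a $ b / r + G $ a $ b) \<longlongrightarrow> G $ a $ b) at_top" by simp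
    then show ?thesis
    proof (rule Lim_transform_eventually)
      show "\<forall>\<^sub>F r in at_top. (mat 1 :: real^'n^'n) $ a $ b / r + G $ a $ b = (mat 1 + r *\<^sub>R G) $ a $ b / r"
        using eventually_gt_at_top[of 0] by eventually_elim (simp add: add_divide_distrib)
    qed
  qed
  have Gnn: "G $ a $ b \<ge> 0" for a b
  proof (rule tendsto_lowerbound[OF lim])
    show "\<forall>\<^sub>F r in at_top. 0 \<le> (mat 1 + r *\<^sub>R G) $ a $ b / r"
      using ev
    proof eventually_elim
      case (elim r)
      then have "r > 0" by (simp add: good_def)
      then show ?case using res[OF elim] by (meson divide_nonneg_pos)
    qed
  qed simp
  have ineq: "G $ a $ c * G $ c $ b \<le> G $ a $ b * G $ c $ c" for a b c
  proof (rule tendsto_le[OF _ tendsto_mult[OF lim lim] tendsto_mult[OF lim lim]])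
    show "\<forall>\<^sub>F r in at_top. (mat 1 + r *\<^sub>R G) $ a $ c / r * ((mat 1 + r *\<^sub>R G) $ c $ b / r)
        \<le> (mat 1 + r *\<^sub>R G) $ a $ b / r * ((mat 1 + r *\<^sub>R G) $ c $ c / r)"
      using ev
    proof eventually_elim
      case (elim r)
      then have "r > 0" by (simp add: good_def)
      then show ?case using ineqK[OF elim, of a c b] unfolding times_divide_times_eq
        by (intro divide_right_mono) auto
    qed
  qed simp
  \<comment> \<open>If \<open>G $ i $ i = 0\<close>, then \<open>ineq\<close> with middle index
    \<open>i\<close> annihilates both cyclic products of every triple through \<open>i\<close>,
    making it symmetric.\<close>
  have diag: "G $ i $ i > 0" for i
  proof (rule ccontr)
    assume "\<not> G $ i $ i > 0"
    then have z: "G $ i $ i = 0" using Gnn[of i i] by simp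
    obtain j where j: "j \<noteq> i" using other_index[OF card, of i i i] by blast
    obtain k where k: "k \<noteq> i" "k \<noteq> j" "tri G i j k \<noteq> tri G i k j"
      using asymmetric_triple_exists[OF card one, of i j] j by metis
    have "G $ k $ i * G $ i $ j = 0" using ineq[of k i j] Gnn[of k i] Gnn[of i j] z
      by (metis mult_nonneg_nonneg mult_zero_right order_antisym)
    moreover have "G $ j $ i * G $ i $ k = 0" using ineq[of j i k] Gnn[of j i] Gnn[of i k] z
      by (metis mult_nonneg_nonneg mult_zero_right order_antisym)
    ultimately show False using k(3) by (auto simp: tri_def)
  qed
  \<comment> \<open>Rows of the resolvent, normalised to have diagonal entry \<open>1\<close>, stay bounded as \<open>r \<rightarrow> \<infinity>\<close>. A limit yields a row of
    the inverse of \<open>G\<close>, or else a dependency between rows of \<open>G\<close> with nonnegative coefficients; in the second case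
    \<open>ineq\<close> makes two rows proportional, and every triple containing both indices is symmetric.\<close>
  have row: "\<exists>b. (\<forall>j. (\<Sum>k\<in>UNIV. b k * G $ k $ j) = (if i = j then 1 else 0)) \<and> (\<forall>j. j \<noteq> i \<longrightarrow> b j \<le> 0)" for i
  proof -
    from ev obtain N where N: "\<And>r. r \<ge> N \<Longrightarrow> good r" by (auto simp: eventually_at_top_linorder)
    define rr where "rr n = max N 1 + real n" for n :: nat
    have rr: "good (rr n)" "rr n \<ge> 1" for n using N by (auto simp: rr_def)
    have rr_top: "filterlim rr at_top sequentially"
      unfolding rr_def by (intro filterlim_tendsto_add_at_top[OF tendsto_const] filterlim_real_sequentially)
    define A where "A n = resolvent G (rr n)" for n
    define K where "K n k j = (mat 1 + rr n *\<^sub>R G) $ k $ j / rr n" for n k j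
    have Klim: "(\<lambda>n. K n k j) \<longlonglongrightarrow> G $ k $ j" for k j
      unfolding K_def by (rule filterlim_compose[OF lim rr_top])
    have K_ne: "K n k j = G $ k $ j" if "k \<noteq> j" for n k j
      using that rr(2)[of n] by (simp add: K_def mat_def)
    have K_eq: "K n k k = G $ k $ k + 1 / rr n" for n k
      using rr(2)[of n] by (simp add: K_def mat_def add_divide_distrib)
    have K_ge: "K n k j \<ge> G $ k $ j" for n k j
      using rr(2)[of n] by (cases "k = j") (auto simp: K_ne K_eq)
    have Knn: "K n k j \<ge> 0" for n k j using K_ge[of k j n] Gnn[of k j] by linarith
    have Aoff: "A n $ i $ j \<le> 0" if "i \<noteq> j" for n j using res[OF rr(1)[of n]] that by (simp add: A_def)
    have Aii: "A n $ i $ i > 0" for n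
    proof -
      obtain v where v: "\<And>i. v $ i > 0" "A n *v v = (\<chi> i. 1)" using res[OF rr(1)[of n]] unfolding A_def by blast
      have "1 = (\<Sum>k\<in>UNIV. A n $ i $ k * v $ k)"
        using v(2) by (simp add: vec_eq_iff matrix_vector_mult_def)
      also have "\<dots> = A n $ i $ i * v $ i + (\<Sum>k\<in>UNIV - {i}. A n $ i $ k * v $ k)"
        by (simp add: sum.remove)
      also have "(\<Sum>k\<in>UNIV - {i}. A n $ i $ k * v $ k) \<le> 0"
        using Aoff v(1) by (intro sum_nonpos mult_nonpos_nonneg) (auto intro: less_imp_le)
      finally have "A n $ i $ i * v $ i \<ge> 1" by simp
      then show ?thesis using v(1)[of i] by (smt (verit) mult_nonpos_nonneg)
    qed
    \<comment> \<open>Row \<open>i\<close> of the resolvent divided by its diagonal entry is e_i -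
      w, and multiplying it by (I + r G) / r gives \<open>c n\<close> times e_i.\<close>
    define w where "w n = (\<chi> j. if j = i then 0 else - A n $ i $ j / A n $ i $ i)" for n
    define c where "c n = 1 / (rr n * A n $ i $ i)" for n
    have wnn: "w n $ j \<ge> 0" for n j
    proof (cases "j = i")
      case False
      then show ?thesis using Aoff[of j n] Aii[of n] by (simp add: w_def divide_nonpos_pos)
    qed (simp add: w_def)
    have rel: "K n i j - (\<Sum>k\<in>UNIV. w n $ k * K n k j) = (if i = j then c n else 0)" for n j
    proof -
      have "(\<Sum>k\<in>UNIV. A n $ i $ k * (mat 1 + rr n *\<^sub>R G) $ k $ j) / (rr n * A n $ i $ i)
          = (\<Sum>k\<in>UNIV. (if k = i then K n k j else 0) - w n $ k * K n k j)"
        unfolding sum_divide_distrib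
        using Aii[of n] rr(2)[of n] by (intro sum.cong) (auto simp: w_def K_def field_simps)
      also have "\<dots> = K n i j - (\<Sum>k\<in>UNIV. w n $ k * K n k j)" by (simp add: sum_subtractf)
      finally show ?thesis using AK[OF rr(1)[of n], of i j] by (auto simp: A_def c_def)
    qed
    have w_le: "w n $ k \<le> G $ i $ k / G $ k $ k" if k: "k \<noteq> i" for n k
    proof -
      have "w n $ k * G $ k $ k \<le> w n $ k * K n k k" using K_ge wnn by (simp add: mult_left_mono)
      also have "\<dots> \<le> (\<Sum>k'\<in>UNIV. w n $ k' * K n k' k)"
        by (rule member_le_sum) (auto intro: mult_nonneg_nonneg wnn Knn)
      also have "\<dots> = G $ i $ k" using rel[of n k] K_ne[of i k n] k by simp
      finally show ?thesis using diag[of k] by (simp add: pos_le_divide_eq)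
    qed
    have c_le: "c n \<le> G $ i $ i + 1" for n
    proof -
      have "0 \<le> (\<Sum>k\<in>UNIV. w n $ k * K n k i)" by (intro sum_nonneg mult_nonneg_nonneg wnn Knn)
      then have "c n \<le> K n i i" using rel[of n i] by simp
      also have "\<dots> \<le> G $ i $ i + 1" using rr(2)[of n] by (simp add: K_eq)
      finally show ?thesis .
    qed
    have c_nn: "c n \<ge> 0" for n using Aii[of n] rr(2)[of n] by (simp add: c_def)
    define S where "S = cbox 0 (\<chi> k. if k = i then 0 else G $ i $ k / G $ k $ k) \<times> {0..G $ i $ i + 1}"
    have "seq_compact S"
      unfolding S_def by (intro compact_imp_seq_compact compact_Times) auto
    moreover have "\<forall>n. (w n, c n) \<in> S"
      using wnn w_le c_le c_nn by (auto simp: S_def mem_box_cart w_def)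
    ultimately obtain l s where ls: "l \<in> S" "strict_mono s" "((\<lambda>n. (w n, c n)) \<circ> s) \<longlonglongrightarrow> l"
      by (rule seq_compactE)
    obtain w' c' where l: "l = (w', c')" by (cases l)
    have wlim: "(\<lambda>n. w (s n) $ k) \<longlonglongrightarrow> w' $ k" for k
      using tendsto_vec_nth[OF tendsto_fst[OF ls(3)], of k] by (simp add: l comp_def)
    have clim: "(\<lambda>n. c (s n)) \<longlonglongrightarrow> c'"
      using tendsto_snd[OF ls(3)] by (simp add: l comp_def)
    have w'nn: "w' $ k \<ge> 0" and w'i: "w' $ i = 0" and c'nn: "c' \<ge> 0" for k
      using ls(1) by (auto simp: S_def l mem_box_cart split: if_splits intro: order_antisym)
    have rel': "G $ i $ j - (\<Sum>k\<in>UNIV. w' $ k * G $ k $ j) = (if i = j then c' else 0)" for j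
    proof (rule LIMSEQ_unique)
      have "(\<lambda>n. K (s n) k j) \<longlonglongrightarrow> G $ k $ j" for k j
        using LIMSEQ_subseq_LIMSEQ[OF Klim ls(2)] by (simp add: comp_def)
      then show "(\<lambda>n. K (s n) i j - (\<Sum>k\<in>UNIV. w (s n) $ k * K (s n) k j)) \<longlonglongrightarrow> G $ i $ j - (\<Sum>k\<in>UNIV. w' $ k * G $ k $ j)"
        by (intro tendsto_diff tendsto_sum tendsto_mult wlim)
      show "(\<lambda>n. K (s n) i j - (\<Sum>k\<in>UNIV. w (s n) $ k * K (s n) k j)) \<longlonglongrightarrow> (if i = j then c' else 0)"
        unfolding rel using clim by simp
    qed
    have "c' \<noteq> 0"
    proof
      assume c0: "c' = 0"
      have dep: "G $ i $ j = (\<Sum>k\<in>UNIV. w' $ k * G $ k $ j)" for j using rel'[of j] c0 by (simp split: if_splits)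
      have "\<exists>m. w' $ m > 0"
      proof (rule ccontr)
        assume "\<not> (\<exists>m. w' $ m > 0)"
        then have "w' $ m = 0" for m using w'nn[of m] by (metis order_le_less)
        then show False using dep[of i] diag[of i] by simp
      qed
      then obtain m where m: "w' $ m > 0" by blast
      then have mi: "m \<noteq> i" using w'i by auto
      \<comment> \<open>By \<open>ineq\<close> each bracket below is nonnegative, while the
        dependency makes their sum with weights \<open>w'\<close> zero; so the bracket vanishes
        where the weight is positive.\<close>
      have proportional: "G $ m $ j * G $ i $ i = G $ m $ i * G $ i $ j" for j
      proof -
        have "(\<Sum>k\<in>UNIV. w' $ k * (G $ k $ j * G $ i $ i - G $ k $ i * G $ i $ j)) =
            (\<Sum>k\<in>UNIV. w' $ k * G $ k $ j) * G $ i $ i - (\<Sum>k\<in>UNIV. w' $ k * G $ k $ i) * G $ i $ j"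
          unfolding sum_distrib_right sum_subtractf[symmetric]
          by (rule sum.cong) (auto simp: algebra_simps)
        also have "\<dots> = 0" unfolding dep[symmetric] by simp
        finally have "\<forall>k\<in>UNIV. w' $ k * (G $ k $ j * G $ i $ i - G $ k $ i * G $ i $ j) = 0"
          using ineq w'nn by (subst (asm) sum_nonneg_eq_0_iff) auto
        then have "w' $ m * (G $ m $ j * G $ i $ i - G $ m $ i * G $ i $ j) = 0" by blast
        then show ?thesis using m by simp
      qed
      have Gmi: "G $ m $ i > 0"
      proof -
        have "G $ m $ i * G $ i $ m > 0" using proportional[of m] diag[of m] diag[of i] by (metis mult_pos_pos)
        then show ?thesis using Gnn[of m i] by (auto simp: zero_less_mult_iff)
      qed
      \<comment> \<open>Proportional rows turn \<open>ineq\<close> for \<open>l\<close>,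
        \<open>m\<close>, \<open>i\<close> into the reverse of \<open>ineq\<close> for
        \<open>l\<close>, \<open>i\<close>, \<open>m\<close>. Columns \<open>i\<close> and
        \<open>m\<close> are then proportional too, which equates the cyclic products.\<close>
      have sym: "sym_triple G {i, m, l}" if l: "l \<noteq> i" "l \<noteq> m" for l
      proof -
        have "G $ l $ m * G $ m $ i * G $ i $ i \<le> G $ l $ i * G $ m $ m * G $ i $ i"
          using ineq[of l m i] diag[of i] by (simp add: mult_right_mono)
        also have "\<dots> = G $ l $ i * G $ i $ m * G $ m $ i" using proportional[of m] by (simp add: mult_ac)
        finally have "G $ m $ i * (G $ l $ m * G $ i $ i) \<le> G $ m $ i * (G $ l $ i * G $ i $ m)" by (simp add: mult_ac)
        then have "G $ l $ m * G $ i $ i = G $ l $ i * G $ i $ m"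
          using Gmi ineq[of l i m] by (simp add: order_antisym)
        then have "tri G i l m * G $ i $ i = G $ i $ l * G $ m $ i * (G $ l $ i * G $ i $ m)"
          by (simp add: tri_def mult_ac)
        moreover have "tri G i m l * G $ i $ i = G $ i $ m * G $ l $ i * (G $ m $ i * G $ i $ l)"
          unfolding proportional[of l, symmetric] by (simp add: tri_def mult_ac)
        ultimately have "tri G i m l * G $ i $ i = tri G i l m * G $ i $ i" by (simp add: mult_ac)
        then have "tri G i m l = tri G i l m" using diag[of i] by simp
        then show ?thesis unfolding sym_triple_def using l mi by blast
      qed
      obtain k1 where k1: "k1 \<noteq> i" "k1 \<noteq> m" using other_index[OF card, of i m m] by blast
      obtain k2 where k2: "k2 \<noteq> i" "k2 \<noteq> m" "k2 \<noteq> k1" using other_index[OF card, of i m k1] by blast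
      have "{i, m, k1} = {i, m, k2}" using one sym[OF k1] sym[OF k2(1,2)] by blast
      then show False using k1 k2 by auto
    qed
    then have c': "c' > 0" using c'nn by simp
    show ?thesis
    proof (intro exI[of _ "\<lambda>k. ((if k = i then 1 else 0) - w' $ k) / c'"] conjI allI impI)
      fix j
      have "(\<Sum>k\<in>UNIV. ((if k = i then 1 else 0) - w' $ k) / c' * G $ k $ j) =
          (\<Sum>k\<in>UNIV. (if k = i then G $ k $ j else 0) - w' $ k * G $ k $ j) / c'"
        unfolding sum_divide_distrib by (rule sum.cong) (auto simp: algebra_simps diff_divide_distrib)
      also have "\<dots> = (if i = j then c' else 0) / c'"
        by (simp add: sum_subtractf rel')
      finally show "(\<Sum>k\<in>UNIV. ((if k = i then 1 else 0) - w' $ k) / c' * G $ k $ j) = (if i = j then 1 else 0)"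
        using c' by simp
      show "((if j = i then 1 else 0) - w' $ j) / c' \<le> 0" if "j \<noteq> i"
        using that w'nn[of j] c' by simp
    qed
  qed
  then obtain b where b: "\<And>i j. (\<Sum>k\<in>UNIV. b i k * G $ k $ j) = (if i = j then 1 else 0)" "\<And>i j. j \<noteq> i \<Longrightarrow> b i j \<le> 0"
    by metis
  show ?thesis
  proof (rule that[of "\<chi> i j. b i j"])
    show "(\<chi> i j. b i j) ** G = mat 1" using b(1) by (simp add: vec_eq_iff matrix_entry_mult mat_def)
  qed (use b(2) Gnn diag in auto)
qed

section \<open>Infinite divisibility\<close>

definition power_products :: "(('n::finite \<Rightarrow> real) \<Rightarrow> real) set" where
  "power_products = range (\<lambda>e s. \<Prod>i\<in>UNIV. s i ^ e i)"

interpretation cube: monomials "power_products :: (('n::finite \<Rightarrow> real) \<Rightarrow> real) set" "{s. \<forall>i. 0 \<le> s i \<and> s i \<le> 1}"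
proof
  show "(\<lambda>_. 1) \<in> (power_products :: (('n \<Rightarrow> real) \<Rightarrow> real) set)"
    unfolding power_products_def by (rule range_eqI[of _ _ "\<lambda>_. 0"]) simp
  show "(\<lambda>s. m s * m' s) \<in> power_products" if m: "m \<in> power_products" "m' \<in> power_products" for m m' :: "('n \<Rightarrow> real) \<Rightarrow> real"
  proof -
    obtain e e' where "m = (\<lambda>s. \<Prod>i\<in>UNIV. s i ^ e i)" "m' = (\<lambda>s. \<Prod>i\<in>UNIV. s i ^ e' i)"
      using m unfolding power_products_def by blast
    then have "(\<lambda>s. m s * m' s) = (\<lambda>s. \<Prod>i\<in>UNIV. s i ^ (e i + e' i))"
      by (simp add: power_add prod.distrib)
    then show ?thesis unfolding power_products_def by (intro range_eqI[of _ _ "\<lambda>i. e i + e' i"])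
  qed
  show "0 \<le> m s" if m: "m \<in> power_products" and s: "s \<in> {s. \<forall>i. 0 \<le> s i \<and> s i \<le> 1}" for m and s :: "'n \<Rightarrow> real"
    using m s unfolding power_products_def by (auto intro!: prod_nonneg)
qed

lemma coordinate_power_product: "(\<lambda>s. s i) \<in> power_products"
proof -
  have "s i = (\<Prod>j\<in>UNIV. s j ^ (if j = i then 1 else 0))" for s :: "'a \<Rightarrow> real"
  proof -
    have "(\<Prod>j\<in>UNIV. s j ^ (if j = i then 1 else 0)) = (\<Prod>j\<in>UNIV. if j = i then s j else 1)"
      by (rule prod.cong) auto
    then show ?thesis by simp
  qed
  then show ?thesis unfolding power_products_def by (intro range_eqI[of _ _ "\<lambda>j. if j = i then 1 else 0"]) blast
qed

lemma kernel_det_0: "kernel_det G (\<lambda>_. 0) = 1"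
proof -
  have "(\<chi> i j. (if i = j then 1 else 0) + 0 * G $ i $ j) = mat 1"
    by (simp add: mat_def vec_eq_iff)
  then show ?thesis unfolding kernel_det_def by (simp only: det_I)
qed

text \<open>Write B = d I - N with N nonnegative. Since B inverts G, I + \<alpha> G = (Diag \<alpha>
  + B) G, and with s_i = 1 / (1 + \<alpha>_i / d) row i of Diag \<alpha> + B is d / s_i times row i
  of I - Diag(s) N / d. The power \<open>- b\<close> of the determinant is thus a positive series in
  the s_i, whose monomials are gamma transforms.\<close>

lemma M_matrix_kernel_law:
  fixes G B :: "real^'n::finite^'n"
  assumes BG: "B ** G = mat 1" and off: "\<And>i j. i \<noteq> j \<Longrightarrow> B $ i $ j \<le> 0"
    and Gnn: "\<And>i j. G $ i $ j \<ge> 0" and diag: "\<And>i. G $ i $ i > 0"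
    and pos: "\<And>a. (\<And>i. a i \<ge> 0) \<Longrightarrow> kernel_det G a > 0" and b: "b > 0"
  shows "\<exists>\<mu> :: (real^'n) measure. prob_space \<mu> \<and> sets \<mu> = sets borel \<and> (AE x in \<mu>. \<forall>i. x $ i \<ge> 0) \<and>
    (\<forall>\<alpha>. (\<forall>i. \<alpha> $ i \<ge> 0) \<longrightarrow>
       (\<integral>x. exp (- (1/2) * (\<Sum>i\<in>UNIV. \<alpha> $ i * x $ i)) \<partial>\<mu>) = kernel_det G (\<lambda>i. \<alpha> $ i) powr - b)"
proof -
  \<comment> \<open>Large enough that d I - B is nonnegative on the diagonal; the 1 ensures
    \<open>d > 0\<close>.\<close>
  define d where "d = 1 + (\<Sum>i\<in>UNIV. \<bar>B $ i $ i\<bar>)"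
  have Bd: "B $ i $ i \<le> d" for i
  proof -
    have "\<bar>B $ i $ i\<bar> \<le> (\<Sum>i\<in>UNIV. \<bar>B $ i $ i\<bar>)" by (rule member_le_sum) auto
    then show ?thesis by (simp add: d_def)
  qed
  have d: "d > 0" unfolding d_def by (intro add_pos_nonneg sum_nonneg) auto
  define N where "N i j = (if i = j then d else 0) - B $ i $ j" for i j
  have Nnn: "N i j \<ge> 0" for i j using off[of i j] Bd[of i] by (auto simp: N_def)
  \<comment> \<open>The row sums of \<open>G\<close> solve B v = 1, so N v = d v - 1 is strictly
    below d v: the weights required by \<open>rseries_det_powr\<close>.\<close>
  define v where "v i = (\<Sum>j\<in>UNIV. G $ i $ j)" for i
  have v: "v i > 0" for i
    unfolding v_def using diag[of i] Gnn by (intro sum_pos2[of UNIV i]) auto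
  have Nv: "(\<Sum>j\<in>UNIV. N i j * v j) = d * v i - 1" for i
  proof -
    have "(\<Sum>j\<in>UNIV. B $ i $ j * v j) = (\<Sum>j\<in>UNIV. \<Sum>k\<in>UNIV. B $ i $ j * G $ j $ k)"
      by (simp add: v_def sum_distrib_left)
    also have "\<dots> = (\<Sum>k\<in>UNIV. \<Sum>j\<in>UNIV. B $ i $ j * G $ j $ k)" by (rule sum.swap)
    also have "\<dots> = (\<Sum>k\<in>UNIV. if i = k then 1 else 0)"
      using BG by (simp add: vec_eq_iff matrix_entry_mult mat_def)
    finally have Bv: "(\<Sum>j\<in>UNIV. B $ i $ j * v j) = 1" by simp
    have "(\<Sum>j\<in>UNIV. N i j * v j) = (\<Sum>j\<in>UNIV. (if i = j then d * v j else 0) - B $ i $ j * v j)"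
      by (rule sum.cong) (auto simp: N_def algebra_simps)
    then show ?thesis using Bv by (simp add: sum_subtractf)
  qed
  define F where "F i j s = N i j / d * s i" for i j and s :: "'n \<Rightarrow> real"
  let ?D = "{s :: 'n \<Rightarrow> real. \<forall>i. 0 \<le> s i \<and> s i \<le> 1}"
  have Fser: "cube.rseries (F i j)" for i j
    unfolding F_def using Nnn d
    by (intro cube.rseries_mult cube.rseries_const cube.rseries_monomial coordinate_power_product) auto
  have Frow: "(\<Sum>j\<in>UNIV. F i j s * v j) < v i" if s: "s \<in> ?D" for s i
  proof -
    have "(\<Sum>j\<in>UNIV. F i j s * v j) = s i * ((\<Sum>j\<in>UNIV. N i j * v j) / d)"
      unfolding F_def sum_divide_distrib sum_distrib_left by (rule sum.cong) auto
    also have "\<dots> \<le> 1 * ((\<Sum>j\<in>UNIV. N i j * v j) / d)"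
      using s d Nnn v by (intro mult_right_mono divide_nonneg_pos sum_nonneg mult_nonneg_nonneg) (auto intro: less_imp_le)
    also have "\<dots> < v i" unfolding Nv using d by (simp add: diff_divide_distrib)
    finally show ?thesis .
  qed
  define \<Delta> where "\<Delta> s = det (\<chi> i j. (if i = j then 1 else 0) - F i j s)" for s
  have "pad UNIV A = (\<chi> i j. A i j)" for A :: "'n \<Rightarrow> 'n \<Rightarrow> real" by (simp add: pad_def)
  then have ser: "cube.rseries (\<lambda>s. \<Delta> s powr - b)" and \<Delta>pos: "\<forall>s\<in>?D. \<Delta> s > 0"
    using cube.rseries_det_powr[of F b v UNIV, OF Fser b v Frow] by (simp_all add: \<Delta>_def)
  define \<kappa> where "\<kappa> = det G * d ^ CARD('n)"
  have kd: "kernel_det G a = \<kappa> * (\<Prod>i\<in>UNIV. 1 + a i / d) * \<Delta> (\<lambda>i. 1 / (1 + a i / d))"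
    if a: "\<And>i. a i \<ge> 0" for a
  proof -
    have p: "1 + a i / d > 0" for i using a[of i] d by (intro add_pos_nonneg) auto
    \<comment> \<open>This is Diag a + B with the factor d + a_i = d (1 + a_i / d) taken out of each
      row.\<close>
    define C :: "real^'n^'n" where "C = (\<chi> i. (d * (1 + a i / d)) *s (\<chi> j. (if i = j then 1 else 0) - F i j (\<lambda>i. 1 / (1 + a i / d))))"
    have C: "C $ i $ j = (if i = j then a i else 0) + B $ i $ j" for i j
    proof -
      have "C $ i $ j = d * (1 + a i / d) * (if i = j then 1 else 0) - N i j"
        using p[of i] d by (simp add: C_def F_def right_diff_distrib)
      then show ?thesis using d by (simp add: N_def distrib_left)
    qed
    have CG: "C ** G = (\<chi> i j. (if i = j then 1 else 0) + a i * G $ i $ j)"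
    proof -
      have "(C ** G) $ i $ j = a i * G $ i $ j + (B ** G) $ i $ j" for i j
      proof -
        have "(C ** G) $ i $ j = (\<Sum>k\<in>UNIV. (if i = k then a i * G $ k $ j else 0) + B $ i $ k * G $ k $ j)"
          unfolding matrix_entry_mult C by (rule sum.cong) (auto simp: distrib_right)
        then show ?thesis by (simp add: sum.distrib matrix_entry_mult)
      qed
      then show ?thesis by (simp add: vec_eq_iff BG mat_def)
    qed
    have "kernel_det G a = det (C ** G)" by (simp only: kernel_det_def CG)
    also have "\<dots> = det C * det G" by (rule det_mul)
    also have "det C = (\<Prod>i\<in>UNIV. d * (1 + a i / d)) * \<Delta> (\<lambda>i. 1 / (1 + a i / d))"
      unfolding C_def det_rows_mul \<Delta>_def ..
    finally show ?thesis by (simp add: \<kappa>_def prod.distrib mult_ac)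
  qed
  have p: "1 + a i / d > 0" if "\<And>i. a i \<ge> 0" for a :: "'n \<Rightarrow> real" and i using that[of i] d by (intro add_pos_nonneg) auto
  have D: "(\<lambda>i. 1 / (1 + a i / d)) \<in> ?D" if "\<And>i. a i \<ge> 0" for a
  proof -
    have "0 \<le> 1 / (1 + a i / d) \<and> 1 / (1 + a i / d) \<le> 1" for i
    proof -
      have "a i / d \<ge> 0" using that d by simp
      then show ?thesis by simp
    qed
    then show ?thesis by simp
  qed
  have \<kappa>: "\<kappa> > 0"
  proof -
    have "kernel_det G (\<lambda>_. 0) = \<kappa> * \<Delta> (\<lambda>i. 1)" using kd[of "\<lambda>_. 0"] by simp
    moreover have "\<Delta> (\<lambda>i. 1) > 0" using \<Delta>pos by simp
    ultimately show ?thesis by (simp add: kernel_det_0 zero_less_mult_iff) (metis less_asym zero_less_mult_iff zero_less_one)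
  qed
  obtain c m where cm: "\<And>j::nat. m j \<in> (power_products :: (('n \<Rightarrow> real) \<Rightarrow> real) set)"
    "\<And>s. s \<in> ?D \<Longrightarrow> ennreal (\<Delta> s powr - b) = (\<Sum>j. c j () * ennreal (m j s))"
  proof -
    obtain c m where "\<forall>j::nat. m j \<in> (power_products :: (('n \<Rightarrow> real) \<Rightarrow> real) set)"
      "\<forall>\<omega>::unit\<in>UNIV. \<forall>s\<in>?D. ennreal (\<Delta> s powr - b) = (\<Sum>j. c j \<omega> * ennreal (m j s))"
      using ser unfolding cube.rseries_def nonneg_series_def by auto
    then show ?thesis using that[of m c] by blast
  qed
  have "\<forall>j. \<exists>e. m j = (\<lambda>s. \<Prod>i\<in>UNIV. s i ^ e i)" using cm(1) by (simp add: power_products_def image_iff)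
  then obtain e where "\<forall>j. m j = (\<lambda>s. \<Prod>i\<in>UNIV. s i ^ e j i)" by (rule choice[THEN exE])
  then have e: "\<And>j s. m j s = (\<Prod>i\<in>UNIV. s i ^ e j i)" by simp
  define L where "L \<alpha> = kernel_det G (\<lambda>i. \<alpha> $ i) powr - b" for \<alpha>
  have Lser: "ennreal (L \<alpha>) = (\<Sum>j. ennreal (\<kappa> powr - b) * c j () * ennreal (\<Prod>i\<in>UNIV. (1 + \<alpha> $ i / d) powr - (b + real (e j i))))"
    if \<alpha>: "\<And>i. \<alpha> $ i \<ge> 0" for \<alpha>
  proof -
    let ?s = "\<lambda>i. 1 / (1 + \<alpha> $ i / d)"
    note pp = p[of "\<lambda>i. \<alpha> $ i", OF \<alpha>] and DD = D[of "\<lambda>i. \<alpha> $ i", OF \<alpha>]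
    have P: "(\<Prod>i\<in>UNIV. 1 + \<alpha> $ i / d) > 0" using pp by (intro prod_pos) auto
    have "L \<alpha> = \<kappa> powr - b * ((\<Prod>i\<in>UNIV. (1 + \<alpha> $ i / d) powr - b) * \<Delta> ?s powr - b)"
    proof -
      have "(\<Prod>i\<in>UNIV. (1 + \<alpha> $ i / d) powr - b) = (\<Prod>i\<in>UNIV. 1 + \<alpha> $ i / d) powr - b"
        using pp by (simp add: prod_powr_distrib less_imp_le)
      moreover have "\<Delta> ?s > 0" using \<Delta>pos DD by blast
      moreover have "kernel_det G (\<lambda>i. \<alpha> $ i) = \<kappa> * ((\<Prod>i\<in>UNIV. 1 + \<alpha> $ i / d) * \<Delta> ?s)"
        using kd[of "\<lambda>i. \<alpha> $ i", OF \<alpha>] by (simp only: mult.assoc)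
      ultimately show ?thesis using \<kappa> P unfolding L_def by (simp only: powr_mult less_imp_le mult_nonneg_nonneg)
    qed
    then have "ennreal (L \<alpha>) = ennreal (\<kappa> powr - b) * (ennreal (\<Prod>i\<in>UNIV. (1 + \<alpha> $ i / d) powr - b) * ennreal (\<Delta> ?s powr - b))"
      by (simp add: ennreal_mult prod_nonneg)
    also have "\<dots> = (\<Sum>j. ennreal (\<kappa> powr - b) * (ennreal (\<Prod>i\<in>UNIV. (1 + \<alpha> $ i / d) powr - b) * (c j () * ennreal (m j ?s))))"
      unfolding cm(2)[OF DD] by (simp only: ennreal_suminf_cmult)
    also have "\<dots> = (\<Sum>j. ennreal (\<kappa> powr - b) * c j () * ennreal (\<Prod>i\<in>UNIV. (1 + \<alpha> $ i / d) powr - (b + real (e j i))))"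
    proof (rule suminf_cong)
      fix j
      have "(\<Prod>i\<in>UNIV. (1 + \<alpha> $ i / d) powr - b) * m j ?s = (\<Prod>i\<in>UNIV. (1 + \<alpha> $ i / d) powr - (b + real (e j i)))"
        unfolding e prod.distrib[symmetric]
      proof (rule prod.cong[OF refl])
        fix i
        have "?s i ^ e j i = (1 + \<alpha> $ i / d) powr - real (e j i)"
          using pp[of i] by (simp add: powr_minus powr_realpow power_divide inverse_eq_divide)
        then show "(1 + \<alpha> $ i / d) powr - b * ?s i ^ e j i = (1 + \<alpha> $ i / d) powr - (b + real (e j i))"
          by (simp flip: powr_add)
      qed
      moreover have "m j ?s \<ge> 0" using cube.nonneg[OF cm(1) DD] .
      ultimately have "ennreal (\<Prod>i\<in>UNIV. (1 + \<alpha> $ i / d) powr - (b + real (e j i))) =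
          ennreal (\<Prod>i\<in>UNIV. (1 + \<alpha> $ i / d) powr - b) * ennreal (m j ?s)"
        by (simp add: prod_nonneg flip: ennreal_mult)
      then show "ennreal (\<kappa> powr - b) * (ennreal (\<Prod>i\<in>UNIV. (1 + \<alpha> $ i / d) powr - b) * (c j () * ennreal (m j ?s))) =
          ennreal (\<kappa> powr - b) * c j () * ennreal (\<Prod>i\<in>UNIV. (1 + \<alpha> $ i / d) powr - (b + real (e j i)))"
        by (simp only: mult_ac)
    qed
    finally show ?thesis .
  qed
  have L0: "L 0 = 1" by (simp add: L_def kernel_det_0)
  have Lnn: "L \<alpha> \<ge> 0" for \<alpha> by (simp add: L_def)
  from gamma_mixture_exists[OF b d Lser L0 Lnn]
  obtain \<mu> :: "(real^'n) measure" where \<mu>: "prob_space \<mu>" "sets \<mu> = sets borel" "AE x in \<mu>. \<forall>i. x $ i \<ge> 0"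
    and "\<And>\<alpha>. (\<And>i. \<alpha> $ i \<ge> 0) \<Longrightarrow> (\<integral>x. exp (- (1/2) * (\<Sum>i\<in>UNIV. \<alpha> $ i * x $ i)) \<partial>\<mu>) = L \<alpha>"
    by blast
  then show ?thesis unfolding L_def by blast
qed


section \<open>Convolution roots and conclusion\<close>

text \<open>On the product of \<open>k\<close> copies of the root law the coordinates are i.i.d.;
  the transform of their sum is the \<open>k\<close>-th power, that of \<open>psi\<close>, and
  uniqueness of Laplace transforms identifies the laws.\<close>

lemma infinitely_divisible_of_roots:
  fixes psi :: "'a \<Rightarrow> real^'n::finite" and G :: "real^'n^'n"
  assumes perm: "permanental_vector M psi G beta"
    and root: "\<And>k::nat. k \<ge> 1 \<Longrightarrow> \<exists>\<mu> :: (real^'n) measure. prob_space \<mu> \<and> sets \<mu> = sets borel \<and>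
      (AE x in \<mu>. \<forall>i. x $ i \<ge> 0) \<and> (\<forall>\<alpha>. (\<forall>i. \<alpha> $ i \<ge> 0) \<longrightarrow>
       (\<integral>x. exp (- (1/2) * (\<Sum>i\<in>UNIV. \<alpha> $ i * x $ i)) \<partial>\<mu>) = kernel_det G (\<lambda>i. \<alpha> $ i) powr - (beta / real k))"
  shows "infinitely_divisible M psi"
  unfolding infinitely_divisible_def
proof (intro allI impI)
  fix k :: nat assume k: "k \<ge> 1"
  obtain \<mu> :: "(real^'n) measure" where \<mu>: "prob_space \<mu>" "sets \<mu> = sets borel" "AE x in \<mu>. \<forall>i. x $ i \<ge> 0"
    and lap: "\<And>\<alpha>. (\<forall>i. \<alpha> $ i \<ge> 0) \<Longrightarrow>
       (\<integral>x. exp (- (1/2) * (\<Sum>i\<in>UNIV. \<alpha> $ i * x $ i)) \<partial>\<mu>) = kernel_det G (\<lambda>i. \<alpha> $ i) powr - (beta / real k)"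
    using root[OF k] by blast
  interpret \<mu>: prob_space \<mu> by fact
  interpret P: product_prob_space "\<lambda>_. \<mu>" "{..<k}" ..
  interpret M: prob_space M using perm by (simp add: permanental_vector_def)
  define N where "N = PiM {..<k} (\<lambda>_. \<mu>)"
  interpret N: prob_space N unfolding N_def by (rule prob_space_PiM) (rule \<mu>(1))
  have comp: "(\<lambda>\<omega>. \<omega> j) \<in> borel_measurable N" if "j < k" for j
    unfolding N_def measurable_cong_sets[OF refl \<mu>(2)[symmetric]]
    by (rule measurable_component_singleton) (use that in simp)
  have law: "distr N borel (\<lambda>\<omega>. \<omega> j) = \<mu>" if "j < k" for j
  proof -
    have "distr N borel (\<lambda>\<omega>. \<omega> j) = distr N \<mu> (\<lambda>\<omega>. \<omega> j)"
      by (rule distr_cong) (use \<mu>(2) in auto)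
    also have "\<dots> = \<mu>"
      unfolding N_def using distr_PiM_component[of "{..<k}" "\<lambda>_. \<mu>" j] \<mu>(1) that by simp
    finally show ?thesis .
  qed
  have psi: "psi \<in> borel_measurable M" "\<And>\<omega> i. \<omega> \<in> space M \<Longrightarrow> psi \<omega> $ i \<ge> 0"
    using perm by (auto simp: permanental_vector_def)
  have sum_meas: "(\<lambda>\<omega>. \<Sum>j<k. \<omega> j) \<in> borel_measurable N"
    by (intro borel_measurable_sum) (use comp in auto)
  have exp_meas: "(\<lambda>x. exp (- (1/2) * (\<Sum>i\<in>UNIV. \<alpha> $ i * x $ i))) \<in> borel_measurable borel" for \<alpha> :: "real^'n"
    by (intro borel_measurable_continuous_onI continuous_intros)
  have "distr N borel (\<lambda>\<omega>. \<Sum>j<k. \<omega> j) = distr M borel psi"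
  proof (rule laplace_transform_unique)
    show "prob_space (distr N borel (\<lambda>\<omega>. \<Sum>j<k. \<omega> j))" by (rule N.prob_space_distr[OF sum_meas])
    show "prob_space (distr M borel psi)" by (rule M.prob_space_distr[OF psi(1)])
    have pos_set: "{x::real^'n. \<forall>i. 0 \<le> x $ i} \<in> sets borel"
      by (intro borel_closed closed_Collect_all closed_Collect_le continuous_intros)
    have "AE \<omega> in N. \<forall>j\<in>{..<k}. \<forall>i. 0 \<le> \<omega> j $ i"
      unfolding N_def
      by (intro AE_finite_allI AE_PiM_component[where P="\<lambda>x. \<forall>i. 0 \<le> x $ i"]) (use \<mu> in auto)
    then have "AE \<omega> in N. \<forall>i. 0 \<le> (\<Sum>j<k. \<omega> j) $ i"
      by eventually_elim (auto intro!: sum_nonneg)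
    then show "AE x in distr N borel (\<lambda>\<omega>. \<Sum>j<k. \<omega> j). \<forall>i. 0 \<le> x $ i"
      using pos_set by (subst AE_distr_iff[OF sum_meas]) (auto simp: pred_def)
    show "AE x in distr M borel psi. \<forall>i. 0 \<le> x $ i"
      using pos_set psi by (subst AE_distr_iff[OF psi(1)]) auto
    fix \<alpha> :: "real^'n" assume \<alpha>: "\<And>i. 0 \<le> \<alpha> $ i"
    let ?f = "\<lambda>x. exp (- (1/2) * (\<Sum>i\<in>UNIV. \<alpha> $ i * x $ i)) :: real"
    have int: "integrable \<mu> ?f"
    proof (rule \<mu>.integrable_const_bound[of _ 1])
      show "AE x in \<mu>. norm (?f x) \<le> 1"
        using \<mu>(3) by eventually_elim (use \<alpha> in \<open>auto intro!: sum_nonneg mult_nonneg_nonneg\<close>)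
      show "?f \<in> borel_measurable \<mu>" unfolding measurable_cong_sets[OF \<mu>(2) refl] by (rule exp_meas)
    qed
    have "(\<integral>x. ?f x \<partial>distr N borel (\<lambda>\<omega>. \<Sum>j<k. \<omega> j)) = (\<integral>\<omega>. ?f (\<Sum>j<k. \<omega> j) \<partial>N)"
      by (rule integral_distr[OF sum_meas exp_meas])
    also have "\<dots> = (\<integral>\<omega>. (\<Prod>j<k. ?f (\<omega> j)) \<partial>N)"
    proof (rule Bochner_Integration.integral_cong[OF refl])
      fix \<omega> :: "nat \<Rightarrow> real^'n"
      have "(\<Sum>i\<in>UNIV. \<alpha> $ i * (\<Sum>j<k. \<omega> j) $ i) = (\<Sum>j<k. \<Sum>i\<in>UNIV. \<alpha> $ i * \<omega> j $ i)"
        by (simp add: sum_distrib_left) (rule sum.swap)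
      then show "?f (\<Sum>j<k. \<omega> j) = (\<Prod>j<k. ?f (\<omega> j))"
        by (simp only: sum_distrib_left exp_sum[OF finite_lessThan, symmetric])
    qed
    also have "\<dots> = (\<Prod>j<k. \<integral>x. ?f x \<partial>\<mu>)"
      unfolding N_def by (rule P.product_integral_prod) (use int in auto)
    also have "\<dots> = (kernel_det G (\<lambda>i. \<alpha> $ i) powr - (beta / real k)) ^ k" using lap \<alpha> by simp
    also have "\<dots> = kernel_det G (\<lambda>i. \<alpha> $ i) powr - beta"
      using permanental_det_pos[OF perm, of "\<lambda>i. \<alpha> $ i"] \<alpha> k by (simp add: powr_power)
    also have "\<dots> = (\<integral>\<omega>. ?f (psi \<omega>) \<partial>M)"
      using permanental_laplace[OF perm, of "\<lambda>i. \<alpha> $ i"] \<alpha> by simp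
    also have "\<dots> = (\<integral>x. ?f x \<partial>distr M borel psi)"
      by (rule integral_distr[OF psi(1) exp_meas, symmetric])
    finally show "(\<integral>x. ?f x \<partial>distr N borel (\<lambda>\<omega>. \<Sum>j<k. \<omega> j)) = (\<integral>x. ?f x \<partial>distr M borel psi)" .
  qed simp_all
  moreover have "N.indep_vars (\<lambda>_. borel) (\<lambda>j \<omega>. \<omega> j) {..<k}"
  proof (subst N.indep_vars_iff_distr_eq_PiM')
    show "{..<k} \<noteq> {}" using k by (simp add: lessThan_empty_iff)
    show "(\<lambda>\<omega>. \<omega> j) \<in> borel_measurable N" if "j \<in> {..<k}" for j using comp that by simp
    have "PiM {..<k} (\<lambda>j. distr N borel (\<lambda>\<omega>. \<omega> j)) = N"
      unfolding N_def[symmetric] by (subst PiM_cong[OF refl, of _ _ "\<lambda>_. \<mu>"]) (auto simp: law N_def[symmetric])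
    moreover have "distr N (PiM {..<k} (\<lambda>_. borel)) (\<lambda>x. \<lambda>i\<in>{..<k}. x i) = N"
    proof -
      have "sets (PiM {..<k} (\<lambda>_. borel)) = sets N"
        unfolding N_def by (rule sets_PiM_cong) (simp_all add: \<mu>(2))
      then have "distr N (PiM {..<k} (\<lambda>_. borel)) (\<lambda>x. \<lambda>i\<in>{..<k}. x i) = distr N N (\<lambda>x. x)"
        by (intro distr_cong) (auto simp: N_def space_PiM PiE_restrict)
      then show ?thesis by (simp add: distr_id)
    qed
    ultimately show "distr N (PiM {..<k} (\<lambda>_. borel)) (\<lambda>x. \<lambda>i\<in>{..<k}. x i) = PiM {..<k} (\<lambda>j. distr N borel (\<lambda>\<omega>. \<omega> j))"
      by simp
  qed
  ultimately show "\<exists>(N :: (nat \<Rightarrow> real^'n) measure) X. prob_space N \<and> (\<forall>j<k. X j \<in> borel_measurable N) \<and>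
      prob_space.indep_vars N (\<lambda>_. borel) X {..<k} \<and> (\<forall>j<k. distr N borel (X j) = distr N borel (X 0)) \<and>
      distr N borel (\<lambda>\<omega>. \<Sum>j<k. X j \<omega>) = distr M borel psi"
    using N.prob_space_axioms comp law k by (intro exI[of _ N] exI[of _ "\<lambda>j \<omega>. \<omega> j"]) auto
qed

theorem theorem1p1:
  fixes M :: "'a measure" and psi :: "'a \<Rightarrow> real^'n::finite"
    and G :: "real^'n^'n" and beta :: real
  assumes "CARD('n) > 3"
    and "beta > 0"
    and "permanental_vector M psi G beta"
    and "\<forall>I J. card I = 3 \<and> card J = 3
            \<and> symmetrizable_on I (\<lambda>i j. G $ i $ j) \<and> symmetrizable_on J (\<lambda>i j. G $ i $ j)
            \<longrightarrow> I = J"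
  shows "infinitely_divisible M psi"
proof -
  note card = assms(1) and beta = assms(2) and perm = assms(3)
  \<comment> \<open>Pair products of \<open>G\<close> are nonnegative, so equal cyclic products
    already give symmetrizability and the hypothesis bounds the number of symmetric triples.\<close>
  have sym_imp: "card I = 3 \<and> symmetrizable_on I (\<lambda>i j. G $ i $ j)" if I: "sym_triple G I" for I
  proof -
    obtain i j k where ijk: "I = {i, j, k}" "i \<noteq> j" "j \<noteq> k" "i \<noteq> k" "tri G i j k = tri G i k j"
      using I unfolding sym_triple_def by blast
    have "symmetrizable_on {i, j, k} (\<lambda>i j. G $ i $ j)"
      using ijk permanental_kernel_pair[OF perm beta]
      by (intro symmetrizable_on_3) (auto simp: tri_def)
    then show ?thesis using ijk by simp
  qed
  have one: "\<forall>I J. sym_triple G I \<longrightarrow> sym_triple G J \<longrightarrow> I = J"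
    using sym_imp assms(4) by blast
  obtain r where r: "r > 0" "\<forall>i j k. i \<noteq> j \<longrightarrow> j \<noteq> k \<longrightarrow> i \<noteq> k \<longrightarrow> tri G i j k \<noteq> tri G i k j \<longrightarrow>
      tri (resolvent G r) i j k \<noteq> tri (resolvent G r) i k j"
    using eventually_happens'[OF trivial_limit_at_top_linorder resolvent_eventually_asymmetric[OF perm]] by blast
  \<comment> \<open>A single \<open>r\<close> fixes the signs. The conjugated kernel still belongs
    to \<open>psi\<close> and has the same cyclic products, so the bound on symmetric triples
    carries over.\<close>
  obtain \<sigma> :: "'n \<Rightarrow> real" where \<sigma>: "\<And>i. \<sigma> i = 1 \<or> \<sigma> i = -1" "\<And>i j. 0 \<le> sign_conj \<sigma> (mat 1 + r *\<^sub>R G) $ i $ j"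
    by (rule resolvent_signature[OF perm beta card one r]) blast
  define G' where "G' = sign_conj \<sigma> G"
  have perm': "permanental_vector M psi G' beta" unfolding G'_def by (rule permanental_sign_conj[OF perm \<sigma>(1)])
  have off: "G' $ i $ j \<ge> 0" if "i \<noteq> j" for i j
  proof -
    have "0 \<le> r * G' $ i $ j" using \<sigma>(2)[of i j] that by (simp add: G'_def sign_conj_def mat_def mult_ac)
    then show ?thesis using r(1) by (simp add: zero_le_mult_iff)
  qed
  have "tri G' i j k = tri G i j k" for i j k
  proof -
    have sq: "\<sigma> l * \<sigma> l = 1" for l using \<sigma>(1)[of l] by auto
    have "tri G' i j k = (\<sigma> i * \<sigma> i) * (\<sigma> j * \<sigma> j) * (\<sigma> k * \<sigma> k) * tri G i j k"
      by (simp add: tri_def G'_def sign_conj_def mult_ac)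
    then show ?thesis by (simp add: sq)
  qed
  then have one': "\<forall>I J. sym_triple G' I \<longrightarrow> sym_triple G' J \<longrightarrow> I = J"
    using one unfolding sym_triple_def by simp
  obtain B where B: "B ** G' = mat 1" "\<And>i j. i \<noteq> j \<Longrightarrow> B $ i $ j \<le> 0" "\<And>i j. G' $ i $ j \<ge> 0" "\<And>i. G' $ i $ i > 0"
    by (rule nonneg_kernel_inverse[OF perm' beta card one' off]) (assumption, rule that)
  show ?thesis
  proof (rule infinitely_divisible_of_roots[OF perm'])
    fix k :: nat assume "k \<ge> 1"
    then have "beta / real k > 0" using beta by simp
    then show "\<exists>\<mu> :: (real^'n) measure. prob_space \<mu> \<and> sets \<mu> = sets borel \<and>
      (AE x in \<mu>. \<forall>i. x $ i \<ge> 0) \<and> (\<forall>\<alpha>. (\<forall>i. \<alpha> $ i \<ge> 0) \<longrightarrow>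
       (\<integral>x. exp (- (1/2) * (\<Sum>i\<in>UNIV. \<alpha> $ i * x $ i)) \<partial>\<mu>) = kernel_det G' (\<lambda>i. \<alpha> $ i) powr - (beta / real k))"
      by (intro M_matrix_kernel_law[of B]) (use B permanental_det_pos[OF perm'] in auto)
  qed
qed

end
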